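(* The facet inducing Steiner graphs with at most five terminals are Steiner trees and Steiner cacti; that is, a Steiner graph $(G,T)$ with $|T|\le 5$ is facet inducing if and only if it is a Steiner tree or a Steiner cactus.
   Context: Graphs are finite and have no loops or multiple edges. A Steiner graph $(G,T)$ consists of a connected graph $G$ with node set $V(G)$ and edge set $E(G)$ and a set $T\subseteq V(G)$ of terminals with $|T|\ge 2$. For $S\subseteq V(G)$, $\delta(S)$ is the set of edges with exactly one endnode in $S$. The cut $\delta(S)$ is a $T$-Steiner cut if $T\cap S\neq\varnothing$ and $T\setminus S\neq\varnothing$. The $T$-Steiner cut dominant is $\mathrm{CUT}_+(G,T)=\mathrm{conv}\{\chi(\delta(S)) : \delta(S)\text{ a }T\text{-Steiner cut}\}+\mathbb{R}_{\ge 0}^{E(G)}$, where $\chi(\cdot)$ denotes the $0/1$ incidence vector in $\mathbb{R}^{E(G)}$. For $c\in\mathbb{R}^{E(G)}$ and $F\subseteq E(G)$, $c(F)=\sum_{e\in F}c_e$. For a nonnegative vector $c$, $\gamma_c(G,T)$ is the minimum of $c(\delta(S))$ over all $T$-Steiner cuts. A vector is in minimum integer form if its components are nonnegative integers with greatest common divisor one. A vector $c$ provides facet weights for $(G,T)$ if $c$ is in minimum integer form, $c_e>0$ for all $e\in E(G)$, $\gamma_c(G,T)>0$, and $cx\ge\gamma_c(G,T)$ defines a facet of $\mathrm{CUT}_+(G,T)$; $(G,T)$ is facet inducing if it has facet weights. A Steiner tree is a Steiner graph $(G,T)$ where $G$ is a tree whose degree-one nodes are all in $T$. A cactus is a connected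 graph with at least one cycle in which every edge is contained in at most one cycle. A Steiner cactus is a Steiner graph $(G,T)$ where $G$ is a cactus whose degree-one nodes are in $T$ and in which every cycle contains at least three nodes that are cut nodes of $G$ or terminals. (A cut node of a connected graph $G$ is a node $w$ whose removal, together with its incident edges, leaves a disconnected graph.) *)

theory Defs
  imports "HOL-Analysis.Analysis"
begin

text \<open>
  A graph is given by its node set \<open>V\<close> and its edge set \<open>E\<close>, an edge being the two-element
  set of its endnodes.
\<close>

definition simple_graph :: "'a set \<Rightarrow> 'a set set \<Rightarrow> bool" where
  "simple_graph V E \<longleftrightarrow> finite V \<and> (\<forall>e\<in>E. e \<subseteq> V \<and> card e = 2)"

text \<open>
  The empty graph counts as connected here, so that the only node of a one-node graph is not
  a cut node. Steiner graphs are nonempty anyway.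
\<close>

definition connected_graph :: "'a set \<Rightarrow> 'a set set \<Rightarrow> bool" where
  "connected_graph V E \<longleftrightarrow> (\<forall>u\<in>V. \<forall>v\<in>V. (u, v) \<in> {(x, y). {x, y} \<in> E}\<^sup>*)"

definition node_degree :: "'a set set \<Rightarrow> 'a \<Rightarrow> nat" where
  "node_degree E v = card {e \<in> E. v \<in> e}"

text \<open>
  A cycle is identified with its edge set, so that rotations and reversals of a closed walk
  give the same cycle; the node set of a cycle \<open>C\<close> is \<open>\<Union>C\<close>.
\<close>

definition closed_walk_edges :: "'a list \<Rightarrow> 'a set set" where
  "closed_walk_edges vs = {{vs ! i, vs ! (Suc i mod length vs)} |i. i < length vs}"

definition is_cycle :: "'a set set \<Rightarrow> 'a set set \<Rightarrow> bool" where
  "is_cycle E C \<longleftrightarrow>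
     C \<subseteq> E \<and> (\<exists>vs. distinct vs \<and> length vs \<ge> 3 \<and> C = closed_walk_edges vs)"

definition tree :: "'a set \<Rightarrow> 'a set set \<Rightarrow> bool" where
  "tree V E \<longleftrightarrow> simple_graph V E \<and> connected_graph V E \<and> (\<nexists>C. is_cycle E C)"

definition cactus :: "'a set \<Rightarrow> 'a set set \<Rightarrow> bool" where
  "cactus V E \<longleftrightarrow> simple_graph V E \<and> connected_graph V E \<and> (\<exists>C. is_cycle E C) \<and>
     (\<forall>e\<in>E. \<forall>C C'. is_cycle E C \<and> e \<in> C \<and> is_cycle E C' \<and> e \<in> C' \<longrightarrow> C = C')"

definition cut_node :: "'a set \<Rightarrow> 'a set set \<Rightarrow> 'a \<Rightarrow> bool" where
  "cut_node V E w \<longleftrightarrow> w \<in> V \<and> \<not> connected_graph (V - {w}) {e \<in> E. w \<notin> e}"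

definition steiner_graph :: "'a set \<Rightarrow> 'a set set \<Rightarrow> 'a set \<Rightarrow> bool" where
  "steiner_graph V E T \<longleftrightarrow>
     simple_graph V E \<and> connected_graph V E \<and> T \<subseteq> V \<and> card T \<ge> 2"

definition steiner_tree :: "'a set \<Rightarrow> 'a set set \<Rightarrow> 'a set \<Rightarrow> bool" where
  "steiner_tree V E T \<longleftrightarrow>
     steiner_graph V E T \<and> tree V E \<and> (\<forall>v\<in>V. node_degree E v = 1 \<longrightarrow> v \<in> T)"

definition steiner_cactus :: "'a set \<Rightarrow> 'a set set \<Rightarrow> 'a set \<Rightarrow> bool" where
  "steiner_cactus V E T \<longleftrightarrow>
     steiner_graph V E T \<and> cactus V E \<and> (\<forall>v\<in>V. node_degree E v = 1 \<longrightarrow> v \<in> T) \<and>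
     (\<forall>C. is_cycle E C \<longrightarrow> card {v \<in> \<Union>C. cut_node V E v \<or> v \<in> T} \<ge> 3)"

definition edge_cut :: "'a set set \<Rightarrow> 'a set \<Rightarrow> 'a set set" where
  "edge_cut E S = {e \<in> E. card (e \<inter> S) = 1}"

definition steiner_cuts :: "'a set \<Rightarrow> 'a set set \<Rightarrow> 'a set \<Rightarrow> 'a set set set" where
  "steiner_cuts V E T = {edge_cut E S |S. S \<subseteq> V \<and> T \<inter> S \<noteq> {} \<and> T - S \<noteq> {}}"

text \<open>
  Nodes are taken from a finite type. The space of real vectors indexed by \<open>E\<close> is the
  coordinate subspace \<open>edge_space E\<close> of the Euclidean space indexed by all sets of nodes. The
  library notion of a facet compares affine dimensions, hence does not depend on the
  surrounding space.
\<close>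

definition edge_space :: "'a set set \<Rightarrow> (real ^ ('a::finite set)) set" where
  "edge_space E = {x. \<forall>e. e \<notin> E \<longrightarrow> x $ e = 0}"

definition incidence_vector :: "'a set set \<Rightarrow> real ^ ('a::finite set)" where
  "incidence_vector F = (\<chi> e. if e \<in> F then 1 else 0)"

definition cut_dominant ::
    "'a set \<Rightarrow> 'a set set \<Rightarrow> 'a set \<Rightarrow> (real ^ ('a::finite set)) set" where
  "cut_dominant V E T =
     {x + y |x y. x \<in> convex hull (incidence_vector ` steiner_cuts V E T) \<and>
                  y \<in> edge_space E \<and> (\<forall>e\<in>E. y $ e \<ge> 0)}"

definition min_steiner_cut ::
    "'a set \<Rightarrow> 'a set set \<Rightarrow> 'a set \<Rightarrow> real ^ ('a::finite set) \<Rightarrow> real" where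
  "min_steiner_cut V E T c = Min ((\<lambda>F. \<Sum>e\<in>F. c $ e) ` steiner_cuts V E T)"

definition min_integer_form :: "'a set set \<Rightarrow> real ^ ('a::finite set) \<Rightarrow> bool" where
  "min_integer_form E c \<longleftrightarrow>
     (\<exists>k :: 'a set \<Rightarrow> nat. (\<forall>e\<in>E. c $ e = real (k e)) \<and> Gcd (k ` E) = 1)"

definition defines_facet ::
    "'v::euclidean_space \<Rightarrow> real \<Rightarrow> 'v set \<Rightarrow> bool" where
  "defines_facet c d P \<longleftrightarrow> (\<forall>x\<in>P. c \<bullet> x \<ge> d) \<and> {x \<in> P. c \<bullet> x = d} facet_of P"

definition facet_weights ::
    "'a set \<Rightarrow> 'a set set \<Rightarrow> 'a set \<Rightarrow> real ^ ('a::finite set) \<Rightarrow> bool" where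
  "facet_weights V E T c \<longleftrightarrow>
     c \<in> edge_space E \<and> min_integer_form E c \<and> (\<forall>e\<in>E. c $ e > 0) \<and>
     min_steiner_cut V E T c > 0 \<and>
     defines_facet c (min_steiner_cut V E T c) (cut_dominant V E T)"

definition facet_inducing :: "('a::finite) set \<Rightarrow> 'a set set \<Rightarrow> 'a set \<Rightarrow> bool" where
  "facet_inducing V E T \<longleftrightarrow> steiner_graph V E T \<and> (\<exists>c. facet_weights V E T c)"

end

theory Submission
  imports Defs
begin

text \<open>
  Facet weights \<open>c\<close> are positive weights whose minimum Steiner cuts span the edge space.
  If \<open>(G, T)\<close> is a Steiner tree or cactus, take weight 2 on bridges and 1 on cycle edges (1 on all
  edges of a tree): single bridges and enough pairs of edges of a common cycle are minimum Steiner
  cuts, because every part of the graph hanging off a node contains a terminal.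

  Conversely, scale \<open>c\<close> to minimum cut value 2. Then \<open>c\<close> is the only vector meeting all Steiner cut
  constraints at cost at most that of \<open>c\<close>, where the cost of an edge is the number of tight sets it
  leaves. Extend the costs to all pairs of nodes by the shortest path metric and splitting off
  fractionally: this gives an optimal solution supported on pairs of terminals with all degrees 2.
  For at most five terminals it dominates, in cost, a Hamiltonian cycle on \<open>T\<close>; routing its edges
  along shortest paths yields a closed walk through all terminals, which must coincide with \<open>c\<close>.
  Hence \<open>c\<close> is integral and all cuts have even value. If two cycles shared an edge, there would be
  three edge-disjoint paths between two nodes, and one of them has at most one terminal hanging off
  it; trading the two parts of this path against each other moves \<open>c\<close> in both directions without
  violating a Steiner cut, contradicting that \<open>c\<close> is extremal. The same argument with the two arcs of
  a cycle shows that every cycle has three nodes that are cut nodes or terminals.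
\<close>

section \<open>Facets and tight cuts\<close>

text \<open>The bound five has two sources. Three edge-disjoint paths with common ends have disjoint
  sets of terminals hanging off them, so placing two terminals behind each takes six. And with five
  terminals one side of every cut has at most two of them, so that degree equations and upper bounds
  1 already imply all cut constraints; on six nodes the subtour polytope has fractional vertices
  (two triangles of halves joined by three edges of weight 1), and a tour as cheap as a fractional
  solution need not exist. The costs act as a dual certificate: nonnegative weights satisfying all
  Steiner cut constraints pay at least 2 for every tight set, so a solution of minimum cost is exact
  on all of them. Splitting off creates pairs that are no edges of the graph, which is why costs are
  extended to all pairs; the shortest path metric guarantees that splitting never raises the cost
  and that the tour can be put back into the graph at the same cost. Parity of the cut values is
  what makes trading work: a perturbed cut value that is positive and even is at least 2.\<close>

definition steiner_set :: "'a set \<Rightarrow> 'a set \<Rightarrow> 'a set \<Rightarrow> bool" where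
  "steiner_set V T S \<longleftrightarrow> S \<subseteq> V \<and> T \<inter> S \<noteq> {} \<and> T - S \<noteq> {}"

text \<open>The edge set is a parameter because the same functional is used for the graph itself and
  for the complete graphs on \<open>V\<close> and on \<open>T\<close>.\<close>

definition cut_value :: "'a set set \<Rightarrow> ('a set \<Rightarrow> real) \<Rightarrow> 'a set \<Rightarrow> real" where
  "cut_value E x S = sum x (edge_cut E S)"

lemma steiner_cuts_eq: "steiner_cuts V E T = edge_cut E ` {S. steiner_set V T S}"
  by (auto simp: steiner_cuts_def steiner_set_def)

lemma edge_cut_subset: "edge_cut E S \<subseteq> E"
  by (auto simp: edge_cut_def)

lemma inner_incidence_vector:
  "c \<bullet> incidence_vector F = (\<Sum>e\<in>F. c $ e)"
proof -
  have "c \<bullet> incidence_vector F = (\<Sum>e\<in>UNIV. if e \<in> F then c $ e else 0)"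
    by (auto simp: inner_vec_def incidence_vector_def intro!: sum.cong)
  also have "\<dots> = (\<Sum>e\<in>F. c $ e)" by (subst sum.If_cases) auto
  finally show ?thesis .
qed

lemma incidence_vector_in_edge_space: "F \<subseteq> E \<Longrightarrow> incidence_vector F \<in> edge_space E"
  by (auto simp: edge_space_def incidence_vector_def)

lemma subspace_edge_space: "subspace (edge_space E)"
  by (auto simp: edge_space_def subspace_def)

lemma dim_edge_space: "dim (edge_space E) = card E"
  using dim_substandard_cart[of E, where 'a=real] by (simp add: edge_space_def dim_vec_eq)

lemma steiner_cut_exists:
  assumes "steiner_graph V E T"
  shows "\<exists>S. steiner_set V T S"
proof -
  have "finite T" and "card T \<ge> 2" and "T \<subseteq> V"
    using assms by (auto simp: steiner_graph_def intro: card_ge_0_finite)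
  then obtain a b where "a \<in> T" "b \<in> T" "a \<noteq> b"
    by (metis card_2_iff' obtain_subset_with_card_n subsetD)
  then show ?thesis using \<open>T \<subseteq> V\<close> by (intro exI[of _ "{a}"]) (auto simp: steiner_set_def)
qed

lemma finite_steiner_cuts: "finite (steiner_cuts V E (T :: 'a::finite set))"
  by (rule finite_subset[of _ UNIV]) auto

lemma cut_dominant_decomp:
  "cut_dominant V E T = (\<Union>x\<in>convex hull (incidence_vector ` steiner_cuts V E T).
     \<Union>y\<in>{y \<in> edge_space E. \<forall>e\<in>E. y $ e \<ge> 0}. {x + y})"
  by (auto simp: cut_dominant_def)

lemma convex_cut_dominant: "convex (cut_dominant V E T)"
  unfolding cut_dominant_decomp
proof (rule convex_sums[OF convex_convex_hull])
  show "convex {y \<in> edge_space E. \<forall>e\<in>E. y $ e \<ge> 0}"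
    by (auto simp: convex_def edge_space_def)
qed

lemma incidence_vector_in_cut_dominant:
  "F \<in> steiner_cuts V E T \<Longrightarrow> incidence_vector F \<in> cut_dominant V E T"
  unfolding cut_dominant_def
  by (rule CollectI, rule exI[of _ "incidence_vector F"], rule exI[of _ 0])
    (auto simp: hull_inc edge_space_def)

lemma convex_hull_in_edge_space:
  "convex hull (incidence_vector ` steiner_cuts V E T) \<subseteq> edge_space E"
proof (rule hull_minimal)
  show "incidence_vector ` steiner_cuts V E T \<subseteq> edge_space E"
    using incidence_vector_in_edge_space[OF edge_cut_subset] by (auto simp: steiner_cuts_def)
  show "convex (edge_space E :: (real ^ 'a set) set)"
    by (rule subspace_imp_convex[OF subspace_edge_space])
qed

lemma cut_dominant_in_edge_space: "cut_dominant V E T \<subseteq> edge_space E"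
  using convex_hull_in_edge_space[of V E T] subspace_add[OF subspace_edge_space[of E]]
  by (fastforce simp: cut_dominant_def)

lemma min_steiner_cut_le:
  "steiner_set V T S \<Longrightarrow> min_steiner_cut V E T c \<le> cut_value E (\<lambda>e. c $ e) S"
  unfolding min_steiner_cut_def cut_value_def steiner_cuts_eq
  by (rule Min_le) (auto simp: image_image)

lemma cut_dominant_ge:
  assumes "\<And>e. e \<in> E \<Longrightarrow> c $ e \<ge> 0" and "\<And>S. steiner_set V T S \<Longrightarrow> d \<le> cut_value E (\<lambda>e. c $ e) S"
    and "x \<in> cut_dominant V E T"
  shows "d \<le> c \<bullet> x"
proof -
  obtain a y where x: "x = a + y" and a: "a \<in> convex hull (incidence_vector ` steiner_cuts V E T)"
    and y: "y \<in> edge_space E" "\<forall>e\<in>E. y $ e \<ge> 0"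
    using assms(3) by (auto simp: cut_dominant_def)
  have "convex hull (incidence_vector ` steiner_cuts V E T) \<subseteq> {z. c \<bullet> z \<ge> d}"
    by (rule hull_minimal)
      (auto simp: convex_halfspace_ge steiner_cuts_eq inner_incidence_vector
        assms(2)[unfolded cut_value_def])
  then have "c \<bullet> a \<ge> d" using a by auto
  moreover have "c \<bullet> y \<ge> 0"
  proof -
    have "c $ e * y $ e \<ge> 0" for e
      using y assms(1)[of e] by (cases "e \<in> E") (auto simp: edge_space_def)
    then show ?thesis by (simp add: inner_vec_def sum_nonneg)
  qed
  ultimately show ?thesis by (simp add: x inner_add_right)
qed

text \<open>For \<open>x = a + y\<close> on the face, the excess of \<open>c \<bullet> a\<close>
  over \<open>d\<close> and the cost of \<open>y\<close> are nonnegative with sum zero. Positive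
  weights then force \<open>y = 0\<close>, and cuts of value above \<open>d\<close> get coefficient
  zero in a convex combination giving \<open>a\<close>. So the face is the polytope of the tight
  cuts and has no unbounded direction.\<close>

lemma cut_dominant_eq_imp_hull:
  assumes pos: "\<And>e. e \<in> E \<Longrightarrow> c $ e > 0"
    and ge: "\<And>S. steiner_set V T S \<Longrightarrow> d \<le> cut_value E (\<lambda>e. c $ e) S"
    and x: "x \<in> cut_dominant V E T" "c \<bullet> x = d"
  shows "x \<in> convex hull (incidence_vector ` {F \<in> steiner_cuts V E T. (\<Sum>e\<in>F. c $ e) = d})"
proof -
  let ?I = "incidence_vector ` steiner_cuts V E T"
  obtain a y where xay: "x = a + y" and a: "a \<in> convex hull ?I"
    and y: "y \<in> edge_space E" "\<forall>e\<in>E. y $ e \<ge> 0"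
    using x(1) by (auto simp: cut_dominant_def)
  have fin: "finite ?I" using finite_steiner_cuts by auto
  have I_ge: "c \<bullet> z \<ge> d" if "z \<in> ?I" for z
    using that ge by (auto simp: steiner_cuts_eq inner_incidence_vector cut_value_def)
  obtain u where u: "\<forall>z\<in>?I. u z \<ge> 0" "sum u ?I = 1" "(\<Sum>z\<in>?I. u z *\<^sub>R z) = a"
    using a unfolding convex_hull_finite[OF fin] by auto
  have ca: "c \<bullet> a - d = (\<Sum>z\<in>?I. u z * (c \<bullet> z - d))"
    unfolding u(3)[symmetric] inner_sum_right
    using u(2) by (simp add: algebra_simps sum_subtractf sum_distrib_left[symmetric])
  have nn: "u z * (c \<bullet> z - d) \<ge> 0" if "z \<in> ?I" for z
    using that u(1) I_ge[OF that] by auto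
  have cy: "c \<bullet> y = (\<Sum>e\<in>UNIV. c $ e * y $ e)" by (simp add: inner_vec_def)
  have nny: "c $ e * y $ e \<ge> 0" for e
    using y pos[of e] by (cases "e \<in> E") (auto simp: edge_space_def intro: mult_nonneg_nonneg less_imp_le)
  have "c \<bullet> y \<ge> 0" unfolding cy by (intro sum_nonneg nny)
  moreover have "c \<bullet> a - d \<ge> 0" unfolding ca by (intro sum_nonneg nn)
  ultimately have z: "c \<bullet> y = 0" "c \<bullet> a - d = 0"
    using x(2) by (auto simp: xay inner_add_right)
  have "y $ e = 0" for e
  proof -
    have "c $ e * y $ e = 0"
      using z(1) unfolding cy using nny by (simp add: sum_nonneg_eq_0_iff)
    then show ?thesis using pos[of e] y(1) by (cases "e \<in> E") (auto simp: edge_space_def)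
  qed
  then have "y = 0" by (simp add: vec_eq_iff)
  let ?J = "incidence_vector ` {F \<in> steiner_cuts V E T. (\<Sum>e\<in>F. c $ e) = d}"
  have uz: "u z = 0" if "z \<in> ?I - ?J" for z
  proof -
    have "u z * (c \<bullet> z - d) = 0"
    proof -
      have "\<forall>z\<in>?I. u z * (c \<bullet> z - d) = 0"
        using z(2)[unfolded ca] nn
        by (subst (asm) sum_nonneg_eq_0_iff[OF fin]) blast+
      then show ?thesis using that by blast
    qed
    moreover have "c \<bullet> z - d \<noteq> 0" using that by (auto simp: inner_incidence_vector)
    ultimately show ?thesis by simp
  qed
  have sub: "?J \<subseteq> ?I" by auto
  have finJ: "finite ?J" using fin sub by (rule finite_subset[rotated])
  have "sum u ?J = 1" using sum.mono_neutral_right[OF fin sub, of u] uz u(2) by auto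
  moreover have "(\<Sum>z\<in>?J. u z *\<^sub>R z) = x"
    using sum.mono_neutral_right[OF fin sub, of "\<lambda>z. u z *\<^sub>R z"] uz u(3) xay \<open>y = 0\<close> by auto
  ultimately show ?thesis unfolding convex_hull_finite[OF finJ] using u(1) sub by blast
qed

text \<open>One cut vector together with its translates by the unit vectors of \<open>E\<close>
  gives \<open>card E + 1\<close> affinely independent points.\<close>

lemma aff_dim_cut_dominant_ge:
  assumes "steiner_graph V E T"
  shows "aff_dim (cut_dominant V E T) \<ge> int (card E)"
proof -
  obtain S where S: "steiner_set V T S" using steiner_cut_exists[OF assms] ..
  let ?x = "incidence_vector (edge_cut E S) :: real ^ 'a set"
  have x: "?x \<in> convex hull (incidence_vector ` steiner_cuts V E T)"
    using S by (auto simp: steiner_cuts_eq intro: hull_inc)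
  let ?A = "(\<lambda>e. axis e (1::real)) ` E :: (real ^ 'a set) set"
  have "(+) ?x ` insert 0 ?A \<subseteq> cut_dominant V E T"
  proof
    fix z assume "z \<in> (+) ?x ` insert 0 ?A"
    then obtain y where y: "z = ?x + y" "y \<in> insert 0 ?A" by auto
    have "y \<in> edge_space E" "\<forall>e\<in>E. y $ e \<ge> 0"
      using y(2) by (auto simp: edge_space_def axis_def)
    then show "z \<in> cut_dominant V E T"
      unfolding cut_dominant_def using x y(1) by blast
  qed
  then have "aff_dim ((+) ?x ` insert 0 ?A) \<le> aff_dim (cut_dominant V E T)"
    by (rule aff_dim_subset)
  then have le: "aff_dim (insert 0 ?A) \<le> aff_dim (cut_dominant V E T)"
    by (simp add: aff_dim_translation_eq del: image_insert)
  have "aff_dim (insert 0 ?A) = int (dim (insert 0 ?A))"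
    by (rule aff_dim_zero) (auto intro: hull_inc)
  moreover have "dim (insert 0 ?A) = dim ?A"
    by (metis dim_span span_insert_0)
  moreover have "independent ?A"
    by (rule independent_mono[OF independent_Basis]) (auto simp: Basis_vec_def)
  then have "dim ?A = card ?A" by (rule dim_eq_card_independent)
  moreover have "card ?A = card E"
    by (rule card_image) (auto simp: inj_on_def axis_eq_axis)
  ultimately show ?thesis using le by simp
qed

text \<open>The form in which the facet property is used: the tight cut equations determine the
  weights. Otherwise \<open>z\<close>, the difference of \<open>x\<close> and \<open>c\<close>, is a
  nonzero vector orthogonal to all tight cuts, so the facet lies in a proper linear subspace
  \<open>H\<close> of the edge space. By dimension its affine hull is all of \<open>H\<close> and
  contains the origin, where \<open>c\<close> does not take the positive value
  \<open>\<gamma>\<close>.\<close>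

proposition facet_weights_unique:
  assumes G: "steiner_graph V E T" and fw: "facet_weights V E T c"
    and x: "\<And>S. steiner_set V T S \<Longrightarrow> cut_value E (\<lambda>e. c $ e) S = min_steiner_cut V E T c \<Longrightarrow>
              cut_value E x S = min_steiner_cut V E T c"
    and e: "e \<in> E"
  shows "x e = c $ e"
proof (rule ccontr)
  assume ne: "x e \<noteq> c $ e"
  define \<gamma> where "\<gamma> = min_steiner_cut V E T c"
  have pos: "\<And>e. e \<in> E \<Longrightarrow> c $ e > 0" and \<gamma>: "\<gamma> > 0" and ces: "c \<in> edge_space E"
    and facet: "{y \<in> cut_dominant V E T. c \<bullet> y = \<gamma>} facet_of cut_dominant V E T"
    using fw by (auto simp: facet_weights_def defines_facet_def \<gamma>_def)
  define F where "F = {y \<in> cut_dominant V E T. c \<bullet> y = \<gamma>}"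
  define z :: "real ^ 'a set" where "z = (\<chi> e. if e \<in> E then x e - c $ e else 0)"
  have z_es: "z \<in> edge_space E" by (auto simp: z_def edge_space_def)
  have z_ne: "z $ e \<noteq> 0" using ne e by (simp add: z_def)
  have ge: "\<gamma> \<le> cut_value E (\<lambda>e. c $ e) S" if "steiner_set V T S" for S
    using min_steiner_cut_le[OF that] by (simp add: \<gamma>_def)
  have tight: "z \<bullet> incidence_vector D = 0"
    if D: "D \<in> steiner_cuts V E T" "(\<Sum>e\<in>D. c $ e) = \<gamma>" for D
  proof -
    obtain S where S: "steiner_set V T S" "D = edge_cut E S" using D(1) by (auto simp: steiner_cuts_eq)
    then have "cut_value E x S = \<gamma>" using x[OF S(1)] D(2) by (simp add: cut_value_def \<gamma>_def)
    moreover have "(\<Sum>e\<in>D. z $ e) = (\<Sum>e\<in>D. x e - c $ e)"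
      using edge_cut_subset[of E S] S(2) by (intro sum.cong) (auto simp: z_def)
    ultimately show ?thesis using D(2) S(2)
      by (simp add: inner_incidence_vector sum_subtractf cut_value_def)
  qed
  define H where "H = edge_space E \<inter> {y. z \<bullet> y = 0}"
  have sub_H: "subspace H"
    unfolding H_def by (intro subspace_inter subspace_edge_space subspace_hyperplane)
  have FH: "F \<subseteq> H"
  proof
    fix y assume y: "y \<in> F"
    then have "y \<in> convex hull (incidence_vector ` {D \<in> steiner_cuts V E T. (\<Sum>e\<in>D. c $ e) = \<gamma>})"
      unfolding F_def using cut_dominant_eq_imp_hull[of E c V T \<gamma> y] pos ge by auto
    moreover have "convex hull (incidence_vector ` {D \<in> steiner_cuts V E T. (\<Sum>e\<in>D. c $ e) = \<gamma>})
        \<subseteq> {y. z \<bullet> y = 0}"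
      by (rule hull_minimal) (auto simp: tight convex_hyperplane)
    ultimately show "y \<in> H"
      using y cut_dominant_in_edge_space[of V E T] by (auto simp: H_def F_def)
  qed
  have "H \<subset> edge_space E"
  proof -
    have "z \<bullet> z \<noteq> 0" using z_ne by auto
    then have "z \<notin> H" by (simp add: H_def)
    then show ?thesis using z_es H_def by blast
  qed
  then have "dim H < dim (edge_space E :: (real ^ 'a set) set)"
    using sub_H subspace_edge_space by (metis dim_psubset span_eq_iff)
  then have dimH: "dim H < card E" by (simp add: dim_edge_space)
  have "aff_dim F = aff_dim (cut_dominant V E T) - 1"
    using facet by (auto simp: facet_of_def F_def)
  then have dF: "aff_dim F \<ge> int (card E) - 1"
    using aff_dim_cut_dominant_ge[OF G] by simp
  have zero: "0 \<notin> affine hull F"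
  proof -
    have "affine hull F \<subseteq> {y. c \<bullet> y = \<gamma>}"
      by (rule hull_minimal) (auto simp: F_def affine_hyperplane)
    then show ?thesis using \<gamma> by auto
  qed
  have aH: "affine hull F \<subseteq> H"
    by (rule hull_minimal[OF FH]) (simp add: sub_H subspace_imp_affine)
  have "affine hull F = H"
  proof (rule affine_dim_equal)
    show "affine (affine hull F)" "affine H" "affine hull F \<subseteq> H"
      using aH sub_H by (auto simp: subspace_imp_affine)
    show "affine hull F \<noteq> {}" using facet by (auto simp: facet_of_def F_def)
    show "aff_dim (affine hull F) = aff_dim H"
      using dF dimH aff_dim_subset[OF aH] by (simp add: aff_dim_subspace sub_H)
  qed
  then show False using zero subspace_0[OF sub_H] by simp
qed

text \<open>A converse of uniqueness: if the tight cuts span the edge space, the face containing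
  them has dimension at least \<open>card E - 1\<close>. Being a proper face of a set of dimension
  at most \<open>card E\<close>, it is a facet.\<close>

proposition facet_weightsI:
  assumes G: "steiner_graph V E T"
    and k: "\<And>e. e \<in> E \<Longrightarrow> c $ e = real (k e)" "\<And>e. e \<in> E \<Longrightarrow> k e > 0" "Gcd (k ` E) = 1"
    and ces: "c \<in> edge_space E" and d: "d > 0"
    and ge: "\<And>S. steiner_set V T S \<Longrightarrow> d \<le> cut_value E (\<lambda>e. c $ e) S"
    and span: "\<And>e. e \<in> E \<Longrightarrow> axis e 1 \<in> span (incidence_vector ` {F \<in> steiner_cuts V E T. (\<Sum>e\<in>F. c $ e) = d})"
  shows "facet_weights V E T c"
proof -
  let ?P = "cut_dominant V E T"
  let ?I = "incidence_vector ` {F \<in> steiner_cuts V E T. (\<Sum>e\<in>F. c $ e) = d} :: (real ^ 'a set) set"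
  define F where "F = {x \<in> ?P. c \<bullet> x = d}"
  have IF: "?I \<subseteq> F" by (auto simp: F_def inner_incidence_vector incidence_vector_in_cut_dominant)
  have Pge: "d \<le> c \<bullet> x" if "x \<in> ?P" for x
    using cut_dominant_ge[OF _ ge that] k(1) by simp
  have "edge_space E \<subseteq> span ?I"
  proof
    fix x :: "real ^ 'a set" assume x: "x \<in> edge_space E"
    have "x = (\<Sum>e\<in>UNIV. x $ e *\<^sub>R axis e 1)" 
      using basis_expansion[of x] by (simp add: scalar_mult_eq_scaleR)
    moreover have "\<dots> \<in> span ?I"
      using x by (intro span_sum) (metis (mono_tags, lifting) edge_space_def mem_Collect_eq scaleR_eq_0_iff span_0 span_scale span)
    ultimately show "x \<in> span ?I" by simp
  qed
  then have "dim (edge_space E :: (real ^ 'a set) set) \<le> dim (span ?I)" by (rule dim_subset)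
  then have "card E \<le> dim (span ?I)" unfolding dim_edge_space .
  also have "dim (span ?I) = dim (insert 0 ?I)" by (simp only: dim_span[symmetric, of "insert 0 ?I"] span_insert_0)
  also have "int \<dots> = aff_dim (insert 0 ?I)" by (rule aff_dim_zero[symmetric]) (auto intro: hull_inc)
  also have "\<dots> \<le> aff_dim (insert 0 F)" using IF by (intro aff_dim_subset) auto
  \<comment> \<open>Passing from linear to affine dimension costs at most one: the origin may lie
    off the affine hull of \<open>F\<close>.\<close>
  also have "\<dots> \<le> aff_dim F + 1" by (simp add: aff_dim_insert)
  finally have dF: "int (card E) \<le> aff_dim F + 1" by simp
  have face: "F face_of ?P"
    unfolding F_def using Pge
    by (intro face_of_Int_supporting_hyperplane_ge[unfolded Int_def mem_Collect_eq] convex_cut_dominant)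
  obtain S where S: "steiner_set V T S" using steiner_cut_exists[OF G] ..
  have "E \<noteq> {}" using d ge[OF S] by (auto simp: cut_value_def edge_cut_def)
  have I_ne: "?I \<noteq> {}"
  proof
    assume I: "?I = {}"
    obtain e where "e \<in> E" using \<open>E \<noteq> {}\<close> by auto
    then have "(axis e 1 :: real ^ 'a set) \<in> {0}" using span[OF \<open>e \<in> E\<close>] unfolding I by simp
    then show False by (simp add: axis_eq_0_iff)
  qed
  then have "F \<noteq> {}" using IF by blast
  have "F \<noteq> ?P"
  proof
    assume "F = ?P"
    let ?x = "incidence_vector (edge_cut E S) :: real ^ 'a set"
    obtain e where e: "e \<in> E" using \<open>E \<noteq> {}\<close> by auto
    \<comment> \<open>Raising one coordinate of a cut vector stays in the dominant but changes the
      cost by \<open>c $ e > 0\<close>, so the face is proper.\<close>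
    have "?x + 0 \<in> ?P" "?x + axis e 1 \<in> ?P"
      unfolding cut_dominant_def using S e
      by (force simp: edge_space_def axis_def steiner_cuts_eq intro: hull_inc)+
    then have "c \<bullet> ?x = d" "c \<bullet> (?x + axis e 1) = d" using \<open>F = ?P\<close> by (auto simp: F_def)
    then have "c $ e = 0" by (simp add: inner_add_right inner_axis)
    then show False using k(1,2)[OF e] by simp
  qed
  then have lt: "aff_dim F < aff_dim ?P"
    by (intro face_of_aff_dim_lt convex_cut_dominant face)
  have "aff_dim ?P \<le> aff_dim (edge_space E :: (real ^ 'a set) set)"
    by (rule aff_dim_subset[OF cut_dominant_in_edge_space])
  also have "\<dots> = int (card E)" by (simp add: aff_dim_subspace subspace_edge_space dim_edge_space)
  finally have "aff_dim F = aff_dim ?P - 1" using lt dF by simp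
  then have facet: "F facet_of ?P" using face \<open>F \<noteq> {}\<close> by (simp add: facet_of_def)
  have "min_steiner_cut V E T c = d"
  proof -
    have "{F \<in> steiner_cuts V E T. (\<Sum>e\<in>F. c $ e) = d} \<noteq> {}" using I_ne by blast
    then show ?thesis unfolding min_steiner_cut_def
      using ge by (intro Min_eqI) (auto simp: finite_steiner_cuts cut_value_def steiner_cuts_eq)
  qed
  then show ?thesis
    unfolding facet_weights_def min_integer_form_def defines_facet_def
    using facet Pge k ces d by (auto simp: F_def)
qed

section \<open>Paths and cycles\<close>

definition reach :: "'a set set \<Rightarrow> ('a \<times> 'a) set" where
  "reach F = {(x, y). {x, y} \<in> F}\<^sup>*"

lemma connected_graph_iff: "connected_graph V E \<longleftrightarrow> (\<forall>u\<in>V. \<forall>v\<in>V. (u, v) \<in> reach E)"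
  by (simp add: connected_graph_def reach_def)

lemma reach_refl [simp]: "(u, u) \<in> reach F"
  by (simp add: reach_def)

lemma reach_trans: "(u, v) \<in> reach F \<Longrightarrow> (v, w) \<in> reach F \<Longrightarrow> (u, w) \<in> reach F"
  unfolding reach_def by (rule rtrancl_trans)

lemma reach_edge: "{u, v} \<in> F \<Longrightarrow> (u, v) \<in> reach F"
  by (auto simp: reach_def)

lemma reach_mono: "F \<subseteq> F' \<Longrightarrow> (u, v) \<in> reach F \<Longrightarrow> (u, v) \<in> reach F'"
  using rtrancl_mono[of "{(x, y). {x, y} \<in> F}" "{(x, y). {x, y} \<in> F'}"] by (auto simp: reach_def)

lemma reach_sym: "(u, v) \<in> reach F \<Longrightarrow> (v, u) \<in> reach F"
  unfolding reach_def by (rule symD[OF sym_rtrancl]) (auto simp: sym_def insert_commute)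

lemma reach_step: "(u, a) \<in> reach F \<Longrightarrow> {a, b} \<in> F \<Longrightarrow> (u, b) \<in> reach F"
  by (rule reach_trans[OF _ reach_edge])

lemma reach_common_source: "(u, a) \<in> reach F \<Longrightarrow> (u, b) \<in> reach F \<Longrightarrow> (a, b) \<in> reach F"
  by (rule reach_trans[OF reach_sym])

lemma reach_common_target: "(a, u) \<in> reach F \<Longrightarrow> (b, u) \<in> reach F \<Longrightarrow> (a, b) \<in> reach F"
  by (rule reach_trans[OF _ reach_sym])

lemma reach_induct [consumes 1, case_names base step]:
  assumes "(u, v) \<in> reach F" "P u"
    "\<And>x y. (u, x) \<in> reach F \<Longrightarrow> {x, y} \<in> F \<Longrightarrow> P x \<Longrightarrow> P y"
  shows "P v"
  using assms(1) unfolding reach_def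
proof (induction rule: rtrancl_induct)
  case base
  show ?case by (rule assms(2))
next
  case (step x y)
  then show ?case using assms(3) unfolding reach_def by simp
qed

lemma converse_reach_induct [consumes 1, case_names base step]:
  assumes "(u, v) \<in> reach F" "P v"
    "\<And>x y. {x, y} \<in> F \<Longrightarrow> (y, v) \<in> reach F \<Longrightarrow> P y \<Longrightarrow> P x"
  shows "P u"
  using assms(1) unfolding reach_def
proof (induction rule: converse_rtrancl_induct)
  case base
  show ?case by (rule assms(2))
next
  case (step x y)
  then show ?case using assms(3) unfolding reach_def by simp
qed

lemma reach_crossing:
  assumes "(u, v) \<in> reach F" "u \<in> S" "v \<notin> S"
  shows "\<exists>a b. {a, b} \<in> F \<and> a \<in> S \<and> b \<notin> S"
  using assms by (induction rule: reach_induct) auto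

lemma reach_closed:
  assumes "(u, v) \<in> reach F" "u \<in> S" "\<And>a b. {a, b} \<in> F \<Longrightarrow> a \<in> S \<Longrightarrow> b \<in> S"
  shows "v \<in> S"
  using reach_crossing[OF assms(1,2)] assms(3) by blast

text \<open>Follow a walk from \<open>u\<close> to \<open>x\<close>: after its last edge in
  \<open>F\<close> it stands at a node of \<open>W\<close> (at \<open>u\<close> if it uses none),
  and the rest avoids \<open>F\<close>. With the edges of paths or of a cycle as \<open>F\<close>,
  this finds a node at which \<open>x\<close> hangs on them.\<close>

lemma reach_attach:
  assumes "(u, x) \<in> reach E" "u \<in> W" "\<Union>F \<inter> \<Union>E \<subseteq> W"
  shows "\<exists>y\<in>W. (y, x) \<in> reach (E - F)"
  using assms(1)
proof (induction rule: reach_induct)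
  case base
  show ?case by (rule bexI[OF reach_refl assms(2)])
next
  case (step x z)
  then obtain y where y: "y \<in> W" "(y, x) \<in> reach (E - F)" by blast
  show ?case
  proof (cases "{x, z} \<in> F")
    case True
    then have "z \<in> W" using assms(3) step(2) by blast
    show ?thesis by (rule bexI[OF reach_refl \<open>z \<in> W\<close>])
  next
    case False
    then have "(x, z) \<in> reach (E - F)" using step(2) by (intro reach_edge) auto
    then show ?thesis using y by (meson reach_trans)
  qed
qed

text \<open>The edges traversed by a walk given by its nodes; a list, because walks may repeat edges
  and the multiplicities will become weights.\<close>

fun wedges :: "'a list \<Rightarrow> 'a set list" where
  "wedges (a # b # vs) = {a, b} # wedges (b # vs)"
| "wedges _ = []"

lemma wedges_append:
  "xs \<noteq> [] \<Longrightarrow> ys \<noteq> [] \<Longrightarrow> wedges (xs @ ys) = wedges xs @ {last xs, hd ys} # wedges ys"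
proof (induction xs rule: wedges.induct)
  case ("2_2" v)
  then show ?case by (cases ys) auto
qed auto

lemma wedges_append_common: "wedges (xs @ a # ys) = wedges (xs @ [a]) @ wedges (a # ys)"
  by (cases "xs = []"; cases ys) (auto simp: wedges_append)

lemma wedges_rev: "wedges (rev vs) = rev (wedges vs)"
proof (induction vs rule: wedges.induct)
  case (1 a b vs)
  have "wedges (rev (a # b # vs)) = wedges (rev (b # vs)) @ [{b, a}]"
    using wedges_append[of "rev (b # vs)" "[a]"] by simp
  then show ?case using 1 by (simp add: insert_commute)
qed auto

lemma wedges_subset: "e \<in> set (wedges vs) \<Longrightarrow> e \<subseteq> set vs"
  by (induction vs rule: wedges.induct) auto

lemma card_wedges: "distinct vs \<Longrightarrow> e \<in> set (wedges vs) \<Longrightarrow> card e = 2"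
  by (induction vs rule: wedges.induct) auto

lemma distinct_wedges: "distinct vs \<Longrightarrow> distinct (wedges vs)"
  by (induction vs rule: wedges.induct) (auto dest: wedges_subset)

lemma Union_wedges: "length vs \<ge> 2 \<Longrightarrow> \<Union>(set (wedges vs)) = set vs"
proof (induction vs rule: wedges.induct)
  case (1 a b vs)
  then show ?case by (cases vs) auto
qed auto

lemma reach_wedges:
  "set (wedges vs) \<subseteq> F \<Longrightarrow> vs \<noteq> [] \<Longrightarrow> x \<in> set vs \<Longrightarrow> (hd vs, x) \<in> reach F"
proof (induction vs rule: wedges.induct)
  case (1 a b vs)
  then have "x = a \<or> (b, x) \<in> reach F" "(a, b) \<in> reach F" by (auto intro: reach_edge)
  then show ?case by (auto intro: reach_trans)
qed auto

lemma distinct_path_exists: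
  assumes "(u, v) \<in> reach F"
  shows "\<exists>p. p \<noteq> [] \<and> hd p = u \<and> last p = v \<and> distinct p \<and> set (wedges p) \<subseteq> F"
  using assms
proof (induction rule: converse_reach_induct)
  case base
  then show ?case by (intro exI[of _ "[v]"]) auto
next
  case (step u x)
  then obtain p where p: "p \<noteq> []" "hd p = x" "last p = v" "distinct p" "set (wedges p) \<subseteq> F" by blast
  show ?case
  proof (cases "u \<in> set p")
    case True
    then obtain xs ys where "p = xs @ u # ys" by (meson split_list)
    then show ?thesis using p wedges_append_common[of xs u ys]
      by (intro exI[of _ "u # ys"]) auto
  next
    case False
    have "wedges (u # p) = {u, x} # wedges p" using p by (cases p) auto
    then show ?thesis using p False step(1) by (intro exI[of _ "u # p"]) auto
  qed
qed

lemma card_edge_inter: "a \<noteq> b \<Longrightarrow> card ({a, b} \<inter> S) = 1 \<longleftrightarrow> (a \<in> S) \<noteq> (b \<in> S)"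
  by (cases "a \<in> S"; cases "b \<in> S") (auto simp: Int_insert_left)

text \<open>Each crossing changes the side, so only the ends matter. Nodes may repeat, as this is
  also applied to closed walks; \<open>card e = 2\<close> excludes stationary steps.\<close>

lemma odd_crossings:
  "vs \<noteq> [] \<Longrightarrow> (\<And>e. e \<in> set (wedges vs) \<Longrightarrow> card e = 2) \<Longrightarrow>
    odd (length (filter (\<lambda>e. card (e \<inter> S) = 1) (wedges vs))) \<longleftrightarrow> (hd vs \<in> S) \<noteq> (last vs \<in> S)"
proof (induction vs rule: wedges.induct)
  case (1 a b vs)
  have "card {a, b} = 2" using 1(3) by simp
  then have "a \<noteq> b" by auto
  moreover have "odd (length (filter (\<lambda>e. card (e \<inter> S) = 1) (wedges (b # vs)))) \<longleftrightarrow>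
      (b \<in> S) \<noteq> (last (b # vs) \<in> S)"
    using 1(1) 1(3) by simp
  ultimately show ?case by (auto simp: card_edge_inter simp del: One_nat_def)
qed auto

lemma odd_card_edge_cut_path:
  assumes "distinct p" "p \<noteq> []"
  shows "odd (card (edge_cut (set (wedges p)) S)) \<longleftrightarrow> (hd p \<in> S) \<noteq> (last p \<in> S)"
proof -
  have "edge_cut (set (wedges p)) S = set (filter (\<lambda>e. card (e \<inter> S) = 1) (wedges p))"
    by (auto simp: edge_cut_def)
  then show ?thesis
    using odd_crossings[of p S] assms card_wedges[OF assms(1)]
      distinct_card[OF distinct_filter[OF distinct_wedges[OF assms(1)]], of "\<lambda>e. card (e \<inter> S) = 1"]
    by metis
qed

lemma edge_joining_path_ends:
  assumes "distinct p" "{hd p, last p} \<in> set (wedges p)"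
  shows "length p = 2"
proof -
  obtain a b vs where p: "p = a # b # vs" using assms(2) by (cases p rule: wedges.cases) auto
  have "{a, last (b # vs)} \<notin> set (wedges (b # vs))"
    using assms(1) wedges_subset[of "{a, last (b # vs)}" "b # vs"] by (auto simp: p)
  then have "{a, last (b # vs)} = {a, b}" using assms(2) by (auto simp: p)
  then have "last (b # vs) = b" using assms(1) by (auto simp: p doubleton_eq_iff)
  then show ?thesis using assms(1) by (cases vs) (auto simp: p split: if_splits)
qed

section \<open>Cycles, their arcs, and cycles through an edge\<close>

lemma set_wedges_nth: "set (wedges vs) = {{vs ! i, vs ! Suc i} |i. Suc i < length vs}"
proof (induction vs rule: wedges.induct)
  case (1 a b vs)
  have "{{(a # b # vs) ! i, (a # b # vs) ! Suc i} |i. Suc i < length (a # b # vs)} =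
    insert {a, b} {{(b # vs) ! i, (b # vs) ! Suc i} |i. Suc i < length (b # vs)}" (is "?L = ?R")
  proof
    show "?L \<subseteq> ?R"
    proof
      fix e assume "e \<in> ?L"
      then obtain i where i: "e = {(a # b # vs) ! i, (a # b # vs) ! Suc i}" "Suc i < length (a # b # vs)" by blast
      show "e \<in> ?R" using i by (cases i) auto
    qed
    show "?R \<subseteq> ?L"
    proof
      fix e assume "e \<in> ?R"
      then consider "e = {a, b}" | i where "e = {(b # vs) ! i, (b # vs) ! Suc i}" "Suc i < length (b # vs)" by blast
      then show "e \<in> ?L"
      proof cases
        case 1
        then show ?thesis by (intro CollectI exI[of _ 0]) auto
      next
        case (2 i)
        then show ?thesis by (intro CollectI exI[of _ "Suc i"]) auto
      qed
    qed
  qed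
  then show ?case using 1 by simp
qed auto

lemma closed_walk_edges_eq:
  assumes "vs \<noteq> []"
  shows "closed_walk_edges vs = insert {last vs, hd vs} (set (wedges vs))"
proof -
  obtain n where n: "length vs = Suc n" using assms by (cases vs) auto
  have "closed_walk_edges vs = {{vs ! i, vs ! (Suc i mod Suc n)} |i. i < n \<or> i = n}"
    by (auto simp: closed_walk_edges_def n less_Suc_eq)
  also have "\<dots> = insert {vs ! n, vs ! 0} {{vs ! i, vs ! Suc i} |i. i < n}"
    by (auto intro: exI[of _ n])
  finally show ?thesis
    using assms by (simp add: set_wedges_nth n last_conv_nth hd_conv_nth)
qed

lemma is_cycleI:
  assumes "distinct p" "length p \<ge> 3" "set (wedges p) \<subseteq> E" "{last p, hd p} \<in> E"
  shows "is_cycle E (insert {last p, hd p} (set (wedges p)))"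
  proof -
  have "p \<noteq> []" using assms(2) by auto
  then show ?thesis
    unfolding is_cycle_def using assms closed_walk_edges_eq[of p] by (intro conjI exI[of _ p]) auto
qed

lemma cycle_subset: "is_cycle E C \<Longrightarrow> C \<subseteq> E"
  by (simp add: is_cycle_def)

text \<open>Rotate the node list so that it starts at \<open>u\<close>, then cut it at
  \<open>v\<close>.\<close>

lemma cycle_arcs:
  assumes "is_cycle E C" "u \<in> \<Union>C" "v \<in> \<Union>C" "u \<noteq> v"
  obtains p q where "distinct p" "hd p = u" "last p = v" "distinct q" "hd q = v" "last q = u"
    "p \<noteq> []" "q \<noteq> []" "C = set (wedges p) \<union> set (wedges q)" "set (wedges p) \<inter> set (wedges q) = {}"
proof -
  obtain vs where vs: "distinct vs" "length vs \<ge> 3" "C = closed_walk_edges vs"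
    using assms(1) by (auto simp: is_cycle_def)
  then have C: "C = insert {last vs, hd vs} (set (wedges vs))" by (intro trans[OF vs(3) closed_walk_edges_eq]) auto
  have "\<Union>C \<subseteq> set vs" using C wedges_subset[of _ vs] vs(2) by (cases "vs = []") auto
  then have uv: "u \<in> set vs" "v \<in> set vs" using assms by auto
  obtain xs ys where xy: "vs = xs @ u # ys" using uv by (meson split_list)
  have "v \<in> set (ys @ xs)" using uv assms(4) xy by auto
  then obtain as bs where ab: "ys @ xs = as @ v # bs" by (meson split_list)
  have C': "C = insert {last (u # as @ v # bs), u} (set (wedges (u # as @ v # bs)))"
  proof (cases "xs = []")
    case True
    then show ?thesis using C xy ab by auto
  next
    case False
    have "C = insert {last (u # ys), hd xs} (set (wedges xs) \<union> insert {last xs, u} (set (wedges (u # ys))))"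
      using C False wedges_append[OF False, of "u # ys"] by (auto simp: xy)
    also have "\<dots> = insert {last xs, u} (set (wedges ((u # ys) @ xs)))"
      using False by (subst wedges_append) auto
    finally show ?thesis using False ab by (metis append_Cons last_appendR)
  qed
  let ?p = "u # as @ [v]" and ?q = "v # bs @ [u]"
  have dist: "distinct (u # as @ v # bs)"
  proof -
    have "distinct (u # (ys @ xs))" using vs(1) xy by auto
    then show ?thesis unfolding ab .
  qed
  have len: "length (u # as @ v # bs) \<ge> 3" using vs(2) ab xy by (metis length_append length_Cons add.commute add_Suc_right)
  have q: "wedges ?q = wedges (v # bs) @ [{last (v # bs), u}]"
    using wedges_append[of "v # bs" "[u]"] by simp
  have "wedges (u # as @ v # bs) = wedges ?p @ wedges (v # bs)"
    using wedges_append_common[of "u # as" v bs] by simp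
  then have CU: "C = set (wedges ?p) \<union> set (wedges ?q)" using C' q by auto
  \<comment> \<open>The arcs share only the nodes \<open>u\<close> and \<open>v\<close>, so a common
    edge would be \<open>{u, v}\<close> and each arc would consist of it alone, leaving fewer than
    three nodes.\<close>
  have disj: "set (wedges ?p) \<inter> set (wedges ?q) = {}"
  proof (rule ccontr)
    assume "set (wedges ?p) \<inter> set (wedges ?q) \<noteq> {}"
    then obtain e where e: "e \<in> set (wedges ?p)" "e \<in> set (wedges ?q)" by auto
    have "distinct ?p" "distinct ?q" using dist by auto
    have "e \<subseteq> {u, v}" using wedges_subset[OF e(1)] wedges_subset[OF e(2)] dist by auto
    moreover have "card e = 2" using card_wedges[OF \<open>distinct ?p\<close> e(1)] .
    ultimately have "e = {u, v}" using assms(4) by (intro card_seteq) auto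
    then have "length ?p = 2" "length ?q = 2"
      using edge_joining_path_ends[of ?p] edge_joining_path_ends[of ?q] e \<open>distinct ?p\<close> \<open>distinct ?q\<close>
      by (auto simp: insert_commute)
    then show False using len by auto
  qed
  show ?thesis
    by (rule that[of ?p ?q]) (use dist CU disj in auto)
qed

lemma cycle_minus_edge:
  assumes "is_cycle E C" "f \<in> C"
  obtains r where "distinct r" "r \<noteq> []" "{hd r, last r} = f" "hd r \<noteq> last r" "C = insert f (set (wedges r))"
    "f \<notin> set (wedges r)" "\<Union>C = set r"
proof -
  obtain vs where vs: "distinct vs" "length vs \<ge> 3" "C = closed_walk_edges vs"
    using assms(1) by (auto simp: is_cycle_def)
  have C: "C = insert {last vs, hd vs} (set (wedges vs))"
    using vs by (intro trans[OF vs(3) closed_walk_edges_eq]) auto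
  have "card f = 2"
    using assms(2) card_wedges[OF vs(1), of f] vs(1,2) unfolding C 
    by (cases vs rule: wedges.cases) (auto simp: card_insert_if)
  then obtain x y where xy: "f = {x, y}" "x \<noteq> y" by (auto simp: card_2_iff)
  obtain p q where pq: "distinct p" "hd p = x" "last p = y" "distinct q" "hd q = y" "last q = x"
    "p \<noteq> []" "q \<noteq> []" "C = set (wedges p) \<union> set (wedges q)" "set (wedges p) \<inter> set (wedges q) = {}"
    using cycle_arcs[OF assms(1), of x y] xy assms(2) by blast
  \<comment> \<open>One of the two arcs between the endnodes of \<open>f\<close> is \<open>f\<close>
    itself; the other one is \<open>r\<close>.\<close>
  have *: "\<exists>r. distinct r \<and> {hd r, last r} = f \<and> hd r \<noteq> last r \<and> r \<noteq> [] \<and> C = insert f (set (wedges r)) \<and> f \<notin> set (wedges r)"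
  proof (cases "f \<in> set (wedges p)")
    case True
    then have "length p = 2" using edge_joining_path_ends[of p] pq xy by auto
    then have "set (wedges p) = {f}" using True by (cases p rule: wedges.cases) auto
    then show ?thesis using pq xy by (intro exI[of _ q]) auto
  next
    case False
    then have fq: "f \<in> set (wedges q)" using assms(2) pq(9) by auto
    then have "length q = 2" using edge_joining_path_ends[of q] pq xy by (auto simp: insert_commute)
    then have "set (wedges q) = {f}" using fq by (cases q rule: wedges.cases) auto
    then show ?thesis using pq xy by (intro exI[of _ p]) auto
  qed
  then obtain r where r: "distinct r" "{hd r, last r} = f" "hd r \<noteq> last r" "r \<noteq> []" "C = insert f (set (wedges r))"
    "f \<notin> set (wedges r)" by blast
  have "length r \<ge> 2" using r(3,4) by (cases r rule: wedges.cases) auto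
  then have "\<Union>C = set r"
    using Union_wedges[of r] r(2,4,5) by (auto simp: insert_absorb)
  then show ?thesis using that[of r] r by blast
qed

lemma cycle_nonempty: "is_cycle E C \<Longrightarrow> C \<noteq> {}"
  by (auto simp: is_cycle_def closed_walk_edges_def) (metis less_le_trans zero_less_numeral)

lemma cycle_through_edge:
  assumes "{u, v} \<in> E" "u \<noteq> v" "(u, v) \<in> reach F" "F \<subseteq> E - {{u, v}}"
  obtains p where "hd p = u" "last p = v" "distinct p" "length p \<ge> 3" "set (wedges p) \<subseteq> F"
    "is_cycle E (insert {u, v} (set (wedges p)))"
proof -
  obtain p where p: "p \<noteq> []" "hd p = u" "last p = v" "distinct p" "set (wedges p) \<subseteq> F"
    using distinct_path_exists[OF assms(3)] by blast
  have "length p \<ge> 3"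
  proof (rule ccontr)
    assume "\<not> length p \<ge> 3"
    then have "length p = 0 \<or> length p = 1 \<or> length p = 2" by linarith
    then show False
    proof (elim disjE)
      assume "length p = 1"
      then show False using p assms(2) by (cases p) auto
    next
      assume "length p = 2"
      then obtain a b where "p = [a, b]" by (auto simp: length_Suc_conv numeral_2_eq_2)
      then show False using p assms(4) by auto
    qed (use p in auto)
  qed
  moreover have "is_cycle E (insert {last p, hd p} (set (wedges p)))"
    using p assms calculation by (intro is_cycleI) (auto simp: insert_commute)
  ultimately show ?thesis using that[of p] p by (simp add: insert_commute)
qed

text \<open>Equivalent to every edge lying on at most one cycle, but about a single cycle. Its
  failure directly yields three edge-disjoint paths between two nodes, and it makes the parts
  hanging off different nodes of a cycle disjoint.\<close>

definition ear_free :: "'a set set \<Rightarrow> bool" where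
  "ear_free E \<longleftrightarrow> (\<forall>C u v. is_cycle E C \<longrightarrow> u \<in> \<Union>C \<longrightarrow> v \<in> \<Union>C \<longrightarrow> (u, v) \<in> reach (E - C) \<longrightarrow> u = v)"

text \<open>If an ear joins \<open>u\<close> and \<open>v\<close>, the first edge
  \<open>{u, x}\<close> of the arc \<open>p\<close> closes to a cycle through the rest of
  \<open>p\<close> and edges outside \<open>C\<close>. It shares \<open>{u, x}\<close> with
  \<open>C\<close>, hence equals \<open>C\<close>, although it avoids the other arc
  \<open>q\<close>; so \<open>q\<close> would have no edges.\<close>

lemma ear_freeI_unique_cycles:
  assumes "\<forall>e\<in>E. \<forall>C C'. is_cycle E C \<and> e \<in> C \<and> is_cycle E C' \<and> e \<in> C' \<longrightarrow> C = C'"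
  shows "ear_free E"
  unfolding ear_free_def
proof (intro allI impI, rule ccontr)
  fix C u v assume C: "is_cycle E C" "u \<in> \<Union>C" "v \<in> \<Union>C" "(u, v) \<in> reach (E - C)" "u \<noteq> v"
  obtain p q where pq: "distinct p" "hd p = u" "last p = v" "distinct q" "hd q = v" "last q = u"
    "p \<noteq> []" "q \<noteq> []" "C = set (wedges p) \<union> set (wedges q)" "set (wedges p) \<inter> set (wedges q) = {}"
    using cycle_arcs[OF C(1-3,5)] .
  obtain x ps where p: "p = u # x # ps"
    using pq(1-3) C(5) pq(7) by (cases p rule: wedges.cases) auto
  let ?F = "(E - C) \<union> set (wedges (x # ps))"
  have ux: "{u, x} \<in> C" using pq(9) p by auto
  have nx: "{u, x} \<notin> set (wedges (x # ps))" using distinct_wedges[OF pq(1)] p by auto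
  have "(x, v) \<in> reach ?F"
    using reach_wedges[of "x # ps" ?F v] pq(3) p by (auto split: if_splits)
  moreover have "(u, v) \<in> reach ?F" using C(4) by (rule reach_mono[rotated]) auto
  ultimately have "(u, x) \<in> reach ?F" by (meson reach_trans reach_sym)
  moreover have "u \<noteq> x" using pq(1) p by auto
  moreover have "?F \<subseteq> E - {{u, x}}" using ux nx cycle_subset[OF C(1)] pq(9) p by auto
  ultimately obtain r where r: "set (wedges r) \<subseteq> ?F" "is_cycle E (insert {u, x} (set (wedges r)))"
    using cycle_through_edge[of u x E ?F] ux cycle_subset[OF C(1)] by blast
  then have "C = insert {u, x} (set (wedges r))"
    using assms C(1) ux cycle_subset[OF C(1)] by blast
  then have "C \<subseteq> insert {u, x} ((E - C) \<union> set (wedges (x # ps)))" using r by blast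
  then have "set (wedges q) \<subseteq> set (wedges p)" using pq(9) by (auto simp: p)
  then have "set (wedges q) = {}" using pq(10) by (metis inf.absorb_iff2)
  then show False using pq(4-6,8) C(5) by (cases q rule: wedges.cases) auto
qed

lemma first_edge_in:
  assumes "set (wedges p) \<inter> C \<noteq> {}"
  shows "\<exists>xs a b ys. p = xs @ a # b # ys \<and> {a, b} \<in> C \<and> set (wedges (xs @ [a])) \<inter> C = {}"
  using assms
proof (induction p rule: wedges.induct)
  case (1 a b vs)
  show ?case
  proof (cases "{a, b} \<in> C")
    case True
    then show ?thesis by (intro exI[of _ "[]"]) auto
  next
    case False
    then have "set (wedges (b # vs)) \<inter> C \<noteq> {}" using 1(2) by auto
    then obtain xs c d ys where *: "b # vs = xs @ c # d # ys" "{c, d} \<in> C" "set (wedges (xs @ [c])) \<inter> C = {}"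
      using 1(1) by blast
    have "wedges ((a # xs) @ [c]) = {a, b} # wedges (xs @ [c])"
      using *(1) by (cases xs) auto
    then show ?thesis using * False
      by (intro exI[of _ "a # xs"] exI[of _ c] exI[of _ d] exI[of _ ys]) auto
  qed
qed auto

text \<open>
  Two different cycles sharing an edge: the second one leaves the first one along an edge
  \<open>f\<close>, and the nodes at which it comes back to \<open>C\<close> on both sides of \<open>f\<close> are joined outside \<open>C\<close>.
\<close>

lemma unique_cyclesI_ear_free:
  assumes "ear_free E" "is_cycle E C" "is_cycle E C'" "e \<in> C" "e \<in> C'"
  shows "C' \<subseteq> C"
proof (rule ccontr)
  assume "\<not> C' \<subseteq> C"
  then obtain f where f: "f \<in> C'" "f \<notin> C" by auto
  obtain r where r: "distinct r" "r \<noteq> []" "{hd r, last r} = f" "C' = insert f (set (wedges r))"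
    using cycle_minus_edge[OF assms(3) f(1)] by metis
  have rE: "set (wedges r) \<subseteq> E" "f \<in> E" using cycle_subset[OF assms(3)] r(4) by auto
  have "set (wedges r) \<inter> C \<noteq> {}" using assms(4,5) f(2) r(4) by auto
  then obtain xs a b ys where 1: "r = xs @ a # b # ys" "{a, b} \<in> C" "set (wedges (xs @ [a])) \<inter> C = {}"
    using first_edge_in by metis
  have "set (wedges (rev r)) \<inter> C \<noteq> {}" using \<open>set (wedges r) \<inter> C \<noteq> {}\<close> by (simp add: wedges_rev)
  then obtain xs' a' b' ys' where 2: "rev r = xs' @ a' # b' # ys'" "{a', b'} \<in> C" "set (wedges (xs' @ [a'])) \<inter> C = {}"
    using first_edge_in by metis
  have r2: "r = rev ys' @ b' # a' # rev xs'" using arg_cong[OF 2(1), of rev] by simp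
  have ra: "(hd r, a) \<in> reach (E - C)"
  proof -
    have "set (wedges (xs @ [a])) \<subseteq> E - C"
      using rE 1(3) wedges_append_common[of xs a "b # ys"] by (auto simp: 1(1))
    then have "(hd (xs @ [a]), a) \<in> reach (E - C)" by (rule reach_wedges) auto
    then show ?thesis by (cases xs) (auto simp: 1(1))
  qed
  have ra': "(last r, a') \<in> reach (E - C)"
  proof -
    have "set (wedges (xs' @ [a'])) \<subseteq> set (wedges (rev r))"
      using wedges_append_common[of xs' a' "b' # ys'"] unfolding 2(1) by auto
    then have "set (wedges (xs' @ [a'])) \<subseteq> E - C"
      using rE 2(3) by (auto simp: wedges_rev)
    then have "(hd (xs' @ [a']), a') \<in> reach (E - C)" by (rule reach_wedges) auto
    moreover have "hd (xs' @ [a']) = last r" using 2(1) r(2) by (metis hd_append hd_rev list.sel(1))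
    ultimately show ?thesis by simp
  qed
  have rr: "(hd r, last r) \<in> reach (E - C)"
    using r(3) f rE by (intro reach_edge) auto
  have "(a, a') \<in> reach (E - C)"
    by (rule reach_trans[OF reach_trans[OF reach_sym[OF ra] rr] ra'])
  \<comment> \<open>If both returns happen at the same node \<open>a\<close>, the first edge of
    \<open>r\<close> in \<open>C\<close> leaves from \<open>a\<close> and the last one arrives at
    \<open>a\<close>. As \<open>r\<close> visits \<open>a\<close> only once, the last one would
    precede the first.\<close>
  then have "a = a'" using assms(1,2) 1(2) 2(2) unfolding ear_free_def by blast
  then have "xs @ a # b # ys = rev ys' @ b' # a # rev xs'" using 1(1) r2 by simp
  have ar: "a \<notin> set xs" "a \<notin> set (b # ys)" using r(1) 1(1) by auto
  have "r = (rev ys' @ [b']) @ a # rev xs'" using r2 \<open>a = a'\<close> by simp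
  then have "xs @ a # (b # ys) = (rev ys' @ [b']) @ a # rev xs'" using 1(1) by simp
  moreover have "a \<notin> set (rev ys' @ [b'])" using r(1) r2 \<open>a = a'\<close> by auto
  ultimately have eq: "xs = rev ys' @ [b']"
    using ar by (metis append_Cons_eq_iff)
  have "{b', a} \<in> set (wedges (xs @ [a]))"
    unfolding eq using wedges_append_common[of "rev ys'" b' "[a]"] by simp
  then show False using 1(3) 2(2) \<open>a = a'\<close> by (auto simp: insert_commute)
qed

section \<open>Steiner trees and cacti\<close>

lemma cycle_minus_node:
  assumes "is_cycle E C" "s \<in> \<Union>C" "x \<in> \<Union>C" "y \<in> \<Union>C" "x \<noteq> s" "y \<noteq> s"
  shows "(x, y) \<in> reach {e \<in> C. s \<notin> e}"
proof -
  obtain f where f: "f \<in> C" "s \<in> f" using assms(2) by auto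
  obtain r0 where r0: "distinct r0" "r0 \<noteq> []" "{hd r0, last r0} = f" "C = insert f (set (wedges r0))"
    "\<Union>C = set r0"
    using cycle_minus_edge[OF assms(1) f(1)] by metis
  define r where "r = (if hd r0 = s then r0 else rev r0)"
  have r: "distinct r" "r \<noteq> []" "hd r = s" "set (wedges r) \<subseteq> C" "\<Union>C = set r"
    using r0 f(2) by (auto simp: r_def wedges_rev hd_rev)
  then obtain r' where r': "r = s # r'" by (cases r) auto
  have "x \<in> set r'" "y \<in> set r'" using assms r(5) r' by auto
  moreover have "set (wedges r') \<subseteq> {e \<in> C. s \<notin> e}"
    using r(1,4) r' wedges_subset[of _ r'] by (cases r') auto
  ultimately have "(hd r', x) \<in> reach {e \<in> C. s \<notin> e}" "(hd r', y) \<in> reach {e \<in> C. s \<notin> e}"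
    by (intro reach_wedges; auto)+
  then show ?thesis by (rule reach_common_source)
qed

text \<open>Remove an edge: the remaining path crosses \<open>S\<close> an odd number of times
  exactly when the removed edge crosses it as well.\<close>

lemma even_card_edge_cut_cycle:
  assumes "is_cycle E C"
  shows "even (card (edge_cut C S))"
proof -
  obtain f where f: "f \<in> C" using cycle_nonempty[OF assms] by blast
  obtain r where r: "distinct r" "r \<noteq> []" "{hd r, last r} = f" "hd r \<noteq> last r" "C = insert f (set (wedges r))"
    "f \<notin> set (wedges r)"
    using cycle_minus_edge[OF assms f] by metis
  have "edge_cut C S = (if (hd r \<in> S) \<noteq> (last r \<in> S) then insert f (edge_cut (set (wedges r)) S) else edge_cut (set (wedges r)) S)"
    unfolding r(5) edge_cut_def using r(3,4) card_edge_inter[of "hd r" "last r" S] by auto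
  moreover have "f \<notin> edge_cut (set (wedges r)) S" "finite (edge_cut (set (wedges r)) S)"
    using r(6) by (auto simp: edge_cut_def)
  ultimately show ?thesis using odd_card_edge_cut_path[OF r(1,2), of S] by auto
qed

section \<open>Parts hanging off a node or a bridge contain terminals\<close>

lemma simple_graph_edge:
  assumes "simple_graph V E" "{a, b} \<in> E"
  shows "a \<in> V" "b \<in> V" "a \<noteq> b"
  using assms by (auto simp: simple_graph_def)

lemma simple_graph_edgeE:
  assumes "simple_graph V E" "e \<in> E"
  obtains a b where "e = {a, b}" "a \<noteq> b" "a \<in> V" "b \<in> V"
  using assms by (auto simp: simple_graph_def) (metis card_2_iff insert_subset)

lemma in_edge_cut_iff:
  "simple_graph V E \<Longrightarrow> {a, b} \<in> E \<Longrightarrow> {a, b} \<in> edge_cut E S \<longleftrightarrow> (a \<in> S) \<noteq> (b \<in> S)"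
  using simple_graph_edge(3)[of V E a b] card_edge_inter[of a b S] by (simp add: edge_cut_def)

lemma steiner_cut_nonempty:
  assumes "steiner_graph V E T" "steiner_set V T S"
  shows "edge_cut E S \<noteq> {}"
proof -
  obtain s t where st: "s \<in> S" "s \<in> V" "t \<in> V" "t \<notin> S"
    using assms by (auto simp: steiner_graph_def steiner_set_def)
  then have "(s, t) \<in> reach E" using assms(1) by (auto simp: steiner_graph_def connected_graph_iff)
  then obtain a b where "{a, b} \<in> E" "a \<in> S" "b \<notin> S" using reach_crossing[of s t E S] st by blast
  then have "{a, b} \<in> edge_cut E S" using in_edge_cut_iff[of V E a b S] assms(1) by (auto simp: steiner_graph_def)
  then show ?thesis by blast
qed

lemma cut_node_component:
  assumes "cut_node V E y" "w \<in> V" "w \<noteq> y"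
  obtains a where "a \<in> V" "a \<noteq> y" "(w, a) \<notin> reach {e \<in> E. y \<notin> e}"
proof -
  obtain a b where "a \<in> V - {y}" "b \<in> V - {y}" "(a, b) \<notin> reach {e \<in> E. y \<notin> e}"
    using assms(1) by (auto simp: cut_node_def connected_graph_iff)
  then have "(w, a) \<notin> reach {e \<in> E. y \<notin> e} \<or> (w, b) \<notin> reach {e \<in> E. y \<notin> e}"
    using reach_common_source[of w a "{e \<in> E. y \<notin> e}" b] by argo
  then show ?thesis using that[of a] that[of b] \<open>a \<in> V - {y}\<close> \<open>b \<in> V - {y}\<close> by auto
qed

text \<open>\<open>Q\<close> is attached to the rest of the graph only at \<open>w\<close>. If it
  had no terminal, there would be a smaller set of this kind inside it. When an edge
  \<open>{x, w}\<close> into \<open>Q\<close> lies on a cycle, the cycle has a special node besides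
  \<open>w\<close>, which must be a cut node with a component away from \<open>w\<close>. When the
  edge is a bridge, \<open>x\<close> is not a leaf and something hangs behind
  \<open>x\<close>.\<close>

lemma terminal_behind_node:
  assumes G: "simple_graph V E" "connected_graph V E"
    and deg: "\<forall>v\<in>V. node_degree E v = 1 \<longrightarrow> v \<in> T"
    and cyc: "\<forall>C. is_cycle E C \<longrightarrow> card {v \<in> \<Union>C. cut_node V E v \<or> v \<in> T} \<ge> 3"
    and Q: "Q \<subseteq> V" "Q \<noteq> {}" "w \<in> V" "w \<notin> Q" "\<And>a b. {a, b} \<in> E \<Longrightarrow> a \<in> Q \<Longrightarrow> b \<in> Q \<or> b = w"
  shows "Q \<inter> T \<noteq> {}"
  using Q
proof (induction "card Q" arbitrary: Q w rule: less_induct)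
  case less
  note Q = less.prems
  have finV: "finite V" using G(1) by (simp add: simple_graph_def)
  then have finQ: "finite Q" using Q(1) finite_subset by blast
  show ?case
  proof
    assume noT: "Q \<inter> T = {}"
    obtain q where "q \<in> Q" using Q(2) by auto
    then have "(q, w) \<in> reach E" using G(2) Q by (auto simp: connected_graph_iff)
    then obtain x where x: "{x, w} \<in> E" "x \<in> Q"
      using reach_crossing[of q w E Q] Q(4,5) \<open>q \<in> Q\<close> by blast
    have xw: "x \<noteq> w" using x(2) Q(4) by auto
    show False
    proof (cases "(x, w) \<in> reach (E - {{x, w}})")
      case True
      then obtain p where p: "hd p = x" "last p = w" "distinct p" "length p \<ge> 3"
        "set (wedges p) \<subseteq> E - {{x, w}}" and C: "is_cycle E (insert {x, w} (set (wedges p)))"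
        using cycle_through_edge[OF x(1) xw] by blast
      let ?C = "insert {x, w} (set (wedges p))"
      have pne: "p \<noteq> []" using p(4) by auto
      have "\<Union>?C = set p" using Union_wedges[of p] p(4) hd_in_set[OF pne] last_in_set[OF pne] p(1,2) by auto
      obtain p' where p': "p = p' @ [w]" using pne p(2) by (metis append_butlast_last_id)
      have p'ne: "p' \<noteq> []" using p(4) p' by auto
      \<comment> \<open>A path starting in \<open>Q\<close> can leave it only through
        \<open>w\<close>, which is its last node.\<close>
      have "set p' \<subseteq> Q"
      proof
        fix y assume "y \<in> set p'"
        then have "(hd p', y) \<in> reach (set (wedges p'))" using p'ne by (intro reach_wedges) auto
        moreover have "hd p' = x" using p(1) p' p'ne by simp
        ultimately have "(x, y) \<in> reach (set (wedges p'))" by simp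
        then show "y \<in> Q" using x(2)
        proof (rule reach_closed)
          fix a b assume ab: "{a, b} \<in> set (wedges p')" "a \<in> Q"
          then have "b \<in> set p'" using wedges_subset[OF ab(1)] by auto
          then have "b \<noteq> w" using p(3) p' by auto
          moreover have "{a, b} \<in> E" using ab(1) p(5) p' p'ne by (auto simp: wedges_append)
          ultimately show "b \<in> Q" using Q(5)[of a b] ab(2) by blast
        qed
      qed
      then have CQ: "\<Union>?C \<subseteq> insert w Q" using \<open>\<Union>?C = set p\<close> p' by auto
      have "card {v \<in> \<Union>?C. cut_node V E v \<or> v \<in> T} \<ge> 3" using cyc C by blast
      then have "\<not> {v \<in> \<Union>?C. cut_node V E v \<or> v \<in> T} \<subseteq> {w}"
        using card_mono[of "{w}" "{v \<in> \<Union>?C. cut_node V E v \<or> v \<in> T}"] by auto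
      then obtain y where y: "y \<in> \<Union>?C" "cut_node V E y \<or> y \<in> T" "y \<noteq> w" by blast
      then have "y \<in> Q" using CQ by auto
      then have cut: "cut_node V E y" using y noT by auto
      let ?Ey = "{e \<in> E. y \<notin> e}"
      obtain a where a: "a \<in> V" "a \<noteq> y" "(w, a) \<notin> reach ?Ey"
        using cut_node_component[OF cut Q(3)] y(3) by metis
      define Q' where "Q' = {z \<in> V. (a, z) \<in> reach ?Ey}"
      have y': "y \<notin> Q'"
      proof
        assume "y \<in> Q'"
        then have "(a, y) \<in> reach ?Ey" by (simp add: Q'_def)
        then have "y \<in> - {y}" by (rule reach_closed) (use a(2) in auto)
        then show False by simp
      qed
      \<comment> \<open>From a node outside \<open>Q\<close>, a simple path to \<open>w\<close>
        never enters \<open>Q\<close> and so misses \<open>y\<close>. Hence a component of the graph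
        without \<open>y\<close> that does not contain \<open>w\<close> lies inside
        \<open>Q\<close>.\<close>
      have Q'Q: "Q' \<subseteq> Q"
      proof
        fix z assume z: "z \<in> Q'"
        show "z \<in> Q"
        proof (rule ccontr)
          assume zQ: "z \<notin> Q"
          have "(z, w) \<in> reach E" using z Q(3) G(2) by (auto simp: Q'_def connected_graph_iff)
          then obtain r where r: "r \<noteq> []" "hd r = z" "last r = w" "distinct r" "set (wedges r) \<subseteq> E"
            using distinct_path_exists by metis
          obtain r' where r': "r = r' @ [w]" using r by (metis append_butlast_last_id)
          have "set r' \<inter> Q = {}"
          proof (cases "r' = []")
            case False
            have "b \<notin> Q" if "b \<in> set r'" for b
            proof -
              have "(z, b) \<in> reach (set (wedges r'))"
                using reach_wedges[of r' "set (wedges r')" b] that False r(2) r' by auto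
              then have "b \<in> - Q"
              proof (rule reach_closed)
                show "z \<in> - Q" using zQ by simp
                fix c d assume cd: "{c, d} \<in> set (wedges r')" "c \<in> - Q"
                then have "c \<in> set r'" using wedges_subset[OF cd(1)] by auto
                then have "c \<noteq> w" using r(4) r' by auto
                moreover have "{d, c} \<in> E" using cd(1) r(5) r' False by (auto simp: wedges_append insert_commute)
                ultimately show "d \<in> - Q" using Q(5)[of d c] cd(2) by blast
              qed
              then show ?thesis by simp
            qed
            then show ?thesis by blast
          qed auto
          then have "y \<notin> set r" using \<open>y \<in> Q\<close> y(3) r' by auto
          then have "set (wedges r) \<subseteq> ?Ey" using r(5) wedges_subset by fastforce
          then have "(z, w) \<in> reach ?Ey" using reach_wedges[of r ?Ey w] r last_in_set[of r] by metis
          have "(a, z) \<in> reach ?Ey" using z by (simp add: Q'_def)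
          from reach_sym[OF reach_trans[OF this \<open>(z, w) \<in> reach ?Ey\<close>]] a(3) show False by simp
        qed
      qed
      have "Q' \<subset> Q" using Q'Q y' \<open>y \<in> Q\<close> by blast
      then have "card Q' < card Q" using finQ psubset_card_mono by blast
      moreover have "Q' \<subseteq> V" "Q' \<noteq> {}" "y \<in> V" using a \<open>y \<in> Q\<close> Q(1) by (auto simp: Q'_def)
      moreover have "d \<in> Q' \<or> d = y" if "{c, d} \<in> E" "c \<in> Q'" for c d
      proof (cases "d = y")
        case False
        then have cd: "{c, d} \<in> ?Ey" using that y' by auto
        have "(a, c) \<in> reach ?Ey" using that(2) by (simp add: Q'_def)
        then have "(a, d) \<in> reach ?Ey" using cd by (rule reach_step)
        then show ?thesis using simple_graph_edge[OF G(1) that(1)] by (simp add: Q'_def)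
      qed auto
      ultimately have "Q' \<inter> T \<noteq> {}" using less.hyps[of Q' y] y' by blast
      then show False using noT Q'Q by blast
    next
      case False
      let ?E = "E - {{x, w}}"
      have "x \<in> V" using x(2) Q(1) by auto
      have "node_degree E x \<noteq> 1" using deg x(2) noT \<open>x \<in> V\<close> by auto
      then have "card {e \<in> E. x \<in> e} \<noteq> 1" unfolding node_degree_def .
      moreover have "card {{x, w}} = 1" by simp
      ultimately have "{e \<in> E. x \<in> e} \<noteq> {{x, w}}" by metis
      then have "\<exists>e. e \<in> E \<and> x \<in> e \<and> e \<noteq> {x, w}" using x(1) by auto
      then obtain e where e: "e \<in> E" "x \<in> e" "e \<noteq> {x, w}" by auto
      then obtain x' where x': "e = {x, x'}" "x' \<noteq> x"
        using simple_graph_edgeE[OF G(1) e(1)] by (metis insertE insert_commute singletonD)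
      define Q' where "Q' = {z \<in> V. (x, z) \<in> reach ?E} - {x}"
      have xx': "(x, x') \<in> reach ?E" using e x' by (intro reach_edge) auto
      have "x' \<in> Q'" using simple_graph_edge[OF G(1), of x x'] e(1) x' xx' by (auto simp: Q'_def)
      have Q'Q: "Q' \<subseteq> Q"
      proof
        fix z assume "z \<in> Q'"
        then have "(x, z) \<in> reach ?E" by (simp add: Q'_def)
        then have "z \<in> Q \<inter> {z. (x, z) \<in> reach ?E}"
        proof (rule reach_closed)
          show "x \<in> Q \<inter> {z. (x, z) \<in> reach ?E}" using x(2) by auto
          fix a b assume ab: "{a, b} \<in> ?E" "a \<in> Q \<inter> {z. (x, z) \<in> reach ?E}"
          then have "(x, b) \<in> reach ?E" by (auto intro: reach_step[of x a])
          moreover have "b \<noteq> w" using calculation False by auto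
          ultimately show "b \<in> Q \<inter> {z. (x, z) \<in> reach ?E}" using ab Q(5)[of a b] by blast
        qed
        then show "z \<in> Q" by simp
      qed
      have "Q' \<subset> Q" using Q'Q x(2) by (auto simp: Q'_def)
      then have "card Q' < card Q" using finQ psubset_card_mono by blast
      moreover have "Q' \<subseteq> V" "Q' \<noteq> {}" "x \<notin> Q'" using \<open>x' \<in> Q'\<close> by (auto simp: Q'_def)
      moreover have "d \<in> Q' \<or> d = x" if "{c, d} \<in> E" "c \<in> Q'" for c d
      proof -
        have "c \<noteq> x" "c \<noteq> w" using that(2) Q'Q Q(4) by (auto simp: Q'_def)
        then have "{c, d} \<in> ?E" using that(1) by (auto simp: doubleton_eq_iff)
        then have "(x, d) \<in> reach ?E" using that(2) by (auto intro: reach_step[of x c] simp: Q'_def)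
        then show ?thesis using simple_graph_edge[OF G(1) that(1)] by (simp add: Q'_def)
      qed
      ultimately have "Q' \<inter> T \<noteq> {}" using less.hyps[of Q' x] \<open>x \<in> V\<close> by blast
      then show False using noT Q'Q by blast
    qed
  qed
qed

text \<open>Each of the two components left by the bridge hangs on the endnode in the other one, so
  \<open>terminal_behind_node\<close> puts a terminal into both.\<close>

lemma bridge_steiner_cut:
  assumes G: "steiner_graph V E T"
    and deg: "\<forall>v\<in>V. node_degree E v = 1 \<longrightarrow> v \<in> T"
    and cyc: "\<forall>C. is_cycle E C \<longrightarrow> card {v \<in> \<Union>C. cut_node V E v \<or> v \<in> T} \<ge> 3"
    and e: "e \<in> E" "\<nexists>C. is_cycle E C \<and> e \<in> C"
  shows "{e} \<in> steiner_cuts V E T"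
proof -
  have sg: "simple_graph V E" "connected_graph V E" "T \<subseteq> V" using G by (auto simp: steiner_graph_def)
  obtain u v where uv: "e = {u, v}" "u \<noteq> v" "u \<in> V" "v \<in> V" using simple_graph_edgeE[OF sg(1) e(1)] .
  have nr: "(u, v) \<notin> reach (E - {e})"
    using cycle_through_edge[of u v E "E - {e}"] e uv(1,2) by blast
  define R where "R x = {z \<in> V. (x, z) \<in> reach (E - {e})}" for x
  have T: "R x \<inter> T \<noteq> {}" if "(x = u \<and> y = v) \<or> (x = v \<and> y = u)" for x y
  proof (rule terminal_behind_node[OF sg(1,2) deg cyc])
    show "R x \<subseteq> V" "R x \<noteq> {}" "y \<in> V" using that uv by (auto simp: R_def)
    show "y \<notin> R x" using that nr reach_sym[of v u "E - {e}"] by (auto simp: R_def)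
    fix a b assume ab: "{a, b} \<in> E" "a \<in> R x"
    show "b \<in> R x \<or> b = y"
    proof (cases "{a, b} = e")
      case True
      then have "b = x \<or> b = y" using that uv(1) by (auto simp: doubleton_eq_iff)
      then show ?thesis using that uv by (auto simp: R_def)
    next
      case False
      then have "(x, b) \<in> reach (E - {e})" using ab by (auto intro: reach_step[of x a] simp: R_def)
      then show ?thesis using simple_graph_edge[OF sg(1) ab(1)] by (simp add: R_def)
    qed
  qed
  have disj: "R u \<inter> R v = {}" using nr reach_common_target[of u _ "E - {e}" v] by (auto simp: R_def)
  have "edge_cut E (R v) = {e}"
  proof
    show "{e} \<subseteq> edge_cut E (R v)"
      using in_edge_cut_iff[OF sg(1), of u v] e(1) uv nr reach_sym[of v u "E - {e}"] by (auto simp: R_def)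
    show "edge_cut E (R v) \<subseteq> {e}"
    proof
      fix f assume f: "f \<in> edge_cut E (R v)"
      then have "f \<in> E" using edge_cut_subset by blast
      then obtain a b where ab: "f = {a, b}" "a \<in> V" "b \<in> V" using simple_graph_edgeE[OF sg(1)] by metis
      show "f \<in> {e}"
      proof (rule ccontr)
        assume "f \<notin> {e}"
        then have "(a, b) \<in> reach (E - {e})" using \<open>f \<in> E\<close> ab by (intro reach_edge) auto
        then have "a \<in> R v \<longleftrightarrow> b \<in> R v" using ab(2,3) reach_trans[of v a "E - {e}" b] reach_trans[of v b "E - {e}" a] reach_sym[of a b "E - {e}"]
          by (auto simp: R_def)
        then show False using in_edge_cut_iff[OF sg(1), of a b "R v"] f \<open>f \<in> E\<close> ab by auto
      qed
    qed
  qed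
  moreover have "steiner_set V T (R v)"
    using T[of v u] T[of u v] disj by (auto simp: steiner_set_def R_def)
  ultimately show ?thesis unfolding steiner_cuts_eq by blast
qed

section \<open>Facet weights of Steiner trees and cacti\<close>

lemma incidence_vector_singleton: "incidence_vector {e} = axis e 1"
  by (auto simp: incidence_vector_def axis_def vec_eq_iff)

lemma steiner_tree_facet_inducing:
  assumes "steiner_tree V E T"
  shows "facet_inducing V E T"
proof -
  have G: "steiner_graph V E T" and deg: "\<forall>v\<in>V. node_degree E v = 1 \<longrightarrow> v \<in> T"
    and noC: "\<nexists>C. is_cycle E C" using assms by (auto simp: steiner_tree_def tree_def)
  define c :: "real ^ 'a set" where "c = (\<chi> e. if e \<in> E then 1 else 0)"
  obtain S where "steiner_set V T S" using steiner_cut_exists[OF G] ..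
  then have "edge_cut E S \<noteq> {}" by (rule steiner_cut_nonempty[OF G])
  then have Ene: "E \<noteq> {}" using edge_cut_subset by blast
  have "facet_weights V E T c"
  proof (rule facet_weightsI[where k = "\<lambda>_. 1" and d = 1])
    show "steiner_graph V E T" by (rule G)
    show "c \<in> edge_space E" by (simp add: c_def edge_space_def)
    show "Gcd ((\<lambda>_. 1 :: nat) ` E) = 1" using Ene by (simp add: image_constant_conv)
    show "1 \<le> cut_value E (\<lambda>e. c $ e) S" if "steiner_set V T S" for S
    proof -
      have "cut_value E (\<lambda>e. c $ e) S = (\<Sum>e\<in>edge_cut E S. 1)"
        unfolding cut_value_def using edge_cut_subset by (intro sum.cong) (auto simp: c_def)
      moreover have "card (edge_cut E S) > 0" using steiner_cut_nonempty[OF G that] by (auto simp: card_gt_0_iff)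
      ultimately show ?thesis by simp
    qed
    show "axis e 1 \<in> span (incidence_vector ` {F \<in> steiner_cuts V E T. (\<Sum>e\<in>F. c $ e) = 1})" if "e \<in> E" for e
    proof -
      have "{e} \<in> steiner_cuts V E T" using bridge_steiner_cut[OF G deg _ that] noC by blast
      then have "incidence_vector {e} \<in> incidence_vector ` {F \<in> steiner_cuts V E T. (\<Sum>e\<in>F. c $ e) = 1}"
        using that by (auto simp: c_def)
      then show ?thesis unfolding incidence_vector_singleton by (rule span_base)
    qed
  qed (auto simp: c_def)
  then show ?thesis using G by (auto simp: facet_inducing_def)
qed

text \<open>Cut after the first node with \<open>P\<close>; the rest has lost only this one. Two
  applications divide an opened cycle into three segments with a special node each.\<close>

lemma split_list_special:
  assumes "card {v \<in> set q. P v} \<ge> Suc n"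
  shows "\<exists>q1 q2. q = q1 @ q2 \<and> (\<exists>x\<in>set q1. P x) \<and> card {v \<in> set q2. P v} \<ge> n"
proof -
  have "{v \<in> set q. P v} \<noteq> {}" using assms by force
  then obtain ys x zs where q: "q = ys @ x # zs" "P x" "\<forall>y\<in>set ys. \<not> P y"
    using split_list_first_prop[of q P] by blast
  have "{v \<in> set q. P v} \<subseteq> insert x {v \<in> set zs. P v}" using q by auto
  then have "card {v \<in> set q. P v} \<le> card (insert x {v \<in> set zs. P v})" by (intro card_mono) auto
  also have "\<dots> \<le> Suc (card {v \<in> set zs. P v})" by (rule card_insert_le_m1) auto
  finally show ?thesis using q assms by (intro exI[of _ "ys @ [x]"] exI[of _ zs]) auto
qed

lemma edge_cut_within:
  assumes "\<And>f. f \<in> F \<Longrightarrow> card f = 2" "\<And>f. f \<in> F \<Longrightarrow> f \<subseteq> B" "B \<subseteq> A \<or> B \<inter> A = {}"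
  shows "edge_cut F A = {}"
proof -
  have "card (f \<inter> A) \<noteq> 1" if "f \<in> F" for f
  proof -
    have "f \<inter> A = f \<or> f \<inter> A = {}" using assms(2)[OF that] assms(3) by auto
    then show ?thesis using assms(1)[OF that] by auto
  qed
  then show ?thesis by (auto simp: edge_cut_def)
qed

lemma steiner_cactus_facet_inducing:
  assumes "steiner_cactus V E T"
  shows "facet_inducing V E T"
proof -
  have G: "steiner_graph V E T" and deg: "\<forall>v\<in>V. node_degree E v = 1 \<longrightarrow> v \<in> T"
    and cyc: "\<forall>C. is_cycle E C \<longrightarrow> card {v \<in> \<Union>C. cut_node V E v \<or> v \<in> T} \<ge> 3"
    and cac: "cactus V E" using assms by (auto simp: steiner_cactus_def)
  have sg: "simple_graph V E" "connected_graph V E" "T \<subseteq> V" using G by (auto simp: steiner_graph_def)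
  obtain C0 where C0: "is_cycle E C0" using cac by (auto simp: cactus_def)
  have ef: "ear_free E" using cac by (intro ear_freeI_unique_cycles) (auto simp: cactus_def)
  define k :: "'a set \<Rightarrow> nat" where "k e = (if \<exists>C. is_cycle E C \<and> e \<in> C then 1 else 2)" for e
  define c :: "real ^ 'a set" where "c = (\<chi> e. if e \<in> E then real (k e) else 0)"
  have cC: "c $ f = 1" if "is_cycle E C" "f \<in> C" for f C
    using that cycle_subset[OF that(1)] by (auto simp: c_def k_def)
  have cnn: "c $ f \<ge> 0" for f by (simp add: c_def)
  have "facet_weights V E T c"
  proof (rule facet_weightsI[where k = k and d = 2])
    show "steiner_graph V E T" by (rule G)
    show "c \<in> edge_space E" by (simp add: c_def edge_space_def)
    \<comment> \<open>A cactus has a cycle, so weight 1 occurs and the greatest common divisor is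
      1.\<close>
    obtain f where "f \<in> C0" using cycle_nonempty[OF C0] by blast
    then have "1 \<in> k ` E" using C0 cycle_subset[OF C0] by (intro image_eqI[of _ _ f]) (auto simp: k_def)
    then show "Gcd (k ` E) = 1" by (metis Gcd_dvd dvd_1_iff_1 nat_dvd_1_iff_1)
    show "2 \<le> cut_value E (\<lambda>e. c $ e) S" if S: "steiner_set V T S" for S
    proof -
      obtain e where e: "e \<in> edge_cut E S" using steiner_cut_nonempty[OF G S] by auto
      then have eE: "e \<in> E" using edge_cut_subset by blast
      show ?thesis
      proof (cases "\<exists>C. is_cycle E C \<and> e \<in> C")
        case False
        then have "c $ e = 2" using eE by (simp add: c_def k_def)
        moreover have "c $ e \<le> cut_value E (\<lambda>e. c $ e) S"
          unfolding cut_value_def by (rule member_le_sum[OF e]) (auto simp: cnn)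
        ultimately show ?thesis by simp
      next
        case True
        then obtain C where C: "is_cycle E C" "e \<in> C" by auto
        have sub: "edge_cut C S \<subseteq> edge_cut E S" using cycle_subset[OF C(1)] by (auto simp: edge_cut_def)
        have "e \<in> edge_cut C S" using e C(2) by (auto simp: edge_cut_def)
        then have "card (edge_cut C S) > 0" by (auto simp: card_gt_0_iff)
        then have "card (edge_cut C S) \<ge> 2" using even_card_edge_cut_cycle[OF C(1), of S] by (cases "card (edge_cut C S) = 1") auto
        then have "2 \<le> (\<Sum>f\<in>edge_cut C S. c $ f)"
          using cC[OF C(1)] edge_cut_subset[of C S] sum.cong[OF refl, of "edge_cut C S" "\<lambda>f. c $ f" "\<lambda>_. 1"]
          by (auto simp: subset_iff)
        also have "\<dots> \<le> cut_value E (\<lambda>e. c $ e) S"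
          unfolding cut_value_def by (rule sum_mono2[OF _ sub]) (auto simp: cnn)
        finally show ?thesis .
      qed
    qed
    let ?I = "incidence_vector ` {F \<in> steiner_cuts V E T. (\<Sum>e\<in>F. c $ e) = 2}"
    show "axis e 1 \<in> span ?I" if e: "e \<in> E" for e
    proof (cases "\<exists>C. is_cycle E C \<and> e \<in> C")
      case False
      then have "{e} \<in> steiner_cuts V E T" using bridge_steiner_cut[OF G deg cyc e] by blast
      then have "incidence_vector {e} \<in> ?I"
        using e False by (auto simp: c_def k_def)
      then show ?thesis unfolding incidence_vector_singleton by (rule span_base)
    next
      case True
      then obtain C where C: "is_cycle E C" "e \<in> C" by auto
      have CE: "C \<subseteq> E" by (rule cycle_subset[OF C(1)])
      have CV: "\<Union>C \<subseteq> V" using CE sg(1) by (auto simp: simple_graph_def)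
      \<comment> \<open>\<open>R A\<close> is \<open>A\<close> with all that hangs off it outside
        \<open>C\<close>. As the parts at different nodes of \<open>C\<close> are disjoint by
        ear-freeness, the edges leaving \<open>R A\<close> are just the edges of \<open>C\<close>
        leaving \<open>A\<close>.\<close>
      define R where "R A = {z \<in> V. \<exists>y\<in>A. (y, z) \<in> reach (E - C)}" for A
      have R_C: "a \<in> R A \<longleftrightarrow> a \<in> A" if "A \<subseteq> \<Union>C" "a \<in> \<Union>C" for a A
      proof
        assume "a \<in> R A"
        then obtain y where "y \<in> A" "(y, a) \<in> reach (E - C)" by (auto simp: R_def)
        moreover from this that have "y = a" using ef C(1) unfolding ear_free_def by blast
        ultimately show "a \<in> A" by simp
      next
        assume "a \<in> A"
        then show "a \<in> R A" using CV that unfolding R_def by (auto intro: bexI[of _ a])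
      qed
      have cutR: "edge_cut E (R A) = edge_cut C A" if A: "A \<subseteq> \<Union>C" for A
      proof -
        have "f \<in> edge_cut E (R A) \<longleftrightarrow> f \<in> edge_cut C A" if "f \<in> E" for f
        proof -
          obtain a b where ab: "f = {a, b}" "a \<noteq> b" "a \<in> V" "b \<in> V" using simple_graph_edgeE[OF sg(1) \<open>f \<in> E\<close>] .
          show ?thesis
          proof (cases "f \<in> C")
            case True
            then have "a \<in> \<Union>C" "b \<in> \<Union>C" using ab by auto
            then show ?thesis using R_C[OF A] True ab(1,2) \<open>f \<in> E\<close> card_edge_inter[OF ab(2)]
              by (simp add: edge_cut_def)
          next
            case False
            then have "(a, b) \<in> reach (E - C)" using \<open>f \<in> E\<close> ab by (intro reach_edge) auto
            then have "a \<in> R A \<longleftrightarrow> b \<in> R A" using ab(3,4) reach_trans[of _ a "E - C" b] reach_trans[of _ b "E - C" a] reach_sym[of a b "E - C"]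
              unfolding R_def by blast
            then show ?thesis using False ab(1,2) card_edge_inter[OF ab(2)] by (auto simp: edge_cut_def)
          qed
        qed
        then show ?thesis using edge_cut_subset[of E] edge_cut_subset[of C A] CE by blast
      qed
      define P where "P v \<longleftrightarrow> cut_node V E v \<or> v \<in> T" for v
      \<comment> \<open>At a cut node \<open>s\<close>, take a component \<open>Q\<close> of the
        graph without \<open>s\<close> that misses some other node \<open>o'\<close> of
        \<open>C\<close>. It contains a terminal \<open>t\<close>. If \<open>t\<close> hung off a
        node of \<open>C\<close> other than \<open>s\<close>, it would be linked to
        \<open>o'\<close> along \<open>C\<close> without passing \<open>s\<close>.\<close>
      have Rterm: "\<exists>t\<in>T. (s, t) \<in> reach (E - C)" if s: "s \<in> \<Union>C" "P s" for s
      proof (cases "s \<in> T")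
        case False
        then have cut: "cut_node V E s" using s(2) by (simp add: P_def)
        let ?Es = "{e \<in> E. s \<notin> e}"
        obtain r where r: "distinct r" "r \<noteq> []" "{hd r, last r} = e" "hd r \<noteq> last r" "\<Union>C = set r"
          using cycle_minus_edge[OF C] by metis
        obtain o' where o': "o' \<in> \<Union>C" "o' \<noteq> s" 
          using r hd_in_set[of r] last_in_set[of r] by metis
        obtain a where a: "a \<in> V" "a \<noteq> s" "(o', a) \<notin> reach ?Es"
          using cut_node_component[OF cut] o' CV by blast
        define Q where "Q = {z \<in> V. (a, z) \<in> reach ?Es}"
        have sQ: "s \<notin> Q"
        proof
          assume "s \<in> Q"
          then have "(a, s) \<in> reach ?Es" by (simp add: Q_def)
          then have "s \<in> - {s}" by (rule reach_closed) (use a(2) in auto)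
          then show False by simp
        qed
        have "Q \<inter> T \<noteq> {}"
        proof (rule terminal_behind_node[OF sg(1,2) deg cyc])
          show "Q \<subseteq> V" "Q \<noteq> {}" "s \<in> V" "s \<notin> Q" using a sQ s(1) CV by (auto simp: Q_def)
          fix x y assume xy: "{x, y} \<in> E" "x \<in> Q"
          show "y \<in> Q \<or> y = s"
          proof (cases "y = s")
            case False
            then have "{x, y} \<in> ?Es" using xy sQ by auto
            then have "(a, y) \<in> reach ?Es" using xy(2) by (auto intro: reach_step[of a x] simp: Q_def)
            then show ?thesis using simple_graph_edge[OF sg(1) xy(1)] by (simp add: Q_def)
          qed auto
        qed
        then obtain t where t: "t \<in> Q" "t \<in> T" by auto
        have "(s, t) \<in> reach E" using s(1) t CV by (auto simp: Q_def sg(2)[unfolded connected_graph_iff])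
        then obtain y where y: "y \<in> \<Union>C" "(y, t) \<in> reach (E - C)"
          using reach_attach[of s t E "\<Union>C" C] s(1) by auto
        have "y = s"
        proof (rule ccontr)
          assume "y \<noteq> s"
          have "t \<in> {z. (y, z) \<in> reach ?Es \<and> (y, z) \<in> reach (E - C)}"
            using y(2)
          proof (rule reach_closed)
            show "y \<in> {z. (y, z) \<in> reach ?Es \<and> (y, z) \<in> reach (E - C)}" by simp
            fix x z assume xz: "{x, z} \<in> E - C" "x \<in> {z. (y, z) \<in> reach ?Es \<and> (y, z) \<in> reach (E - C)}"
            have z: "(y, z) \<in> reach (E - C)" using xz by (auto intro: reach_step[of y x])
            have "x \<noteq> s" "z \<noteq> s"
              using ef C(1) y(1) s(1) \<open>y \<noteq> s\<close> z xz(2) unfolding ear_free_def by blast+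
            then have "{x, z} \<in> ?Es" using xz(1) by auto
            then show "z \<in> {z. (y, z) \<in> reach ?Es \<and> (y, z) \<in> reach (E - C)}"
              using z xz(2) reach_step[of y x ?Es z] by blast
          qed
          then have "(y, t) \<in> reach ?Es" by simp
          moreover have "(o', y) \<in> reach {e \<in> C. s \<notin> e}"
            using cycle_minus_node[OF C(1) s(1) o'(1) y(1) o'(2) \<open>y \<noteq> s\<close>] .
          then have "(o', y) \<in> reach ?Es" using CE by (elim reach_mono[rotated]) auto
          ultimately have "(o', t) \<in> reach ?Es" using reach_trans by fast
          moreover have "(a, t) \<in> reach ?Es" using t by (simp add: Q_def)
          ultimately have "(o', a) \<in> reach ?Es" by (rule reach_common_target)
          then show False using a(3) by simp
        qed
        then show ?thesis using y(2) t(2) by auto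
      qed (auto intro: bexI[of _ s])
      have SR: "incidence_vector (edge_cut C A) \<in> ?I"
        if A: "A \<subseteq> \<Union>C" "\<exists>x\<in>A. P x" "\<exists>x\<in>\<Union>C - A. P x" "card (edge_cut C A) = 2" for A
      proof -
        obtain s s' where s: "s \<in> A" "P s" "s' \<in> \<Union>C" "s' \<notin> A" "P s'" using A by auto
        obtain t where t: "t \<in> T" "(s, t) \<in> reach (E - C)" using Rterm[of s] s A(1) by blast
        obtain t' where t': "t' \<in> T" "(s', t') \<in> reach (E - C)" using Rterm[of s'] s by blast
        have "t \<in> R A" using t s(1) sg(3) by (auto simp: R_def)
        moreover have "t' \<notin> R A"
        proof
          assume "t' \<in> R A"
          then obtain y where "y \<in> A" "(y, t') \<in> reach (E - C)" by (auto simp: R_def)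
          then have "(y, s') \<in> reach (E - C)" using reach_common_target[OF _ t'(2)] by simp
          then have "y = s'" using ef C(1) A(1) s(3) \<open>y \<in> A\<close> unfolding ear_free_def by blast
          then show False using s(4) \<open>y \<in> A\<close> by simp
        qed
        ultimately have "steiner_set V T (R A)" using t(1) t'(1) by (auto simp: steiner_set_def R_def)
        then have "edge_cut C A \<in> steiner_cuts V E T" using cutR[OF A(1)] by (auto simp: steiner_cuts_eq)
        moreover have "(\<Sum>f\<in>edge_cut C A. c $ f) = (\<Sum>f\<in>edge_cut C A. 1)"
          using edge_cut_subset[of C A] cC[OF C(1)] by (intro sum.cong) auto
        ultimately show ?thesis using A(4) by auto
      qed
      \<comment> \<open>Opening \<open>C\<close> at \<open>e\<close> makes \<open>e\<close> one of
        the three edges between the segments; the other two, \<open>?f\<close> and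
        \<open>?g\<close>, are those at which \<open>q\<close> is divided.\<close>
      obtain q where q: "distinct q" "q \<noteq> []" "{hd q, last q} = e" "hd q \<noteq> last q" "C = insert e (set (wedges q))"
        "\<Union>C = set q"
        using cycle_minus_edge[OF C] by metis
      have "card {v \<in> set q. P v} \<ge> Suc 2"
        unfolding P_def q(6)[symmetric] using cyc C(1) by simp
      then obtain q1 q' where q1: "q = q1 @ q'" "\<exists>x\<in>set q1. P x" "card {v \<in> set q'. P v} \<ge> 2"
        using split_list_special by blast
      then obtain q2 q3 where q2: "q' = q2 @ q3" "\<exists>x\<in>set q2. P x" "card {v \<in> set q3. P v} \<ge> 1"
        using split_list_special[of 1 q' P] by (auto simp: numeral_2_eq_2)
      have "{v \<in> set q3. P v} \<noteq> {}" using q2(3) by force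
      then have q3: "\<exists>x\<in>set q3. P x" by auto
      have ne: "q1 \<noteq> []" "q2 \<noteq> []" "q3 \<noteq> []" using q1 q2 q3 by auto
      let ?f = "{last q1, hd q2}" and ?g = "{last q2, hd q3}"
      have e_eq: "e = {hd q1, last q3}" using q(3) q1(1) q2(1) ne by auto
      have C_eq: "C = {e, ?f, ?g} \<union> (set (wedges q1) \<union> set (wedges q2) \<union> set (wedges q3))"
        using q(5) ne unfolding q1(1) q2(1) by (auto simp: wedges_append)
      have dq: "distinct q1" "distinct q2" "distinct q3" "set q1 \<inter> set q2 = {}" "set q1 \<inter> set q3 = {}"
        "set q2 \<inter> set q3 = {}" using q(1) unfolding q1(1) q2(1) by auto
      have mem: "hd q1 \<in> set q1" "last q1 \<in> set q1" "hd q2 \<in> set q2" "last q2 \<in> set q2" "hd q3 \<in> set q3" "last q3 \<in> set q3"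
        using ne by auto
      have inner: "edge_cut (set (wedges q1) \<union> set (wedges q2) \<union> set (wedges q3)) A = {}"
        if "A = set q1 \<or> A = set q2 \<or> A = set q3" for A
      proof -
        have "edge_cut (set (wedges q')) A = {}" if "q' \<in> {q1, q2, q3}" for q'
          using that \<open>A = set q1 \<or> A = set q2 \<or> A = set q3\<close> dq
          by (intro edge_cut_within[of _ "set q'"]) (auto intro: card_wedges dest: wedges_subset)
        then show ?thesis by (auto simp: edge_cut_def)
      qed
      have cuteq: "edge_cut C A = edge_cut {e, ?f, ?g} A" if "A = set q1 \<or> A = set q2 \<or> A = set q3" for A
        unfolding C_eq using inner[OF that] by (auto simp: edge_cut_def)
      have ner: "hd q1 \<noteq> last q3" "last q1 \<noteq> hd q2" "last q2 \<noteq> hd q3" using dq mem by auto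
      have notin: "hd q1 \<notin> set q2" "hd q1 \<notin> set q3" "last q1 \<notin> set q2" "last q1 \<notin> set q3"
        "hd q2 \<notin> set q1" "hd q2 \<notin> set q3" "last q2 \<notin> set q1" "last q2 \<notin> set q3"
        "hd q3 \<notin> set q1" "hd q3 \<notin> set q2" "last q3 \<notin> set q1" "last q3 \<notin> set q2"
        using dq mem by auto
      have d: "e \<noteq> ?f" "e \<noteq> ?g" "?f \<noteq> ?g"
        using notin mem unfolding e_eq by (auto simp: doubleton_eq_iff)
      have cut1: "edge_cut C (set q1) = {e, ?f}"
        unfolding cuteq[of "set q1", simplified] using card_edge_inter[OF ner(1), of "set q1"]
          card_edge_inter[OF ner(2), of "set q1"] card_edge_inter[OF ner(3), of "set q1"] mem notin
        by (auto simp: edge_cut_def e_eq)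
      have cut2: "edge_cut C (set q2) = {?f, ?g}"
        unfolding cuteq[of "set q2", simplified] using card_edge_inter[OF ner(1), of "set q2"]
          card_edge_inter[OF ner(2), of "set q2"] card_edge_inter[OF ner(3), of "set q2"] mem notin
        by (auto simp: edge_cut_def e_eq)
      have cut3: "edge_cut C (set q3) = {e, ?g}"
        unfolding cuteq[of "set q3", simplified] using card_edge_inter[OF ner(1), of "set q3"]
          card_edge_inter[OF ner(2), of "set q3"] card_edge_inter[OF ner(3), of "set q3"] mem notin
        by (auto simp: edge_cut_def e_eq)
      have sub: "set q1 \<subseteq> \<Union>C" "set q2 \<subseteq> \<Union>C" "set q3 \<subseteq> \<Union>C" using q(6) q1 q2 by auto
      have "incidence_vector {e, ?f} \<in> ?I"
        unfolding cut1[symmetric]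
      proof (rule SR[OF sub(1) q1(2)])
        show "\<exists>x\<in>\<Union>C - set q1. P x" using q2(2) sub dq by blast
        show "card (edge_cut C (set q1)) = 2" unfolding cut1 using d by simp
      qed
      moreover have "incidence_vector {?f, ?g} \<in> ?I"
        unfolding cut2[symmetric]
      proof (rule SR[OF sub(2) q2(2)])
        show "\<exists>x\<in>\<Union>C - set q2. P x" using q1(2) sub dq by blast
        show "card (edge_cut C (set q2)) = 2" unfolding cut2 using d by simp
      qed
      moreover have "incidence_vector {e, ?g} \<in> ?I"
        unfolding cut3[symmetric]
      proof (rule SR[OF sub(3) q3])
        show "\<exists>x\<in>\<Union>C - set q3. P x" using q1(2) sub dq by blast
        show "card (edge_cut C (set q3)) = 2" unfolding cut3 using d by simp
      qed
      \<comment> \<open>Cutting off one segment gives a tight cut consisting of two of the three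
        connecting edges; the three such pairs generate each single edge.\<close>
      moreover have "axis e 1 = (1/2) *\<^sub>R (incidence_vector {e, ?f} + incidence_vector {e, ?g} - incidence_vector {?f, ?g})"
        using d by (auto simp: vec_eq_iff axis_def incidence_vector_def)
      ultimately show ?thesis
        by (simp only:) (intro span_scale span_diff span_add span_base)
    qed
  qed (auto simp: c_def k_def)
  then show ?thesis using G by (auto simp: facet_inducing_def)
qed

section \<open>Splitting off\<close>

lemma finite_pos_lower_bound:
  assumes "finite A" "\<And>a. a \<in> A \<Longrightarrow> (0::real) < f a"
  shows "\<exists>\<epsilon>>0. \<forall>a\<in>A. \<epsilon> \<le> f a"
  using assms
proof (induction A rule: finite_induct)
  case empty
  then show ?case by (intro exI[of _ 1]) auto
next
  case (insert a A)
  then obtain \<epsilon> where "\<epsilon> > 0" "\<forall>a\<in>A. \<epsilon> \<le> f a" by auto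
  then show ?case using insert.prems[of a] by (intro exI[of _ "min \<epsilon> (f a)"]) auto
qed

text \<open>\<open>w\<close> is a proper convex combination
  \<open>\<epsilon> h + (1 - \<epsilon>) w'\<close> of the indicator \<open>h\<close> of
  \<open>H\<close> and another point \<open>w'\<close> of the polytope; positivity on
  \<open>H\<close> and the strict upper bound off \<open>H\<close> leave room for \<open>w'\<close>.
  The cost is at least \<open>M\<close> at \<open>w'\<close> and at most \<open>M\<close> at
  \<open>w\<close>, so \<open>h\<close> cannot cost more than \<open>M\<close>.\<close>

lemma convex_position_bound:
  fixes w D :: "'i \<Rightarrow> real"
  assumes fin: "finite I" and H: "H \<subseteq> I"
    and J: "\<And>J. J \<in> \<J> \<Longrightarrow> J \<subseteq> I \<and> sum w J = 2 \<and> card (J \<inter> H) = 2"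
    and w: "\<And>i. i \<in> I \<Longrightarrow> 0 \<le> w i \<and> w i \<le> 1" "\<And>i. i \<in> H \<Longrightarrow> 0 < w i" "\<And>i. i \<in> I - H \<Longrightarrow> w i < 1"
    and M: "(\<Sum>i\<in>I. w i * D i) \<le> M"
    and LB: "\<And>w'. (\<And>i. i \<in> I \<Longrightarrow> 0 \<le> w' i \<and> w' i \<le> 1) \<Longrightarrow> (\<And>J. J \<in> \<J> \<Longrightarrow> sum w' J = 2) \<Longrightarrow>
       M \<le> (\<Sum>i\<in>I. w' i * D i)"
  shows "sum D H \<le> M"
proof -
  have "0 < (if i \<in> H then w i else 1 - w i)" if "i \<in> I" for i using w(2,3)[of i] that by auto
  then have "\<exists>\<epsilon>>0. \<forall>i\<in>I. \<epsilon> \<le> (if i \<in> H then w i else 1 - w i)"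
    by (rule finite_pos_lower_bound[OF fin])
  then obtain \<epsilon>0 where \<epsilon>0: "\<epsilon>0 > 0" "\<forall>i\<in>I. \<epsilon>0 \<le> (if i \<in> H then w i else 1 - w i)"
    by blast
  define \<epsilon> where "\<epsilon> = min \<epsilon>0 (1/2)"
  have \<epsilon>: "\<epsilon> > 0" "\<epsilon> < 1" "\<And>i. i \<in> I \<Longrightarrow> \<epsilon> \<le> (if i \<in> H then w i else 1 - w i)"
    using \<epsilon>0 by (force simp: \<epsilon>_def)+
  define h where "h i = (if i \<in> H then 1 else 0 :: real)" for i
  define w' where "w' i = (w i - \<epsilon> * h i) / (1 - \<epsilon>)" for i
  have "M \<le> (\<Sum>i\<in>I. w' i * D i)"
  proof (rule LB)
    fix i assume "i \<in> I"
    then show "0 \<le> w' i \<and> w' i \<le> 1"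
      using \<epsilon>(1,2) \<epsilon>(3)[of i] w(1)[of i] by (auto simp: w'_def h_def divide_simps split: if_splits)
  next
    fix J assume "J \<in> \<J>"
    note J = J[OF this]
    then have "finite J" using fin finite_subset by blast
    have "sum h J = real (card (J \<inter> H))"
      unfolding h_def using \<open>finite J\<close> by (simp add: sum.If_cases Int_def)
    then have "sum w' J = (2 - \<epsilon> * 2) / (1 - \<epsilon>)"
      using J unfolding w'_def by (simp add: sum_divide_distrib[symmetric] sum_subtractf sum_distrib_left[symmetric])
    also have "\<dots> = 2" using \<epsilon>(2) by (simp add: field_simps)
    finally show "sum w' J = 2" .
  qed
  also have "(\<Sum>i\<in>I. w' i * D i) = ((\<Sum>i\<in>I. w i * D i) - \<epsilon> * (\<Sum>i\<in>I. h i * D i)) / (1 - \<epsilon>)"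
    unfolding w'_def by (simp add: sum_divide_distrib[symmetric] sum_subtractf[symmetric] sum_distrib_left algebra_simps)
  also have "(\<Sum>i\<in>I. h i * D i) = sum D H"
    unfolding h_def using fin H by (simp add: if_distrib[of "\<lambda>x. x * _"] sum.If_cases Int_absorb1 cong: if_cong)
  finally have "M * (1 - \<epsilon>) \<le> (\<Sum>i\<in>I. w i * D i) - \<epsilon> * sum D H"
    using \<epsilon>(2) by (simp add: divide_simps)
  then have "\<epsilon> * sum D H \<le> \<epsilon> * M" using M by (simp add: algebra_simps)
  then show ?thesis using \<epsilon>(1) by simp
qed

section \<open>Cut functions on complete graphs\<close>

lemma cut_value_indicator:
  "cut_value F (w :: 'a::finite set \<Rightarrow> real) S = (\<Sum>e\<in>F. w e * (if card (e \<inter> S) = 1 then 1 else 0))"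
  unfolding cut_value_def edge_cut_def
  by (simp add: if_distrib[of "\<lambda>x. _ * x"] sum.If_cases Int_def cong: if_cong)

lemma edge_cut_complement:
  assumes "\<And>e. e \<in> F \<Longrightarrow> e \<subseteq> V \<and> card e = 2"
  shows "edge_cut F (V - S) = edge_cut F S"
proof -
  have "card (e \<inter> (V - S)) = 1 \<longleftrightarrow> card (e \<inter> S) = 1" if "e \<in> F" for e
  proof -
    obtain a b where ab: "e = {a, b}" "a \<noteq> b" using assms[OF \<open>e \<in> F\<close>] by (auto simp: card_2_iff)
    have "a \<in> V" "b \<in> V" using assms[OF that] ab by auto
    then show ?thesis using card_edge_inter[OF ab(2)] unfolding ab(1) by auto
  qed
  then show ?thesis by (auto simp: edge_cut_def)
qed

lemma steiner_set_complement: "T \<subseteq> V \<Longrightarrow> steiner_set V T S \<Longrightarrow> steiner_set V T (V - S)"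
  by (auto simp: steiner_set_def)

definition pairs :: "'a set \<Rightarrow> 'a set set" where
  "pairs A = {e. e \<subseteq> A \<and> card e = 2}"

lemma pairsI: "a \<in> A \<Longrightarrow> b \<in> A \<Longrightarrow> a \<noteq> b \<Longrightarrow> {a, b} \<in> pairs A"
  by (simp add: pairs_def)

lemma pairsE:
  assumes "e \<in> pairs A"
  obtains a b where "e = {a, b}" "a \<noteq> b" "a \<in> A" "b \<in> A"
  using assms by (auto simp: pairs_def card_2_iff)

lemma cut_value_complement_pairs: "cut_value (pairs V) w (V - S) = cut_value (pairs V) w S"
  unfolding cut_value_def by (subst edge_cut_complement) (auto simp: pairs_def)

lemma cut_value_submodular:
  fixes w :: "'a::finite set \<Rightarrow> real"
  assumes "\<And>e. e \<in> pairs V \<Longrightarrow> 0 \<le> w e"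
  shows "cut_value (pairs V) w (X \<inter> Y) + cut_value (pairs V) w (X \<union> Y) \<le> cut_value (pairs V) w X + cut_value (pairs V) w Y"
  unfolding cut_value_indicator sum.distrib[symmetric]
proof (rule sum_mono)
  fix e assume e: "e \<in> pairs V"
  then obtain a b where ab: "e = {a, b}" "a \<noteq> b" by (elim pairsE)
  have "(if card (e \<inter> (X \<inter> Y)) = 1 then 1 else 0) + (if card (e \<inter> (X \<union> Y)) = 1 then 1 else 0)
     \<le> (if card (e \<inter> X) = 1 then 1 else 0) + (if card (e \<inter> Y) = 1 then 1 else (0::real))" (is "?l \<le> ?r")
    unfolding ab(1) card_edge_inter[OF ab(2)] by auto
  then have "w e * ?l \<le> w e * ?r" using assms[OF e] by (rule mult_left_mono)
  then show "w e * (if card (e \<inter> (X \<inter> Y)) = 1 then 1 else 0) + w e * (if card (e \<inter> (X \<union> Y)) = 1 then 1 else 0)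
     \<le> w e * (if card (e \<inter> X) = 1 then 1 else 0) + w e * (if card (e \<inter> Y) = 1 then 1 else 0)"
    by (simp only: distrib_left)
qed

text \<open>Checked edge by edge. An edge from \<open>X \<inter> Y\<close> to the complement of
  \<open>X \<union> Y\<close> counts twice on the right and not in the cuts on the left; this pays
  for the extra term of \<open>{u, v}\<close>.\<close>

lemma cut_value_posimodular:
  fixes w :: "'a::finite set \<Rightarrow> real"
  assumes "\<And>e. e \<in> pairs V \<Longrightarrow> 0 \<le> w e" and uv: "{u, v} \<in> pairs V" "u \<in> X \<inter> Y" "v \<notin> X \<union> Y"
  shows "cut_value (pairs V) w (X - Y) + cut_value (pairs V) w (Y - X) + 2 * w {u, v} \<le> cut_value (pairs V) w X + cut_value (pairs V) w Y"
proof -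
  have "2 * w {u, v} = (\<Sum>e\<in>pairs V. if e = {u, v} then 2 * w e else 0)"
    using uv(1) by (subst sum.delta) auto
  moreover have "(\<Sum>e\<in>pairs V. w e * (if card (e \<inter> (X - Y)) = 1 then 1 else 0) + w e * (if card (e \<inter> (Y - X)) = 1 then 1 else 0)
     + (if e = {u, v} then 2 * w e else 0))
     \<le> (\<Sum>e\<in>pairs V. w e * (if card (e \<inter> X) = 1 then 1 else 0) + w e * (if card (e \<inter> Y) = 1 then 1 else 0))"
  proof (rule sum_mono)
    fix e assume e: "e \<in> pairs V"
    then obtain a b where ab: "e = {a, b}" "a \<noteq> b" by (elim pairsE)
    have "(if card (e \<inter> (X - Y)) = 1 then 1 else 0) + (if card (e \<inter> (Y - X)) = 1 then 1 else 0) + (if e = {u, v} then 2 else 0)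
       \<le> (if card (e \<inter> X) = 1 then 1 else 0) + (if card (e \<inter> Y) = 1 then 1 else (0::real))" (is "?l \<le> ?r")
      unfolding ab(1) card_edge_inter[OF ab(2)] doubleton_eq_iff using uv(2,3) by auto
    then have "w e * ?l \<le> w e * ?r" using assms(1)[OF e] by (rule mult_left_mono)
    then show "w e * (if card (e \<inter> (X - Y)) = 1 then 1 else 0) + w e * (if card (e \<inter> (Y - X)) = 1 then 1 else 0)
     + (if e = {u, v} then 2 * w e else 0)
     \<le> w e * (if card (e \<inter> X) = 1 then 1 else 0) + w e * (if card (e \<inter> Y) = 1 then 1 else 0)"
      by (auto simp: distrib_left split: if_splits)
  qed
  ultimately show ?thesis unfolding cut_value_indicator by (simp only: sum.distrib)
qed

lemma sum_add_indicator:
  fixes w :: "'a::finite set \<Rightarrow> real"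
  shows "(\<Sum>e\<in>F. (w e + \<epsilon> * (if e = a then 1 else 0)) * f e) = (\<Sum>e\<in>F. w e * f e) + (if a \<in> F then \<epsilon> * f a else 0)"
proof -
  have "(\<Sum>e\<in>F. (w e + \<epsilon> * (if e = a then 1 else 0)) * f e) = (\<Sum>e\<in>F. w e * f e + (if e = a then \<epsilon> * f e else 0))"
    by (intro sum.cong) (auto simp: algebra_simps)
  then show ?thesis by (simp add: sum.distrib)
qed

text \<open>Facet weights scaled to minimum cut value 2, the least number of times a closed walk
  through all terminals crosses a Steiner set. \<open>uniq\<close> is the facet property in the form
  of \<open>facet_weights_unique\<close>.\<close>

locale extremal_weights =
  fixes V :: "'a::finite set" and E T and c :: "'a set \<Rightarrow> real"
  assumes G: "steiner_graph V E T"
    and pos: "\<And>e. e \<in> E \<Longrightarrow> c e > 0"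
    and feas: "\<And>S. steiner_set V T S \<Longrightarrow> 2 \<le> cut_value E c S"
    and uniq: "\<And>x e. (\<And>S. steiner_set V T S \<Longrightarrow> cut_value E c S = 2 \<Longrightarrow> cut_value E x S = 2) \<Longrightarrow> e \<in> E \<Longrightarrow> x e = c e"
begin

lemma sg: "simple_graph V E" and conn: "connected_graph V E" and TV: "T \<subseteq> V" and T2: "card T \<ge> 2"
  using G by (auto simp: steiner_graph_def)

lemma E_pairs: "E \<subseteq> pairs V"
  using sg by (auto simp: simple_graph_def pairs_def)

definition tights where "tights = {S. steiner_set V T S \<and> cut_value E c S = 2}"

definition len :: "'a set \<Rightarrow> nat" where
  "len e = (\<Sum>S\<in>tights. if card (e \<inter> S) = 1 then 1 else 0)"

text \<open>The cost of \<open>c\<close>, since every tight set contributes exactly 2. A tight set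
  and its complement both belong to \<open>tights\<close>, which doubles the costs and
  \<open>M\<close> alike.\<close>

definition M where "M = 2 * real (card tights)"

definition wlen :: "'a list \<Rightarrow> nat" where "wlen vs = sum_list (map len (wedges vs))"

text \<open>Defined on unordered pairs, as the weights are; reversing a shortest walk restores the
  wanted orientation.\<close>

definition dist_pair :: "'a set \<Rightarrow> nat" where
  "dist_pair e = (LEAST n. \<exists>vs. vs \<noteq> [] \<and> {hd vs, last vs} = e \<and> set (wedges vs) \<subseteq> E \<and> wlen vs = n)"

text \<open>If \<open>e\<close> left no tight set, \<open>c e\<close> could be changed without
  affecting any tight equation, against uniqueness. Positive lengths later keep the feasible region
  bounded.\<close>

lemma len_pos: "e \<in> E \<Longrightarrow> len e \<ge> 1"
proof (rule ccontr)
  assume e: "e \<in> E" and "\<not> len e \<ge> 1"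
  then have "len e = 0" by simp
  then have no: "card (e \<inter> S) \<noteq> 1" if "S \<in> tights" for S
    using that by (auto simp: len_def split: if_splits)
  have "(c(e := c e + 1)) e = c e"
  proof (rule uniq[of "c(e := c e + 1)", OF _ e])
    fix S assume S: "steiner_set V T S" "cut_value E c S = 2"
    then have "e \<notin> edge_cut E S" using no[of S] by (auto simp: tights_def edge_cut_def)
    then have "cut_value E (c(e := c e + 1)) S = cut_value E c S"
      unfolding cut_value_def by (intro sum.cong) auto
    then show "cut_value E (c(e := c e + 1)) S = 2" using S by simp
  qed
  then show False by simp
qed

section \<open>The metric induced by the tight sets\<close>

lemma wlen_rev: "wlen (rev vs) = wlen vs"
  by (simp add: wlen_def wedges_rev rev_map[symmetric])

lemma dist_pair_le: "vs \<noteq> [] \<Longrightarrow> set (wedges vs) \<subseteq> E \<Longrightarrow> dist_pair {hd vs, last vs} \<le> wlen vs"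
  unfolding dist_pair_def by (rule Least_le) auto

lemma dist_pair_walk:
  assumes "u \<in> V" "v \<in> V"
  obtains vs where "vs \<noteq> []" "hd vs = u" "last vs = v" "set (wedges vs) \<subseteq> E" "wlen vs = dist_pair {u, v}"
proof -
  have "(u, v) \<in> reach E" using conn assms by (auto simp: connected_graph_iff)
  then obtain p where p: "p \<noteq> []" "hd p = u" "last p = v" "set (wedges p) \<subseteq> E" using distinct_path_exists by metis
  have "\<exists>vs. vs \<noteq> [] \<and> {hd vs, last vs} = {u, v} \<and> set (wedges vs) \<subseteq> E \<and> wlen vs = dist_pair {u, v}"
    unfolding dist_pair_def by (rule LeastI_ex) (use p in blast)
  then obtain vs where vs: "vs \<noteq> []" "{hd vs, last vs} = {u, v}" "set (wedges vs) \<subseteq> E" "wlen vs = dist_pair {u, v}" by blast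
  show ?thesis
  proof (cases "hd vs = u \<and> last vs = v")
    case False
    then have "last vs = u" "hd vs = v" using vs(2) by (auto simp: doubleton_eq_iff)
    then show ?thesis using that[of "rev vs"] vs by (simp add: hd_rev last_rev wedges_rev wlen_rev)
  qed (use vs that in blast)
qed

lemma dist_pair_triangle:
  assumes "u \<in> V" "v \<in> V" "x \<in> V"
  shows "dist_pair {u, x} \<le> dist_pair {u, v} + dist_pair {v, x}"
proof -
  obtain p where p: "p \<noteq> []" "hd p = u" "last p = v" "set (wedges p) \<subseteq> E" "wlen p = dist_pair {u, v}"
    using dist_pair_walk[OF assms(1,2)] .
  obtain q where q: "q \<noteq> []" "hd q = v" "last q = x" "set (wedges q) \<subseteq> E" "wlen q = dist_pair {v, x}"
    using dist_pair_walk[OF assms(2,3)] .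
  obtain p' where p': "p = p' @ [v]" using p by (metis append_butlast_last_id)
  obtain q' where q': "q = v # q'" using q by (cases q) auto
  have w: "wedges (p' @ v # q') = wedges p @ wedges q" unfolding p' q' by (rule wedges_append_common)
  have "hd (p' @ v # q') = u" "last (p' @ v # q') = x" using p(2) q(3) p' q' by (cases p'; auto)+
  moreover have "set (wedges (p' @ v # q')) \<subseteq> E" using w p(4) q(4) by auto
  ultimately have "dist_pair {u, x} \<le> wlen (p' @ v # q')"
    using dist_pair_le[of "p' @ v # q'"] by auto
  also have "\<dots> = wlen p + wlen q" unfolding wlen_def w by simp
  finally show ?thesis using p q by simp
qed

lemma dist_pair_edge: "e \<in> E \<Longrightarrow> dist_pair e \<le> len e"
proof -
  assume e: "e \<in> E"
  then obtain a b where "e = {a, b}" by (rule simple_graph_edgeE[OF sg])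
  then show ?thesis using dist_pair_le[of "[a, b]"] e by (simp add: wlen_def)
qed

lemma wlen_crossings: "wlen vs = (\<Sum>S\<in>tights. length (filter (\<lambda>e. card (e \<inter> S) = 1) (wedges vs)))"
proof -
  have "sum_list (map len es) = (\<Sum>S\<in>tights. length (filter (\<lambda>e. card (e \<inter> S) = 1) es))" for es
    by (induction es) (auto simp: len_def sum.distrib[symmetric] intro!: sum.cong)
  then show ?thesis by (simp add: wlen_def)
qed

text \<open>Also for pairs that are no edges, \<open>len\<close> counts the tight sets separating
  the pair, and every walk between the two nodes crosses each of them.\<close>

lemma dist_pair_ge:
  assumes "u \<in> V" "v \<in> V" "u \<noteq> v"
  shows "len {u, v} \<le> dist_pair {u, v}"
proof -
  obtain p where p: "p \<noteq> []" "hd p = u" "last p = v" "set (wedges p) \<subseteq> E" "wlen p = dist_pair {u, v}"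
    using dist_pair_walk[OF assms(1,2)] .
  have "len {u, v} \<le> wlen p"
    unfolding len_def wlen_crossings
  proof (rule sum_mono)
    fix S
    have "odd (length (filter (\<lambda>e. card (e \<inter> S) = 1) (wedges p))) \<longleftrightarrow> (u \<in> S) \<noteq> (v \<in> S)"
      using odd_crossings[OF p(1), of S] p sg by (auto simp: simple_graph_def)
    then show "(if card ({u, v} \<inter> S) = 1 then 1 else 0) \<le> length (filter (\<lambda>e. card (e \<inter> S) = 1) (wedges p))"
      using card_edge_inter[OF assms(3), of S] by (auto elim: oddE simp del: One_nat_def)
  qed
  then show ?thesis using p by simp
qed

lemma dist_pair_pos: "e \<in> pairs V \<Longrightarrow> dist_pair e \<ge> 1"
proof -
  assume "e \<in> pairs V"
  then obtain u v where uv: "e = {u, v}" "u \<noteq> v" "u \<in> V" "v \<in> V" by (elim pairsE)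
  obtain p where p: "p \<noteq> []" "hd p = u" "last p = v" "set (wedges p) \<subseteq> E" "wlen p = dist_pair {u, v}"
    using dist_pair_walk[OF uv(3,4)] .
  obtain a b ps where ab: "p = a # b # ps" using p(1-3) uv(2) by (cases p rule: wedges.cases) auto
  then have "len {a, b} \<ge> 1" using p(4) len_pos by auto
  then show ?thesis using p(5) by (simp add: ab wlen_def uv(1))
qed

text \<open>The cost is a constraint and not the objective: within the budget \<open>M\<close> the
  total weight can then be minimised, and this is what splitting off lowers.\<close>

definition feasible :: "('a set \<Rightarrow> real) \<Rightarrow> bool" where
  "feasible w \<longleftrightarrow> (\<forall>e\<in>pairs V. 0 \<le> w e) \<and> (\<forall>S. steiner_set V T S \<longrightarrow> 2 \<le> cut_value (pairs V) w S) \<and>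
     (\<Sum>e\<in>pairs V. w e * dist_pair e) \<le> M"

lemma feasible_exists: "feasible (\<lambda>e. if e \<in> E then c e else 0)"
  unfolding feasible_def
proof (intro conjI ballI allI impI)
  show "0 \<le> (if e \<in> E then c e else 0)" for e using pos[of e] by auto
next
  fix S assume S: "steiner_set V T S"
  have "cut_value (pairs V) (\<lambda>e. if e \<in> E then c e else 0) S = cut_value E c S"
    unfolding cut_value_def using E_pairs by (intro sum.mono_neutral_cong_right) (auto simp: edge_cut_def)
  then show "2 \<le> cut_value (pairs V) (\<lambda>e. if e \<in> E then c e else 0) S" using feas[OF S] by simp
next
  have "(\<Sum>e\<in>pairs V. (if e \<in> E then c e else 0) * dist_pair e) = (\<Sum>e\<in>E. c e * dist_pair e)"
    using E_pairs by (intro sum.mono_neutral_cong_right) auto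
  also have "\<dots> \<le> (\<Sum>e\<in>E. c e * len e)"
    using dist_pair_edge pos by (intro sum_mono mult_left_mono) (auto intro: less_imp_le)
  \<comment> \<open>Exchange the sums over edges and tight sets: an edge pays its weight once for
    every tight set it leaves.\<close>
  also have "\<dots> = (\<Sum>S\<in>tights. cut_value E c S)"
    unfolding cut_value_indicator len_def
    by (subst sum.swap) (simp add: sum_distrib_left if_distrib cong: if_cong)
  also have "\<dots> = M" by (simp add: tights_def M_def)
  finally show "(\<Sum>e\<in>pairs V. (if e \<in> E then c e else 0) * real (dist_pair e)) \<le> M" .
qed

text \<open>Compactness: every pair costs at least 1 per unit of weight, so the budget
  \<open>M\<close> bounds all coordinates.\<close>

lemma minimal_feasible_exists:
  obtains w where "feasible w" "\<And>w'. feasible w' \<Longrightarrow> (\<Sum>e\<in>pairs V. w e) \<le> (\<Sum>e\<in>pairs V. w' e)"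
proof -
  define \<Omega> :: "(real ^ 'a set) set" where "\<Omega> = {w. feasible (\<lambda>e. w $ e) \<and> (\<forall>e. e \<notin> pairs V \<longrightarrow> w $ e = 0)}"
  have lift: "(\<chi> e. if e \<in> pairs V then w e else 0) \<in> \<Omega>" if "feasible w" for w
  proof -
    have "cut_value (pairs V) (\<lambda>e. if e \<in> pairs V then w e else 0) S = cut_value (pairs V) w S" for S
      unfolding cut_value_def by (intro sum.cong) (auto simp: edge_cut_def)
    moreover have "(\<Sum>e\<in>pairs V. (if e \<in> pairs V then w e else 0) * dist_pair e) = (\<Sum>e\<in>pairs V. w e * dist_pair e)"
      by (intro sum.cong) auto
    moreover have "($) (\<chi> e. if e \<in> pairs V then w e else 0) = (\<lambda>e. if e \<in> pairs V then w e else 0)"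
      by (simp add: fun_eq_iff)
    ultimately show ?thesis using that by (simp add: \<Omega>_def feasible_def)
  qed
  have "\<Omega> = (\<Inter>e\<in>pairs V. {w. 0 \<le> w $ e}) \<inter> (\<Inter>S\<in>{S. steiner_set V T S}. {w. 2 \<le> (\<Sum>e\<in>edge_cut (pairs V) S. w $ e)}) \<inter>
    {w. (\<Sum>e\<in>pairs V. w $ e * dist_pair e) \<le> M} \<inter> (\<Inter>e\<in>- pairs V. {w. w $ e = 0})"
    unfolding \<Omega>_def feasible_def cut_value_def by auto
  moreover have "closed \<dots>"
    by (intro closed_Int closed_INT ballI closed_Collect_le closed_Collect_eq continuous_intros)
  ultimately have "closed \<Omega>" by simp
  moreover have "bounded \<Omega>"
  proof (rule boundedI)
    fix w assume w: "w \<in> \<Omega>"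
    have "\<bar>w $ e\<bar> \<le> M" for e
    proof (cases "e \<in> pairs V")
      case True
      have nn: "0 \<le> w $ e" if "e \<in> pairs V" for e using w that by (auto simp: \<Omega>_def feasible_def)
      have "w $ e * 1 \<le> w $ e * dist_pair e" using nn[OF True] dist_pair_pos[OF True] by (intro mult_left_mono) auto
      also have "\<dots> \<le> (\<Sum>e\<in>pairs V. w $ e * dist_pair e)" using nn by (intro member_le_sum[OF True]) auto
      also have "\<dots> \<le> M" using w by (auto simp: \<Omega>_def feasible_def)
      finally show ?thesis using nn[OF True] by simp
    next
      case False
      then show ?thesis using w by (auto simp: \<Omega>_def M_def)
    qed
    then have "(\<Sum>e\<in>UNIV. \<bar>w $ e\<bar>) \<le> (\<Sum>e\<in>(UNIV :: 'a set set). M)" by (intro sum_mono) auto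
    then show "norm w \<le> (\<Sum>e\<in>(UNIV :: 'a set set). M)" using norm_le_l1_cart[of w] by linarith
  qed
  ultimately have "compact \<Omega>" by (simp add: compact_eq_bounded_closed)
  moreover have "\<Omega> \<noteq> {}" using lift[OF feasible_exists] by auto
  moreover have "continuous_on \<Omega> (\<lambda>w. \<Sum>e\<in>pairs V. w $ e)" by (intro continuous_intros)
  ultimately obtain w where w: "w \<in> \<Omega>" "\<And>w'. w' \<in> \<Omega> \<Longrightarrow> (\<Sum>e\<in>pairs V. w $ e) \<le> (\<Sum>e\<in>pairs V. w' $ e)"
    using continuous_attains_inf[of \<Omega> "\<lambda>w. \<Sum>e\<in>pairs V. w $ e"] by blast
  show ?thesis
  proof (rule that[of "\<lambda>e. w $ e"])
    show "feasible (\<lambda>e. w $ e)" using w(1) by (simp add: \<Omega>_def)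
    fix w' assume "feasible w'"
    from w(2)[OF lift[OF this]] show "(\<Sum>e\<in>pairs V. w $ e) \<le> (\<Sum>e\<in>pairs V. w' e)" by simp
  qed
qed

section \<open>Structure of a fractional solution of minimum total weight\<close>

context
  fixes w
  assumes w_feas: "feasible w" and w_min: "\<And>w'. feasible w' \<Longrightarrow> (\<Sum>e\<in>pairs V. w e) \<le> (\<Sum>e\<in>pairs V. w' e)"
begin

lemma w_nonneg: "e \<in> pairs V \<Longrightarrow> 0 \<le> w e"
  and w_cut: "steiner_set V T S \<Longrightarrow> 2 \<le> cut_value (pairs V) w S"
  and w_cost: "(\<Sum>e\<in>pairs V. w e * dist_pair e) \<le> M"
  using w_feas by (auto simp: feasible_def)

text \<open>Otherwise every Steiner set separating \<open>u\<close> and \<open>v\<close> has slack,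
  and lowering the weight of \<open>{u, v}\<close> a little reduces the total weight.
  Complementation puts \<open>u\<close> inside the tight set.\<close>

lemma tight_separating:
  assumes uv: "{u, v} \<in> pairs V" "w {u, v} > 0"
  shows "\<exists>X. steiner_set V T X \<and> cut_value (pairs V) w X = 2 \<and> u \<in> X \<and> v \<notin> X"
proof (rule ccontr)
  assume no: "\<not> ?thesis"
  have uv': "u \<noteq> v" "u \<in> V" "v \<in> V" using uv(1) by (auto simp: pairs_def)
  let ?A = "{S. steiner_set V T S \<and> (u \<in> S) \<noteq> (v \<in> S)}"
  have gt: "cut_value (pairs V) w S - 2 > 0" if "S \<in> ?A" for S
  proof -
    have "cut_value (pairs V) w S \<noteq> 2"
    proof (cases "u \<in> S")
      case True
      then show ?thesis using no that by auto
    next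
      case False
      have "steiner_set V T (V - S)" using steiner_set_complement[OF TV] that by auto
      moreover have "u \<in> V - S" "v \<notin> V - S" using that False uv' by auto
      ultimately show ?thesis using no cut_value_complement_pairs[of V w S] by metis
    qed
    then show ?thesis using w_cut[of S] that by auto
  qed
  obtain \<epsilon>0 where \<epsilon>0: "\<epsilon>0 > 0" "\<forall>S\<in>?A. \<epsilon>0 \<le> cut_value (pairs V) w S - 2"
    using finite_pos_lower_bound[of ?A "\<lambda>S. cut_value (pairs V) w S - 2"] gt by auto
  define \<epsilon> where "\<epsilon> = min \<epsilon>0 (w {u, v})"
  have \<epsilon>: "\<epsilon> > 0" "\<epsilon> \<le> w {u, v}" "\<And>S. S \<in> ?A \<Longrightarrow> \<epsilon> \<le> cut_value (pairs V) w S - 2"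
    using \<epsilon>0 uv(2) by (force simp: \<epsilon>_def)+
  define w' where "w' e = w e + (- \<epsilon>) * (if e = {u, v} then 1 else 0)" for e
  have sum': "(\<Sum>e\<in>pairs V. w' e * f e) = (\<Sum>e\<in>pairs V. w e * f e) - \<epsilon> * f {u, v}" for f :: "'a set \<Rightarrow> real"
    unfolding w'_def sum_add_indicator using uv(1) by simp
  have "feasible w'"
    unfolding feasible_def
  proof (intro conjI ballI allI impI)
    show "0 \<le> w' e" if "e \<in> pairs V" for e using w_nonneg[OF that] \<epsilon>(2) by (auto simp: w'_def)
    show "2 \<le> cut_value (pairs V) w' S" if S: "steiner_set V T S" for S
    proof (cases "(u \<in> S) \<noteq> (v \<in> S)")
      case True
      then show ?thesis using \<epsilon>(3)[of S] S card_edge_inter[OF uv'(1), of S]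
        unfolding cut_value_indicator sum' by auto
    next
      case False
      then show ?thesis using w_cut[OF S] card_edge_inter[OF uv'(1), of S]
        unfolding cut_value_indicator sum' by auto
    qed
    show "(\<Sum>e\<in>pairs V. w' e * real (dist_pair e)) \<le> M"
      unfolding sum' using w_cost \<epsilon>(1) mult_nonneg_nonneg[of \<epsilon> "real (dist_pair {u, v})"] by linarith
  qed
  then have "(\<Sum>e\<in>pairs V. w e) \<le> (\<Sum>e\<in>pairs V. w' e)" by (rule w_min)
  then show False using sum'[of "\<lambda>_. 1"] \<epsilon>(1) by simp
qed

text \<open>
  Splitting off: moving weight from \<open>{u, v}\<close> and \<open>{v, x}\<close> to \<open>{u, x}\<close> lowers the total weight. It is
  obstructed only by tight sets containing \<open>u\<close> and \<open>x\<close> but not \<open>v\<close>. Tight sets containing \<open>u\<close> but not \<open>v\<close>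
  are closed under union, so choose \<open>x\<close> outside the largest one.
\<close>

lemma no_splitting:
  assumes v: "v \<in> V" "v \<notin> T \<or> cut_value (pairs V) w {v} > 2" and uv: "{u, v} \<in> pairs V" "w {u, v} > 0"
  shows False
proof -
  let ?cut = "cut_value (pairs V) w"
  have uv': "u \<noteq> v" "u \<in> V" using uv(1) by (auto simp: pairs_def)
  let ?X = "{X. steiner_set V T X \<and> ?cut X = 2 \<and> u \<in> X \<and> v \<notin> X}"
  have "?X \<noteq> {}" using tight_separating[OF uv] by blast
  moreover have "finite ?X" by simp
  ultimately obtain X where X: "X \<in> ?X" "\<And>Y. Y \<in> ?X \<Longrightarrow> card Y \<le> card X"
    using obtains_MAX[of ?X card] Max_ge by (metis (mono_tags, lifting) finite_imageI imageI)
  have XV: "X \<subseteq> V" "steiner_set V T X" "?cut X = 2" "u \<in> X" "v \<notin> X" using X(1) by (auto simp: steiner_set_def)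
  \<comment> \<open>Uncrossing: if intersection and union are Steiner sets, submodularity makes the
    union tight and the maximality of \<open>X\<close> applies. Otherwise both differences are
    Steiner sets, and posimodularity contradicts \<open>w {u, v} > 0\<close>.\<close>
  have sub: "Y \<subseteq> X" if Y: "Y \<in> ?X" for Y
  proof (cases "T \<inter> X \<inter> Y \<noteq> {} \<and> T - (X \<union> Y) \<noteq> {}")
    case True
    then have st: "steiner_set V T (X \<inter> Y)" "steiner_set V T (X \<union> Y)"
      using X(1) Y by (auto simp: steiner_set_def)
    have "?cut (X \<union> Y) = 2"
      using cut_value_submodular[of V w X Y] w_nonneg w_cut[OF st(1)] w_cut[OF st(2)] X(1) Y by auto
    then have "X \<union> Y \<in> ?X" using st(2) X(1) Y by auto
    then have "card (X \<union> Y) \<le> card X" by (rule X(2))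
    then have "X \<union> Y = X" by (metis card_seteq finite sup_ge1)
    then show ?thesis by auto
  next
    case False
    then have "steiner_set V T (X - Y)" "steiner_set V T (Y - X)"
      using X(1) Y by (auto simp: steiner_set_def)
    then have "?cut (X - Y) \<ge> 2" "?cut (Y - X) \<ge> 2" using w_cut by auto
    moreover have "?cut (X - Y) + ?cut (Y - X) + 2 * w {u, v} \<le> ?cut X + ?cut Y"
      using X(1) Y w_nonneg by (intro cut_value_posimodular uv(1)) auto
    ultimately show ?thesis using X(1) Y uv(2) by auto
  qed
  \<comment> \<open>If all positive pairs at \<open>v\<close> led into \<open>X\<close>, adding
    \<open>v\<close> to \<open>X\<close> would lower its cut by at least the cut of
    \<open>{v}\<close>. For a nonterminal \<open>v\<close> this gives a Steiner set of value below
    2; for a terminal the cut of \<open>{v}\<close> already exceeds the value 2 of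
    \<open>X\<close>.\<close>
  have "\<exists>x. x \<in> V - X \<and> x \<noteq> v \<and> w {v, x} > 0"
  proof (rule ccontr)
    assume "\<not> ?thesis"
    then have zero: "w {v, x} = 0" if "x \<in> V - X" "x \<noteq> v" for x
      using that w_nonneg[of "{v, x}"] pairsI[of v V x] v(1) by force
    have le: "?cut (insert v X) + ?cut {v} \<le> ?cut X"
      unfolding cut_value_indicator sum.distrib[symmetric]
    proof (rule sum_mono)
      fix e assume e: "e \<in> pairs V"
      then obtain a b where ab: "e = {a, b}" "a \<noteq> b" "a \<in> V" "b \<in> V" by (elim pairsE)
      show "w e * (if card (e \<inter> insert v X) = 1 then 1 else 0) + w e * (if card (e \<inter> {v}) = 1 then 1 else 0)
         \<le> w e * (if card (e \<inter> X) = 1 then 1 else 0)"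
        using w_nonneg[OF e] zero[of a] zero[of b] XV(5) ab
        unfolding ab(1) card_edge_inter[OF ab(2)] by (auto simp: insert_commute)
    qed
    have "?cut {v} > 0"
    proof -
      have "w {u, v} * (if card ({u, v} \<inter> {v}) = 1 then 1 else 0) \<le> ?cut {v}"
        unfolding cut_value_indicator using w_nonneg by (intro member_le_sum[OF uv(1)]) auto
      then show ?thesis using uv(2) card_edge_inter[OF uv'(1), of "{v}"] uv' by auto
    qed
    have nn: "?cut (insert v X) \<ge> 0"
      unfolding cut_value_def using w_nonneg edge_cut_subset[of "pairs V"] by (intro sum_nonneg) blast
    show False
    proof (cases "v \<in> T")
      case False
      then have "steiner_set V T (insert v X)" using XV(2) v(1) by (auto simp: steiner_set_def)
      then show False using w_cut[of "insert v X"] le XV(3) \<open>?cut {v} > 0\<close> by auto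
    next
      case True
      then show False using v(2) le nn XV(3) by auto
    qed
  qed
  then obtain x where x: "x \<in> V" "x \<notin> X" "x \<noteq> v" "w {v, x} > 0" by auto
  have xu: "x \<noteq> u" using x XV(4) by auto
  \<comment> \<open>Only sets with \<open>v\<close> on one side and both \<open>u\<close> and
    \<open>x\<close> on the other lose by the splitting, namely \<open>2 * \<epsilon>\<close>. None
    of them is tight: up to complement, a tight one would contain \<open>u\<close> and not
    \<open>v\<close>, hence lie in \<open>X\<close>, yet contain \<open>x\<close>.\<close>
  let ?A = "{S. steiner_set V T S \<and> (v \<in> S) \<noteq> (u \<in> S) \<and> (v \<in> S) \<noteq> (x \<in> S)}"
  have gt: "(?cut S - 2) / 2 > 0" if S: "S \<in> ?A" for S
  proof -
    have "?cut S \<noteq> 2"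
    proof
      assume t: "?cut S = 2"
      show False
      proof (cases "v \<in> S")
        case False
        then have "S \<in> ?X" using S t by auto
        then show False using sub[of S] x(2) S False by auto
      next
        case True
        have "steiner_set V T (V - S)" using steiner_set_complement[OF TV] S by auto
        moreover have "?cut (V - S) = 2" using t by (simp add: cut_value_complement_pairs)
        ultimately have "V - S \<in> ?X" using S True uv' by auto
        then show False using sub[of "V - S"] x S True by auto
      qed
    qed
    then show ?thesis using w_cut[of S] S by auto
  qed
  obtain \<epsilon>0 where \<epsilon>0: "\<epsilon>0 > 0" "\<forall>S\<in>?A. \<epsilon>0 \<le> (?cut S - 2) / 2"
    using finite_pos_lower_bound[of ?A "\<lambda>S. (?cut S - 2) / 2"] gt by auto
  define \<epsilon> where "\<epsilon> = min \<epsilon>0 (min (w {u, v}) (w {v, x}))"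
  have \<epsilon>: "\<epsilon> > 0" "\<epsilon> \<le> w {u, v}" "\<epsilon> \<le> w {v, x}" "\<And>S. S \<in> ?A \<Longrightarrow> \<epsilon> \<le> (?cut S - 2) / 2"
    using \<epsilon>0 uv(2) x(4) by (force simp: \<epsilon>_def)+
  define w' where "w' e = w e + (- \<epsilon>) * (if e = {u, v} then 1 else 0) + (- \<epsilon>) * (if e = {v, x} then 1 else 0)
     + \<epsilon> * (if e = {u, x} then 1 else 0)" for e
  have inP: "{v, x} \<in> pairs V" "{u, x} \<in> pairs V" using x uv' v(1) xu by (auto intro!: pairsI)
  have sum': "(\<Sum>e\<in>pairs V. w' e * f e) = (\<Sum>e\<in>pairs V. w e * f e) - \<epsilon> * (f {u, v} + f {v, x} - f {u, x})"
    for f :: "'a set \<Rightarrow> real"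
    unfolding w'_def sum_add_indicator using uv(1) inP by (simp add: algebra_simps)
  have "feasible w'"
    unfolding feasible_def
  proof (intro conjI ballI allI impI)
    fix e assume e: "e \<in> pairs V"
    have "{u, v} \<noteq> {v, x}" using xu uv' by (auto simp: doubleton_eq_iff)
    then show "0 \<le> w' e" using w_nonneg[OF e] \<epsilon>(1-3) by (auto simp: w'_def)
  next
    fix S assume S: "steiner_set V T S"
    note cd = card_edge_inter[OF uv'(1), of S] card_edge_inter[OF x(3), of S] card_edge_inter[OF xu, of S]
    show "2 \<le> cut_value (pairs V) w' S"
    proof (cases "S \<in> ?A")
      case True
      then have "2 * \<epsilon> \<le> ?cut S - 2" using \<epsilon>(4)[OF True] by simp
      then show ?thesis using True cd \<epsilon>(1)
        unfolding cut_value_indicator sum' by (auto simp: insert_commute algebra_simps)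
    next
      case False
      then show ?thesis using S cd \<epsilon>(1) w_cut[OF S]
        unfolding cut_value_indicator sum' by (auto simp: insert_commute algebra_simps)
    qed
  next
    have "real (dist_pair {u, x}) \<le> dist_pair {u, v} + dist_pair {v, x}"
      using dist_pair_triangle[OF uv'(2) v(1) x(1)] by simp
    then have "0 \<le> \<epsilon> * (real (dist_pair {u, v}) + real (dist_pair {v, x}) - real (dist_pair {u, x}))"
      using \<epsilon>(1) by (intro mult_nonneg_nonneg) auto
    then show "(\<Sum>e\<in>pairs V. w' e * real (dist_pair e)) \<le> M"
      unfolding sum' using w_cost by linarith
  qed
  then have "(\<Sum>e\<in>pairs V. w e) \<le> (\<Sum>e\<in>pairs V. w' e)" by (rule w_min)
  then show False using sum'[of "\<lambda>_. 1"] \<epsilon>(1) by simp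
qed

lemma w_support: "e \<in> pairs V - pairs T \<Longrightarrow> w e = 0"
proof (rule ccontr)
  assume e: "e \<in> pairs V - pairs T" and "w e \<noteq> 0"
  then have "w e > 0" using w_nonneg[of e] by auto
  obtain a b where ab: "e = {a, b}" "a \<noteq> b" "a \<in> V" "b \<in> V" using e by (auto elim: pairsE)
  then consider "a \<notin> T" | "b \<notin> T" using e pairsI[of a T b] by auto
  then show False
  proof cases
    case 1
    then show False using no_splitting[of a b] ab e \<open>w e > 0\<close> by (auto simp: insert_commute)
  next
    case 2
    then show False using no_splitting[of b a] ab e \<open>w e > 0\<close> by auto
  qed
qed

lemma pairs_T: "pairs T \<subseteq> pairs V"
  using TV by (auto simp: pairs_def)

lemma w_sum_T: "(\<Sum>e\<in>pairs V. w e * f e) = (\<Sum>e\<in>pairs T. w e * f e)"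
  using w_support pairs_T by (intro sum.mono_neutral_right) auto

lemma w_cost_T: "(\<Sum>e\<in>pairs T. w e * dist_pair e) \<le> M"
  using w_cost w_sum_T[of dist_pair] by simp

text \<open>The cut around a terminal requires degree at least 2, and a terminal of larger degree
  could be split off further.\<close>

lemma w_degree:
  assumes "t \<in> T"
  shows "(\<Sum>e\<in>{e \<in> pairs T. t \<in> e}. w e) = 2"
proof -
  have "T \<noteq> {t}" using T2 by auto
  then have st: "steiner_set V T {t}" using assms TV by (auto simp: steiner_set_def)
  have "cut_value (pairs V) w {t} = 2"
  proof (rule ccontr)
    assume "cut_value (pairs V) w {t} \<noteq> 2"
    then have gt: "cut_value (pairs V) w {t} > 2" using w_cut[OF st] by simp
    then have "edge_cut (pairs V) {t} \<noteq> {}" by (auto simp: cut_value_def)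
    have "\<exists>e\<in>edge_cut (pairs V) {t}. w e > 0"
    proof (rule ccontr)
      assume "\<not> ?thesis"
      then have "cut_value (pairs V) w {t} \<le> 0" unfolding cut_value_def by (intro sum_nonpos) auto
      then show False using gt by simp
    qed
    then obtain e where e: "e \<in> pairs V" "card (e \<inter> {t}) = 1" "w e > 0" by (auto simp: edge_cut_def)
    then have "t \<in> e" by (cases "t \<in> e") auto
    obtain a b where ab: "e = {a, b}" "a \<noteq> b" using e by (auto elim: pairsE)
    then have "\<exists>u. e = {u, t}" using \<open>t \<in> e\<close> by (auto simp: insert_commute)
    then obtain u where "e = {u, t}" by blast
    then show False using no_splitting[of t u] gt assms TV e by auto
  qed
  then have "2 = (\<Sum>e\<in>pairs T. w e * (if card (e \<inter> {t}) = 1 then 1 else 0))"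
    unfolding cut_value_indicator w_sum_T by simp
  also have "\<dots> = (\<Sum>e\<in>pairs T. if t \<in> e then w e else 0)"
    by (intro sum.cong) auto
  also have "\<dots> = (\<Sum>e\<in>{e \<in> pairs T. t \<in> e}. w e)"
    by (simp add: sum.If_cases Int_def)
  finally show ?thesis by simp
qed

lemma w_cut_T: "steiner_set V T S \<Longrightarrow> 2 \<le> cut_value (pairs T) w S"
  using w_cut[of S] unfolding cut_value_indicator w_sum_T .

lemma w_nonneg_T: "e \<in> pairs T \<Longrightarrow> 0 \<le> w e"
  using w_nonneg pairs_T by auto

end

text \<open>Weak duality: add up the constraints of all tight sets. A pair then occurs
  \<open>len\<close> times, which is at most its distance.\<close>

lemma cost_lower_bound:
  assumes "\<And>e. e \<in> pairs T \<Longrightarrow> 0 \<le> w e" "\<And>S. steiner_set V T S \<Longrightarrow> 2 \<le> cut_value (pairs T) w S"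
  shows "M \<le> (\<Sum>e\<in>pairs T. w e * dist_pair e)"
proof -
  have "M = (\<Sum>S\<in>tights. 2)" by (simp add: M_def)
  also have "\<dots> \<le> (\<Sum>S\<in>tights. cut_value (pairs T) w S)"
    using assms(2) by (intro sum_mono) (auto simp: tights_def)
  also have "\<dots> = (\<Sum>e\<in>pairs T. w e * len e)"
    unfolding cut_value_indicator len_def
    by (subst sum.swap) (simp add: sum_distrib_left if_distrib cong: if_cong)
  also have "\<dots> \<le> (\<Sum>e\<in>pairs T. w e * dist_pair e)"
  proof (intro sum_mono mult_left_mono)
    fix e assume e: "e \<in> pairs T"
    then obtain a b where "e = {a, b}" "a \<noteq> b" "a \<in> V" "b \<in> V" using TV by (auto elim!: pairsE)
    then show "real (len e) \<le> real (dist_pair e)" using dist_pair_ge[of a b] by simp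
    show "0 \<le> w e" by (rule assms(1)[OF e])
  qed
  finally show ?thesis .
qed

end

section \<open>Tours on at most five terminals\<close>

lemma pairs_empty: "pairs {} = {}"
  by (auto simp: pairs_def)

lemma pairs_insert: "a \<notin> A \<Longrightarrow> pairs (insert a A) = (\<lambda>x. {a, x}) ` A \<union> pairs A"
proof (intro equalityI subsetI)
  fix e assume a: "a \<notin> A" and "e \<in> pairs (insert a A)"
  then obtain x y where "e = {x, y}" "x \<noteq> y" "x \<in> insert a A" "y \<in> insert a A" by (elim pairsE)
  then show "e \<in> (\<lambda>x. {a, x}) ` A \<union> pairs A"
    by (auto intro: pairsI simp: insert_commute)
next
  fix e assume "a \<notin> A" "e \<in> (\<lambda>x. {a, x}) ` A \<union> pairs A"
  then show "e \<in> pairs (insert a A)"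
    by (auto simp: pairs_def card_insert_if)
qed

lemma sum_pairs_star:
  assumes "t \<in> A"
  shows "(\<Sum>e\<in>{e \<in> pairs A. t \<in> e}. w e) = (\<Sum>x\<in>A - {t}. w {t, x})"
proof -
  have "{e \<in> pairs A. t \<in> e} = (\<lambda>x. {t, x}) ` (A - {t})"
  proof (intro equalityI subsetI)
    fix e assume e: "e \<in> {e \<in> pairs A. t \<in> e}"
    then obtain x y where "e = {x, y}" "x \<noteq> y" "x \<in> A" "y \<in> A" by (auto elim: pairsE)
    then show "e \<in> (\<lambda>x. {t, x}) ` (A - {t})" using e by auto
  qed (use assms in \<open>auto simp: pairs_def\<close>)
  moreover have "inj_on (\<lambda>x. {t, x}) (A - {t})" by (auto simp: inj_on_def doubleton_eq_iff)
  ultimately show ?thesis by (simp add: sum.reindex)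
qed

text \<open>As a set, this suits tours on at least three nodes; a tour on two terminals uses its
  edge twice, which only the list of \<open>wedges\<close> records.\<close>

definition tour_edges :: "'a list \<Rightarrow> 'a set set" where
  "tour_edges ts = set (wedges (ts @ [hd ts]))"

text \<open>
  The existence of these tours is a finite form of the fact that the subtour polytope on at
  most five nodes is integral.
\<close>

lemma tour_through_support_4:
  assumes dist: "distinct [a, b, c, d]" and w: "\<And>e. e \<in> pairs {a, b, c, d} \<Longrightarrow> 0 \<le> w e \<and> w e \<le> (1::real)"
    and deg: "\<And>t. t \<in> {a, b, c, d} \<Longrightarrow> (\<Sum>e\<in>{e \<in> pairs {a, b, c, d}. t \<in> e}. w e) = 2"
  shows "\<exists>ts. distinct ts \<and> set ts = {a, b, c, d} \<and> length ts = 4 \<and> (\<forall>e\<in>tour_edges ts. 0 < w e) \<and>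
    (\<forall>e\<in>pairs {a, b, c, d} - tour_edges ts. w e < 1)"
proof -
  have ne: "a \<noteq> b" "a \<noteq> c" "a \<noteq> d" "b \<noteq> a" "b \<noteq> c" "b \<noteq> d" "c \<noteq> a" "c \<noteq> b" "c \<noteq> d" "d \<noteq> a" "d \<noteq> b" "d \<noteq> c"
    using dist by auto
  have d: "w {a, b} + w {a, c} + w {a, d} = 2" "w {a, b} + w {b, c} + w {b, d} = 2" "w {a, c} + w {b, c} + w {c, d} = 2" "w {a, d} + w {b, d} + w {c, d} = 2"
    using deg[of a] deg[of b] deg[of c] deg[of d] dist
    by (simp_all add: sum_pairs_star insert_Diff_if ne insert_commute add.assoc)
  have r: "0 \<le> w {a, b} \<and> w {a, b} \<le> 1" "0 \<le> w {a, c} \<and> w {a, c} \<le> 1" "0 \<le> w {a, d} \<and> w {a, d} \<le> 1" "0 \<le> w {b, c} \<and> w {b, c} \<le> 1" "0 \<le> w {b, d} \<and> w {b, d} \<le> 1" "0 \<le> w {c, d} \<and> w {c, d} \<le> 1"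
    using w dist by (auto intro!: pairsI)
  \<comment> \<open>The three Hamiltonian cycles on four nodes, each with positive edges and chords
    below 1, as \<open>convex_position_bound\<close> asks. That one of them fits is linear
    arithmetic.\<close>
  have disj: "(0 < w {a, b} \<and> 0 < w {b, c} \<and> 0 < w {c, d} \<and> 0 < w {a, d} \<and> w {a, c} < 1 \<and> w {b, d} < 1) \<or>
    (0 < w {a, b} \<and> 0 < w {b, d} \<and> 0 < w {c, d} \<and> 0 < w {a, c} \<and> w {a, d} < 1 \<and> w {b, c} < 1) \<or>
    (0 < w {a, c} \<and> 0 < w {b, c} \<and> 0 < w {b, d} \<and> 0 < w {a, d} \<and> w {a, b} < 1 \<and> w {c, d} < 1)"
    using d r by (smt (z3))
  have all_pairs: "pairs {a, b, c, d} = {{a, b}, {a, c}, {a, d}, {b, c}, {b, d}, {c, d}}"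
    by (auto simp: pairs_insert pairs_empty dist[simplified])
  have "\<exists>ts. distinct ts \<and> set ts = {a, b, c, d} \<and> length ts = 4 \<and> (\<forall>e\<in>tour_edges ts. 0 < w e) \<and>
    (\<forall>e\<in>{{a, b}, {a, c}, {a, d}, {b, c}, {b, d}, {c, d}} - tour_edges ts. w e < 1)"
    using disj
    apply (elim disjE)
    subgoal using dist by (intro exI[of _ "[a, b, c, d]"]) (simp add: tour_edges_def insert_commute, blast?)
    subgoal using dist by (intro exI[of _ "[a, b, d, c]"]) (simp add: tour_edges_def insert_commute, blast?)
    subgoal using dist by (intro exI[of _ "[a, c, b, d]"]) (simp add: tour_edges_def insert_commute, blast?)
    done
  then show ?thesis unfolding all_pairs .
qed

lemma tour_through_support_5:
  assumes dist: "distinct [a, b, c, d, e]" and w: "\<And>x. x \<in> pairs {a, b, c, d, e} \<Longrightarrow> 0 \<le> w x \<and> w x \<le> (1::real)"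
    and deg: "\<And>t. t \<in> {a, b, c, d, e} \<Longrightarrow> (\<Sum>x\<in>{x \<in> pairs {a, b, c, d, e}. t \<in> x}. w x) = 2"
  shows "\<exists>ts. distinct ts \<and> set ts = {a, b, c, d, e} \<and> length ts = 5 \<and> (\<forall>x\<in>tour_edges ts. 0 < w x) \<and>
    (\<forall>x\<in>pairs {a, b, c, d, e} - tour_edges ts. w x < 1)"
proof -
  have ne: "a \<noteq> b" "a \<noteq> c" "a \<noteq> d" "a \<noteq> e" "b \<noteq> a" "b \<noteq> c" "b \<noteq> d" "b \<noteq> e" "c \<noteq> a" "c \<noteq> b" "c \<noteq> d" "c \<noteq> e" "d \<noteq> a" "d \<noteq> b" "d \<noteq> c" "d \<noteq> e" "e \<noteq> a" "e \<noteq> b" "e \<noteq> c" "e \<noteq> d"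
    using dist by auto
  have d: "w {a, b} + w {a, c} + w {a, d} + w {a, e} = 2" "w {a, b} + w {b, c} + w {b, d} + w {b, e} = 2" "w {a, c} + w {b, c} + w {c, d} + w {c, e} = 2" "w {a, d} + w {b, d} + w {c, d} + w {d, e} = 2" "w {a, e} + w {b, e} + w {c, e} + w {d, e} = 2"
    using deg[of a] deg[of b] deg[of c] deg[of d] deg[of e] dist
    by (simp_all add: sum_pairs_star insert_Diff_if ne insert_commute add.assoc)
  have r: "0 \<le> w {a, b} \<and> w {a, b} \<le> 1" "0 \<le> w {a, c} \<and> w {a, c} \<le> 1" "0 \<le> w {a, d} \<and> w {a, d} \<le> 1" "0 \<le> w {a, e} \<and> w {a, e} \<le> 1" "0 \<le> w {b, c} \<and> w {b, c} \<le> 1" "0 \<le> w {b, d} \<and> w {b, d} \<le> 1" "0 \<le> w {b, e} \<and> w {b, e} \<le> 1" "0 \<le> w {c, d} \<and> w {c, d} \<le> 1" "0 \<le> w {c, e} \<and> w {c, e} \<le> 1" "0 \<le> w {d, e} \<and> w {d, e} \<le> 1"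
    using w dist by (auto intro!: pairsI)
  \<comment> \<open>The twelve Hamiltonian cycles on five nodes, each against its five
    chords.\<close>
  have disj: "(0 < w {a, b} \<and> 0 < w {b, c} \<and> 0 < w {c, d} \<and> 0 < w {d, e} \<and> 0 < w {a, e} \<and> w {a, c} < 1 \<and> w {a, d} < 1 \<and> w {b, d} < 1 \<and> w {b, e} < 1 \<and> w {c, e} < 1) \<or>
    (0 < w {a, b} \<and> 0 < w {b, c} \<and> 0 < w {c, e} \<and> 0 < w {d, e} \<and> 0 < w {a, d} \<and> w {a, c} < 1 \<and> w {a, e} < 1 \<and> w {b, d} < 1 \<and> w {b, e} < 1 \<and> w {c, d} < 1) \<or>
    (0 < w {a, b} \<and> 0 < w {b, d} \<and> 0 < w {c, d} \<and> 0 < w {c, e} \<and> 0 < w {a, e} \<and> w {a, c} < 1 \<and> w {a, d} < 1 \<and> w {b, c} < 1 \<and> w {b, e} < 1 \<and> w {d, e} < 1) \<or>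
    (0 < w {a, b} \<and> 0 < w {b, d} \<and> 0 < w {d, e} \<and> 0 < w {c, e} \<and> 0 < w {a, c} \<and> w {a, d} < 1 \<and> w {a, e} < 1 \<and> w {b, c} < 1 \<and> w {b, e} < 1 \<and> w {c, d} < 1) \<or>
    (0 < w {a, b} \<and> 0 < w {b, e} \<and> 0 < w {c, e} \<and> 0 < w {c, d} \<and> 0 < w {a, d} \<and> w {a, c} < 1 \<and> w {a, e} < 1 \<and> w {b, c} < 1 \<and> w {b, d} < 1 \<and> w {d, e} < 1) \<or>
    (0 < w {a, b} \<and> 0 < w {b, e} \<and> 0 < w {d, e} \<and> 0 < w {c, d} \<and> 0 < w {a, c} \<and> w {a, d} < 1 \<and> w {a, e} < 1 \<and> w {b, c} < 1 \<and> w {b, d} < 1 \<and> w {c, e} < 1) \<or>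
    (0 < w {a, c} \<and> 0 < w {b, c} \<and> 0 < w {b, d} \<and> 0 < w {d, e} \<and> 0 < w {a, e} \<and> w {a, b} < 1 \<and> w {a, d} < 1 \<and> w {b, e} < 1 \<and> w {c, d} < 1 \<and> w {c, e} < 1) \<or>
    (0 < w {a, c} \<and> 0 < w {b, c} \<and> 0 < w {b, e} \<and> 0 < w {d, e} \<and> 0 < w {a, d} \<and> w {a, b} < 1 \<and> w {a, e} < 1 \<and> w {b, d} < 1 \<and> w {c, d} < 1 \<and> w {c, e} < 1) \<or>
    (0 < w {a, c} \<and> 0 < w {c, d} \<and> 0 < w {b, d} \<and> 0 < w {b, e} \<and> 0 < w {a, e} \<and> w {a, b} < 1 \<and> w {a, d} < 1 \<and> w {b, c} < 1 \<and> w {c, e} < 1 \<and> w {d, e} < 1) \<or>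
    (0 < w {a, c} \<and> 0 < w {c, e} \<and> 0 < w {b, e} \<and> 0 < w {b, d} \<and> 0 < w {a, d} \<and> w {a, b} < 1 \<and> w {a, e} < 1 \<and> w {b, c} < 1 \<and> w {c, d} < 1 \<and> w {d, e} < 1) \<or>
    (0 < w {a, d} \<and> 0 < w {c, d} \<and> 0 < w {b, c} \<and> 0 < w {b, e} \<and> 0 < w {a, e} \<and> w {a, b} < 1 \<and> w {a, c} < 1 \<and> w {b, d} < 1 \<and> w {c, e} < 1 \<and> w {d, e} < 1) \<or>
    (0 < w {a, d} \<and> 0 < w {b, d} \<and> 0 < w {b, c} \<and> 0 < w {c, e} \<and> 0 < w {a, e} \<and> w {a, b} < 1 \<and> w {a, c} < 1 \<and> w {b, e} < 1 \<and> w {c, d} < 1 \<and> w {d, e} < 1)"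
    using d r by (smt (z3))
  have all_pairs: "pairs {a, b, c, d, e} = {{a, b}, {a, c}, {a, d}, {a, e}, {b, c}, {b, d}, {b, e}, {c, d}, {c, e}, {d, e}}"
    by (auto simp: pairs_insert pairs_empty dist[simplified])
  have "\<exists>ts. distinct ts \<and> set ts = {a, b, c, d, e} \<and> length ts = 5 \<and> (\<forall>x\<in>tour_edges ts. 0 < w x) \<and>
    (\<forall>x\<in>{{a, b}, {a, c}, {a, d}, {a, e}, {b, c}, {b, d}, {b, e}, {c, d}, {c, e}, {d, e}} - tour_edges ts. w x < 1)"
    using disj
    apply (elim disjE)
    subgoal using dist by (intro exI[of _ "[a, b, c, d, e]"]) (simp add: tour_edges_def insert_commute, blast?)
    subgoal using dist by (intro exI[of _ "[a, b, c, e, d]"]) (simp add: tour_edges_def insert_commute, blast?)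
    subgoal using dist by (intro exI[of _ "[a, b, d, c, e]"]) (simp add: tour_edges_def insert_commute, blast?)
    subgoal using dist by (intro exI[of _ "[a, b, d, e, c]"]) (simp add: tour_edges_def insert_commute, blast?)
    subgoal using dist by (intro exI[of _ "[a, b, e, c, d]"]) (simp add: tour_edges_def insert_commute, blast?)
    subgoal using dist by (intro exI[of _ "[a, b, e, d, c]"]) (simp add: tour_edges_def insert_commute, blast?)
    subgoal using dist by (intro exI[of _ "[a, c, b, d, e]"]) (simp add: tour_edges_def insert_commute, blast?)
    subgoal using dist by (intro exI[of _ "[a, c, b, e, d]"]) (simp add: tour_edges_def insert_commute, blast?)
    subgoal using dist by (intro exI[of _ "[a, c, d, b, e]"]) (simp add: tour_edges_def insert_commute, blast?)
    subgoal using dist by (intro exI[of _ "[a, c, e, b, d]"]) (simp add: tour_edges_def insert_commute, blast?)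
    subgoal using dist by (intro exI[of _ "[a, d, c, b, e]"]) (simp add: tour_edges_def insert_commute, blast?)
    subgoal using dist by (intro exI[of _ "[a, d, b, c, e]"]) (simp add: tour_edges_def insert_commute, blast?)
    done
  then show ?thesis unfolding all_pairs .
qed

section \<open>Cuts and cheap tours on few terminals\<close>

lemma cut_value_singleton_pairs:
  "cut_value (pairs A) (w :: 'a::finite set \<Rightarrow> real) {t} = (\<Sum>e\<in>{e \<in> pairs A. t \<in> e}. w e)"
  unfolding cut_value_def edge_cut_def by (intro sum.cong) (auto simp: Int_insert_right)

lemma cut_value_doubleton_pairs:
  fixes w :: "'a::finite set \<Rightarrow> real"
  assumes "{s, t} \<in> pairs A"
  shows "cut_value (pairs A) w {s, t} =
    (\<Sum>e\<in>{e \<in> pairs A. s \<in> e}. w e) + (\<Sum>e\<in>{e \<in> pairs A. t \<in> e}. w e) - 2 * w {s, t}"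
proof -
  have st: "s \<noteq> t" using assms by (auto simp: pairs_def)
  have star: "(\<Sum>e\<in>{e \<in> pairs A. u \<in> e}. w e) = (\<Sum>e\<in>pairs A. w e * (if u \<in> e then 1 else 0))" for u
    by (simp add: if_distrib[of "\<lambda>x. _ * x"] sum.If_cases Int_def cong: if_cong)
  have one: "w {s, t} = (\<Sum>e\<in>pairs A. if e = {s, t} then w e else 0)"
    using assms by (subst sum.delta) auto
  show ?thesis
    unfolding star one cut_value_indicator sum_distrib_left sum.distrib[symmetric] sum_subtractf[symmetric]
  proof (rule sum.cong[OF refl])
    fix e assume "e \<in> pairs A"
    then obtain x y where "e = {x, y}" "x \<noteq> y" by (elim pairsE)
    then show "w e * (if card (e \<inter> {s, t}) = 1 then 1 else 0)
        = w e * (if s \<in> e then 1 else 0) + w e * (if t \<in> e then 1 else 0) - 2 * (if e = {s, t} then w e else 0)"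
      using st card_edge_inter[of x y "{s, t}"] by (auto simp: doubleton_eq_iff)
  qed
qed

text \<open>One side of the cut has at most two terminals. A single one has degree 2, and two of
  them have cut value \<open>4 - 2 * w {s, t}\<close>, at least 2 by the upper bound. So the cut
  constraints follow from equations and bounds, the only constraints in
  \<open>convex_position_bound\<close>.\<close>

lemma degree_cut_ge:
  fixes w :: "'a::finite set \<Rightarrow> real"
  assumes "card T \<le> 5" "T \<subseteq> V" "steiner_set V T S"
    and deg: "\<And>t. t \<in> T \<Longrightarrow> (\<Sum>e\<in>{e \<in> pairs T. t \<in> e}. w e) = 2"
    and w: "\<And>e. e \<in> pairs T \<Longrightarrow> w e \<le> 1"
  shows "2 \<le> cut_value (pairs T) w S"
proof -
  have small: "2 \<le> cut_value (pairs T) w A" if A: "A \<subseteq> T" "A \<noteq> {}" "card A \<le> 2" for A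
  proof -
    have "card A \<noteq> 0" using A(2) by simp
    then have "card A = 1 \<or> card A = 2" using A(3) by linarith
    then show ?thesis
    proof
      assume "card A = 1"
      then obtain t where t: "A = {t}" by (auto simp: card_1_singleton_iff)
      then show ?thesis using cut_value_singleton_pairs[of T w t] deg[of t] A(1) by simp
    next
      assume "card A = 2"
      then obtain s t where st: "A = {s, t}" "s \<noteq> t" by (auto simp: card_2_iff)
      have stP: "{s, t} \<in> pairs T" using st A(1) by (intro pairsI) auto
      then show ?thesis using cut_value_doubleton_pairs[OF stP, of w] deg[of s] deg[of t] w[OF stP] st A(1) by simp
    qed
  qed
  have eq: "cut_value (pairs T) w S = cut_value (pairs T) w (S \<inter> T)"
    unfolding cut_value_indicator
  proof (rule sum.cong[OF refl])
    fix e assume "e \<in> pairs T"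
    then have "e \<inter> (S \<inter> T) = e \<inter> S" by (auto simp: pairs_def)
    then show "w e * (if card (e \<inter> S) = 1 then 1 else 0) = w e * (if card (e \<inter> (S \<inter> T)) = 1 then 1 else 0)" by simp
  qed
  have "card (S \<inter> T) + card (T - S) = card T"
    using card_Un_disjoint[of "S \<inter> T" "T - S"] by (metis Int_Diff_Un Int_Diff_disjoint Int_commute finite)
  then consider "card (S \<inter> T) \<le> 2" | "card (T - S) \<le> 2" using assms(1) by linarith
  then show ?thesis
  proof cases
    case 1
    then show ?thesis unfolding eq using assms(3) by (intro small) (auto simp: steiner_set_def)
  next
    case 2
    have "cut_value (pairs T) w (S \<inter> T) = cut_value (pairs T) w (T - S \<inter> T)"
      by (rule cut_value_complement_pairs[symmetric])
    moreover have "T - S \<inter> T = T - S" by auto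
    ultimately show ?thesis unfolding eq using 2 assms(3) by (simp, intro small) (auto simp: steiner_set_def)
  qed
qed

lemma Collect_disj_conj:
  "{x. (x = a \<or> Q x) \<and> P x} = (if P a then insert a {x. Q x \<and> P x} else {x. Q x \<and> P x})"
  by auto

lemma card_tour_edges_at:
  assumes "distinct ts" "3 \<le> length ts" "length ts \<le> 5" "t \<in> set ts"
  shows "card {e \<in> tour_edges ts. t \<in> e} = 2"
proof -
  consider a b c where "ts = [a, b, c]" | a b c d where "ts = [a, b, c, d]" | a b c d e where "ts = [a, b, c, d, e]"
  proof -
    have "length ts = 3 \<or> length ts = 4 \<or> length ts = 5" using assms(2,3) by linarith
    then show ?thesis using that by (auto simp: eval_nat_numeral length_Suc_conv)
  qed
  then show ?thesis
    using assms(1,4) by cases (auto simp: tour_edges_def Collect_disj_conj Collect_conv_if doubleton_eq_iff card_insert_if)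
qed

lemma sum_tour_edges:
  assumes "distinct ts" "3 \<le> length ts"
  shows "sum f (tour_edges ts) = sum_list (map f (wedges (ts @ [hd ts])))"
proof -
  have ne: "ts \<noteq> []" using assms(2) by auto
  have w: "wedges (ts @ [hd ts]) = wedges ts @ [{last ts, hd ts}]" using ne by (simp add: wedges_append)
  have "{hd ts, last ts} \<notin> set (wedges ts)" using edge_joining_path_ends[OF assms(1)] assms(2) by force
  then have "distinct (wedges (ts @ [hd ts]))" unfolding w using distinct_wedges[OF assms(1)] by (auto simp: insert_commute)
  then show ?thesis unfolding tour_edges_def by (simp add: sum_list_distinct_conv_sum_set)
qed

lemma tour_edges_subset:
  assumes "distinct ts" "2 \<le> length ts"
  shows "tour_edges ts \<subseteq> pairs (set ts)"
proof
  fix e assume e: "e \<in> tour_edges ts"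
  have ne: "ts \<noteq> []" using assms(2) by auto
  have "hd ts \<noteq> last ts" using assms by (cases ts rule: wedges.cases) auto
  then have "card e = 2"
    using e card_wedges[OF assms(1)] ne unfolding tour_edges_def by (auto simp: wedges_append)
  moreover have "e \<subseteq> set ts" using e ne wedges_subset[of e "ts @ [hd ts]"] by (auto simp: tour_edges_def)
  ultimately show "e \<in> pairs (set ts)" by (simp add: pairs_def)
qed

context extremal_weights
begin

lemma cheap_tour_exists:
  assumes T5: "card T \<le> 5"
  obtains ts where "distinct ts" "ts \<noteq> []" "set ts = T" "real (sum_list (map dist_pair (wedges (ts @ [hd ts])))) \<le> M"
proof -
  obtain w where w: "feasible w" "\<And>w'. feasible w' \<Longrightarrow> (\<Sum>e\<in>pairs V. w e) \<le> (\<Sum>e\<in>pairs V. w' e)"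
    using minimal_feasible_exists by blast
  have nonneg: "0 \<le> w e" if "e \<in> pairs T" for e by (rule w_nonneg_T[of w]) (use w that in auto)
  have degree: "(\<Sum>e\<in>{e \<in> pairs T. t \<in> e}. w e) = 2" if "t \<in> T" for t by (rule w_degree[of w]) (use w that in auto)
  have cost: "(\<Sum>e\<in>pairs T. w e * dist_pair e) \<le> M" by (rule w_cost_T[of w]) (use w in auto)
  have cut: "2 \<le> cut_value (pairs T) w S" if "steiner_set V T S" for S by (rule w_cut_T[of w]) (use w that in auto)
  have deg: "(\<Sum>x\<in>T - {t}. w {t, x}) = 2" if "t \<in> T" for t using degree[OF that] sum_pairs_star[OF that, of w] by simp
  show ?thesis
  proof (cases "card T = 2")
    case True
    then obtain a b where ab: "T = {a, b}" "a \<noteq> b" by (auto simp: card_2_iff)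
    have P: "pairs T = {{a, b}}" unfolding ab(1) using ab(2) by (auto simp: pairs_insert pairs_empty)
    \<comment> \<open>The only pair carries weight 2, so the tour goes along it and back.\<close>
    have "w {a, b} = 2" using deg[of a] ab by simp
    then have "2 * real (dist_pair {a, b}) \<le> M" using cost unfolding P by simp
    then show ?thesis using that[of "[a, b]"] ab by (simp add: insert_commute)
  next
    case False
    \<comment> \<open>With a third terminal present, \<open>{s, t}\<close> is a Steiner set, and its
      constraint \<open>4 - 2 * w {s, t} \<ge> 2\<close> is the upper bound.\<close>
    have le1: "w e \<le> 1" if e: "e \<in> pairs T" for e
    proof -
      obtain s t where st: "e = {s, t}" "s \<noteq> t" "s \<in> T" "t \<in> T" using e by (elim pairsE)
      have "T \<noteq> {s, t}" using False st(2) by auto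
      then obtain u where u: "u \<in> T" "u \<noteq> s" "u \<noteq> t" using st by blast
      have "steiner_set V T {s, t}" using st u TV by (auto simp: steiner_set_def)
      then have c2: "2 \<le> cut_value (pairs T) w {s, t}" by (rule cut)
      then show ?thesis using cut_value_doubleton_pairs[of s t T w] degree[OF st(3)] degree[OF st(4)] e st(1) by simp
    qed
    have "\<exists>ts. distinct ts \<and> set ts = T \<and> 3 \<le> length ts \<and> length ts \<le> 5 \<and> (\<forall>e\<in>tour_edges ts. 0 < w e) \<and>
      (\<forall>e\<in>pairs T - tour_edges ts. w e < 1)"
    proof -
      obtain ts where ts: "distinct ts" "set ts = T" using finite_distinct_list[of T] by auto
      then have "length ts = card T" by (simp add: distinct_card[symmetric])
      then have "length ts = 3 \<or> length ts = 4 \<or> length ts = 5" using False T2 T5 by linarith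
      then consider a b c where "ts = [a, b, c]" | a b c d where "ts = [a, b, c, d]" | a b c d e where "ts = [a, b, c, d, e]"
        by (auto simp: eval_nat_numeral length_Suc_conv)
      then show ?thesis
      proof cases
        case (1 a b c)
        then have T: "T = {a, b, c}" and d: "a \<noteq> b" "a \<noteq> c" "b \<noteq> c" using ts by auto
        \<comment> \<open>On three terminals the degree equations force all weights to be 1.\<close>
        have "w {a, b} + w {a, c} = 2" "w {b, a} + w {b, c} = 2" "w {c, a} + w {c, b} = 2"
          using deg[of a] deg[of b] deg[of c] d unfolding T by (simp_all add: insert_Diff_if)
        then have "w {a, b} = 1" "w {a, c} = 1" "w {b, c} = 1" by (simp_all add: insert_commute)
        moreover have "pairs T = {{a, b}, {a, c}, {b, c}}" unfolding T using d by (auto simp: pairs_insert pairs_empty)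
        ultimately show ?thesis using 1 ts d by (intro exI[of _ ts]) (auto simp: tour_edges_def insert_commute)
      next
        case (2 a b c d)
        then have T: "T = {a, b, c, d}" using ts by auto
        have "\<exists>ts. distinct ts \<and> set ts = {a, b, c, d} \<and> length ts = 4 \<and> (\<forall>e\<in>tour_edges ts. 0 < w e) \<and>
          (\<forall>e\<in>pairs {a, b, c, d} - tour_edges ts. w e < 1)"
          by (rule tour_through_support_4) (use ts 2 nonneg le1 degree in \<open>auto simp: T\<close>)
        then obtain ts' where "distinct ts'" "set ts' = T" "length ts' = 4" "\<forall>e\<in>tour_edges ts'. 0 < w e"
          "\<forall>e\<in>pairs T - tour_edges ts'. w e < 1" unfolding T by blast
        then show ?thesis by (intro exI[of _ ts']) auto
      next
        case (3 a b c d e)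
        then have T: "T = {a, b, c, d, e}" using ts by auto
        have "\<exists>ts. distinct ts \<and> set ts = {a, b, c, d, e} \<and> length ts = 5 \<and> (\<forall>e\<in>tour_edges ts. 0 < w e) \<and>
          (\<forall>x\<in>pairs {a, b, c, d, e} - tour_edges ts. w x < 1)"
          by (rule tour_through_support_5) (use ts 3 nonneg le1 degree in \<open>auto simp: T\<close>)
        then obtain ts' where "distinct ts'" "set ts' = T" "length ts' = 5" "\<forall>e\<in>tour_edges ts'. 0 < w e"
          "\<forall>e\<in>pairs T - tour_edges ts'. w e < 1" unfolding T by blast
        then show ?thesis by (intro exI[of _ ts']) auto
      qed
    qed
    then obtain ts where ts: "distinct ts" "set ts = T" "3 \<le> length ts" "length ts \<le> 5"
      "\<And>e. e \<in> tour_edges ts \<Longrightarrow> 0 < w e" "\<And>e. e \<in> pairs T - tour_edges ts \<Longrightarrow> w e < 1" by blast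
    have sub: "tour_edges ts \<subseteq> pairs T" using tour_edges_subset[OF ts(1)] ts(2,3) by simp
    \<comment> \<open>The family \<open>\<J>\<close> consists of the stars of the terminals, each of
      which the tour meets in two edges. Every vector satisfying degree equations and bounds
      satisfies the cut constraints and so costs at least \<open>M\<close>.\<close>
    have "sum (\<lambda>e. real (dist_pair e)) (tour_edges ts) \<le> M"
    proof (rule convex_position_bound[where I = "pairs T" and w = w and \<J> = "(\<lambda>t. {e \<in> pairs T. t \<in> e}) ` T"])
      fix J assume "J \<in> (\<lambda>t. {e \<in> pairs T. t \<in> e}) ` T"
      then obtain t where t: "t \<in> T" "J = {e \<in> pairs T. t \<in> e}" by auto
      have "J \<inter> tour_edges ts = {e \<in> tour_edges ts. t \<in> e}" using sub t(2) by auto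
      then show "J \<subseteq> pairs T \<and> sum w J = 2 \<and> card (J \<inter> tour_edges ts) = 2"
        using t degree[OF t(1)] card_tour_edges_at[OF ts(1,3,4)] ts(2) by auto
    next
      fix w' assume w': "\<And>i. i \<in> pairs T \<Longrightarrow> 0 \<le> w' i \<and> w' i \<le> 1"
        "\<And>J. J \<in> (\<lambda>t. {e \<in> pairs T. t \<in> e}) ` T \<Longrightarrow> sum w' J = (2::real)"
      show "M \<le> (\<Sum>i\<in>pairs T. w' i * real (dist_pair i))"
        using w' by (intro cost_lower_bound degree_cut_ge[OF T5 TV]) auto
    qed (use sub ts nonneg le1 cost in auto)
    then have "real (sum_list (map dist_pair (wedges (ts @ [hd ts])))) \<le> M"
      unfolding sum_tour_edges[OF ts(1,3), symmetric] of_nat_sum .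
    moreover have "ts \<noteq> []" using ts(3) by auto
    ultimately show ?thesis using that[of ts] ts(1,2) by blast
  qed
qed

section \<open>From a cheap tour to even integral weights\<close>

lemma walk_through_list:
  assumes "ts \<noteq> []" "set ts \<subseteq> V"
  shows "\<exists>vs. vs \<noteq> [] \<and> hd vs = hd ts \<and> last vs = last ts \<and> set ts \<subseteq> set vs \<and> set (wedges vs) \<subseteq> E \<and>
    wlen vs = sum_list (map dist_pair (wedges ts))"
  using assms
proof (induction ts rule: wedges.induct)
  case (1 a b ts)
  then obtain vs where vs: "vs \<noteq> []" "hd vs = b" "last vs = last (b # ts)" "set (b # ts) \<subseteq> set vs" "set (wedges vs) \<subseteq> E"
    "wlen vs = sum_list (map dist_pair (wedges (b # ts)))" by auto
  obtain p where p: "p \<noteq> []" "hd p = a" "last p = b" "set (wedges p) \<subseteq> E" "wlen p = dist_pair {a, b}"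
    using dist_pair_walk[of a b] 1(3) by auto
  obtain p' where p': "p = p' @ [b]" using p by (metis append_butlast_last_id)
  obtain vs' where vs': "vs = b # vs'" using vs by (cases vs) auto
  have w: "wedges (p' @ b # vs') = wedges p @ wedges vs" unfolding p' vs' by (rule wedges_append_common)
  have "wlen (p' @ b # vs') = wlen p + wlen vs" unfolding wlen_def w by simp
  moreover have "hd (p' @ b # vs') = a" using p(2) p' by (cases p') auto
  moreover have "a \<in> set (p' @ b # vs')" using p(2) p' by (cases p') auto
  ultimately show ?case using vs p w vs'
    by (intro exI[of _ "p' @ b # vs'"]) auto
next
  case ("2_2" v)
  then show ?case by (intro exI[of _ "[v]"]) (auto simp: wlen_def)
qed auto

lemma sum_count_list_edge_cut:
  "(\<Sum>e\<in>edge_cut E S. count_list es e) = length (filter (\<lambda>e. card (e \<inter> S) = 1) es)"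
  if "set es \<subseteq> E"
proof -
  have "(\<Sum>e\<in>edge_cut E S. count_list es e) = (\<Sum>e\<in>edge_cut E S. count_list (filter (\<lambda>e. card (e \<inter> S) = 1) es) e)"
    by (intro sum.cong) (auto simp: count_list_eq_length_filter edge_cut_def intro!: arg_cong[of _ _ length] filter_cong)
  also have "\<dots> = length (filter (\<lambda>e. card (e \<inter> S) = 1) es)"
    using that by (intro sum_count_set) (auto simp: edge_cut_def)
  finally show ?thesis .
qed

text \<open>A closed walk through all terminals crosses every set evenly and every Steiner set at
  least twice. At cost at most \<open>M\<close> it crosses the tight sets at most twice on average,
  hence each exactly twice, and uniqueness identifies its edge multiplicities \<open>k\<close> with
  \<open>c\<close>.\<close>

proposition even_integral_weights:
  assumes "card T \<le> 5"
  obtains k :: "'a set \<Rightarrow> nat" where "\<And>e. e \<in> E \<Longrightarrow> c e = real (k e)" "\<And>S. even (\<Sum>e\<in>edge_cut E S. k e)"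
proof -
  obtain ts where ts: "distinct ts" "ts \<noteq> []" "set ts = T" "real (sum_list (map dist_pair (wedges (ts @ [hd ts])))) \<le> M"
    using cheap_tour_exists[OF assms] .
  obtain vs where vs: "vs \<noteq> []" "hd vs = hd (ts @ [hd ts])" "last vs = last (ts @ [hd ts])" "set (ts @ [hd ts]) \<subseteq> set vs"
    "set (wedges vs) \<subseteq> E" "wlen vs = sum_list (map dist_pair (wedges (ts @ [hd ts])))"
    using walk_through_list[of "ts @ [hd ts]"] ts(2,3) TV hd_in_set[of ts] by auto
  define k where "k = count_list (wedges vs)"
  let ?cr = "\<lambda>S. length (filter (\<lambda>e. card (e \<inter> S) = 1) (wedges vs))"
  have kS: "(\<Sum>e\<in>edge_cut E S. k e) = ?cr S" for S
    unfolding k_def by (rule sum_count_list_edge_cut[OF vs(5)])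
  have ev: "even (?cr S)" for S
    using odd_crossings[OF vs(1), of S] vs(2,3,5) ts(2) sg by (auto simp: simple_graph_def)
  have ge2: "?cr S \<ge> 2" if S: "steiner_set V T S" for S
  proof -
    obtain s t where st: "s \<in> S" "t \<notin> S" "s \<in> T" "t \<in> T" using S by (auto simp: steiner_set_def)
    then have "(hd vs, s) \<in> reach (set (wedges vs))" "(hd vs, t) \<in> reach (set (wedges vs))"
      using reach_wedges[of vs "set (wedges vs)"] vs(1,4) ts(3) by auto
    then have "(s, t) \<in> reach (set (wedges vs))" by (rule reach_common_source)
    then obtain a b where ab: "{a, b} \<in> set (wedges vs)" "a \<in> S" "b \<notin> S"
      using reach_crossing[of s t _ S] st by blast
    then have "card ({a, b} \<inter> S) = 1" by (subst card_edge_inter) auto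
    then have "filter (\<lambda>e. card (e \<inter> S) = 1) (wedges vs) \<noteq> []"
      using ab(1) by (auto simp: filter_empty_conv)
    then have "?cr S \<noteq> 0" by simp
    then show ?thesis using ev[of S] by (cases "?cr S = 1") (simp, linarith)
  qed
  have "(\<Sum>S\<in>tights. real (?cr S)) \<le> (\<Sum>S\<in>tights. 2)"
  proof -
    have "(\<Sum>S\<in>tights. real (?cr S)) = real (wlen vs)" unfolding wlen_crossings by (rule of_nat_sum[symmetric])
    then show ?thesis using ts(4) vs(6) by (simp add: M_def)
  qed
  then have "(\<Sum>S\<in>tights. real (?cr S) - 2) \<le> 0" by (simp add: sum_subtractf)
  moreover have nn: "real (?cr S) - 2 \<ge> 0" if "S \<in> tights" for S
    using ge2[of S] that by (simp add: tights_def)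
  ultimately have "(\<Sum>S\<in>tights. real (?cr S) - 2) = 0" by (intro antisym sum_nonneg) auto
  then have tight: "real (?cr S) = 2" if "S \<in> tights" for S
    using nn that by (subst (asm) sum_nonneg_eq_0_iff) auto
  have "real (k e) = c e" if "e \<in> E" for e
  proof (rule uniq[of "\<lambda>e. real (k e)", OF _ that])
    fix S assume "steiner_set V T S" "cut_value E c S = 2"
    then have "S \<in> tights" by (simp add: tights_def)
    then show "cut_value E (\<lambda>e. real (k e)) S = 2"
      using tight[of S] kS[of S] by (simp add: cut_value_def flip: of_nat_sum)
  qed
  then show ?thesis using that[of k] kS ev by simp
qed

end

section \<open>Perturbations\<close>

lemma card_edge_cut_Un:
  assumes "A \<inter> B = {}"
  shows "card (edge_cut (A \<union> B) S) = card (edge_cut A (S :: 'a::finite set)) + card (edge_cut B S)"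
proof -
  have "edge_cut (A \<union> B) S = edge_cut A S \<union> edge_cut B S" "edge_cut A S \<inter> edge_cut B S = {}"
    using assms by (auto simp: edge_cut_def)
  then show ?thesis by (simp add: card_Un_disjoint)
qed

lemma edge_cut_mono: "A \<subseteq> B \<Longrightarrow> edge_cut A S \<subseteq> edge_cut B S"
  by (auto simp: edge_cut_def)

definition signed :: "'a set set \<Rightarrow> 'a set set \<Rightarrow> 'a set \<Rightarrow> real" where
  "signed A B e = (if e \<in> A then 1 else 0) - (if e \<in> B then 1 else 0)"

lemma cut_value_signed:
  fixes A :: "'a::finite set set"
  assumes "A \<subseteq> E" "B \<subseteq> E"
  shows "cut_value E (\<lambda>e. c e + signed A B e) S = cut_value E c S + real (card (edge_cut A S)) - real (card (edge_cut B S))"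
proof -
  have "(\<Sum>e\<in>edge_cut E S. if e \<in> F then 1 else 0 :: real) = real (card (edge_cut F S))" if "F \<subseteq> E" for F
  proof -
    have "edge_cut E S \<inter> F = edge_cut F S" using that by (auto simp: edge_cut_def)
    then show ?thesis by (simp add: sum.If_cases)
  qed
  then show ?thesis using assms
    by (simp add: cut_value_def signed_def sum.distrib sum_subtractf)
qed

lemma crossing_in_edge_cut:
  assumes "simple_graph V E" "F \<subseteq> E" "(a, b) \<in> reach F" "(a \<in> S) \<noteq> (b \<in> S)"
  shows "edge_cut F S \<noteq> {}"
proof -
  have *: "edge_cut F S \<noteq> {}" if xy: "(x, y) \<in> reach F" "x \<in> S" "y \<notin> S" for x y
  proof -
    obtain a b where ab: "{a, b} \<in> F" "a \<in> S" "b \<notin> S" using reach_crossing[OF xy] by blast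
    then have "card ({a, b} \<inter> S) = 1" by (subst card_edge_inter) auto
    then show ?thesis using ab(1) by (auto simp: edge_cut_def)
  qed
  show ?thesis using *[of a b] *[of b a] assms(3,4) reach_sym[OF assms(3)] by blast
qed

section \<open>Trading weights between edge sets\<close>

context extremal_weights
begin

text \<open>On a tight set the two perturbed values add up to 4. If both are at least 2, both equal
  2 and uniqueness applies.\<close>

lemma no_perturbation:
  assumes "\<And>S. steiner_set V T S \<Longrightarrow> 2 \<le> cut_value E (\<lambda>e. c e + z e) S"
    and "\<And>S. steiner_set V T S \<Longrightarrow> 2 \<le> cut_value E (\<lambda>e. c e - z e) S" and "e \<in> E"
  shows "z e = 0"
proof -
  have "c e + z e = c e"
  proof (rule uniq[of "\<lambda>e. c e + z e", OF _ assms(3)])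
    fix S assume S: "steiner_set V T S" "cut_value E c S = 2"
    then have "cut_value E (\<lambda>e. c e + z e) S + cut_value E (\<lambda>e. c e - z e) S = 4"
      by (simp add: cut_value_def sum.distrib sum_subtractf)
    then show "cut_value E (\<lambda>e. c e + z e) S = 2" using assms(1,2)[OF S(1)] by linarith
  qed
  then show ?thesis by simp
qed

end

locale even_extremal_weights = extremal_weights V E T c for V :: "'a::finite set" and E T c +
  fixes k :: "'a set \<Rightarrow> nat"
  assumes c_eq: "\<And>e. e \<in> E \<Longrightarrow> c e = real (k e)" and k_even: "\<And>S. even (\<Sum>e\<in>edge_cut E S. k e)"
begin

lemma c_ge_1: "e \<in> E \<Longrightarrow> c e \<ge> 1"
  using pos[of e] c_eq[of e] by simp

lemma cut_value_eq: "cut_value E c S = real (\<Sum>e\<in>edge_cut E S. k e)"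
  unfolding cut_value_def of_nat_sum using edge_cut_subset[of E S] by (intro sum.cong) (auto simp: c_eq)

text \<open>With \<open>?a\<close>, \<open>?b\<close>, \<open>?r\<close> cut edges in
  \<open>A\<close>, in \<open>B\<close> and elsewhere, weights of at least 1 give
  \<open>?n \<ge> ?a + ?b + ?r\<close>. Two edges elsewhere suffice. Otherwise the new value
  \<open>?n + ?a - ?b\<close> is even, and it is positive because it is at least
  \<open>2 * ?a + ?r\<close> and some cut edge lies outside \<open>B\<close>.\<close>

lemma perturbed_cut_ge:
  assumes A: "A \<subseteq> E" "B \<subseteq> E" "A \<inter> B = {}"
    and cut: "even (card (edge_cut A S) + card (edge_cut B S)) \<and> \<not> edge_cut E S \<subseteq> B \<or> card (edge_cut (E - (A \<union> B)) S) \<ge> 2"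
  shows "2 \<le> cut_value E (\<lambda>e. c e + signed A B e) S"
proof -
  let ?n = "\<Sum>e\<in>edge_cut E S. k e" and ?a = "card (edge_cut A S)" and ?b = "card (edge_cut B S)"
    and ?r = "card (edge_cut (E - (A \<union> B)) S)"
  have "E = (A \<union> B) \<union> (E - (A \<union> B))" using A by blast
  then have "card (edge_cut E S) = ?a + ?b + ?r"
    using card_edge_cut_Un[of "A \<union> B" "E - (A \<union> B)" S] card_edge_cut_Un[OF A(3), of S] by auto
  moreover have "card (edge_cut E S) \<le> ?n"
  proof -
    have "(\<Sum>e\<in>edge_cut E S. 1) \<le> ?n"
    proof (rule sum_mono)
      fix e assume "e \<in> edge_cut E S"
      then have "e \<in> E" using edge_cut_subset by blast
      then show "1 \<le> k e" using c_ge_1[of e] c_eq[of e] by simp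
    qed
    then show ?thesis by simp
  qed
  ultimately have n: "?n \<ge> ?a + ?b + ?r" by simp
  have "?n + ?a \<ge> ?b + 2"
  proof (cases "?r \<ge> 2")
    case False
    then have ev: "even (?a + ?b)" and ns: "\<not> edge_cut E S \<subseteq> B" using cut by auto
    then obtain e where "e \<in> edge_cut E S" "e \<notin> B" by auto
    then have "edge_cut A S \<noteq> {} \<or> edge_cut (E - (A \<union> B)) S \<noteq> {}" by (auto simp: edge_cut_def)
    then have "?a + ?r \<ge> 1" by (auto simp: card_gt_0_iff Suc_le_eq)
    moreover have "even ?n" by (rule k_even)
    moreover have "n + a \<ge> b + 2" if "a + r \<ge> 1" "even n" "n \<ge> a + b + r" "even (a + b)" for n a b r :: nat
      using that by presburger
    ultimately show ?thesis using n ev by blast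
  qed (use n in linarith)
  then have "real ?n + real ?a \<ge> real ?b + 2" by (metis of_nat_add of_nat_le_iff of_nat_numeral)
  then show ?thesis unfolding cut_value_signed[OF A(1,2)] cut_value_eq by linarith
qed

lemma signed_perturbation_trivial:
  assumes A: "A \<subseteq> E" "B \<subseteq> E" "A \<inter> B = {}"
    and AB: "\<And>S. steiner_set V T S \<Longrightarrow> even (card (edge_cut A S) + card (edge_cut B S)) \<and> \<not> edge_cut E S \<subseteq> B \<or> card (edge_cut (E - (A \<union> B)) S) \<ge> 2"
    and BA: "\<And>S. steiner_set V T S \<Longrightarrow> even (card (edge_cut A S) + card (edge_cut B S)) \<and> \<not> edge_cut E S \<subseteq> A \<or> card (edge_cut (E - (A \<union> B)) S) \<ge> 2"
  shows "A \<union> B = {}"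
proof -
  have z: "signed A B e = 0" if "e \<in> E" for e
  proof (rule no_perturbation[of "signed A B", OF _ _ that])
    fix S assume S: "steiner_set V T S"
    show "2 \<le> cut_value E (\<lambda>e. c e + signed A B e) S" by (rule perturbed_cut_ge[OF A AB[OF S]])
    have "2 \<le> cut_value E (\<lambda>e. c e + signed B A e) S"
      using BA[OF S] A by (intro perturbed_cut_ge) (auto simp: add.commute Un_commute)
    then show "2 \<le> cut_value E (\<lambda>e. c e - signed A B e) S" by (simp add: signed_def algebra_simps)
  qed
  show ?thesis
  proof (rule ccontr)
    assume "A \<union> B \<noteq> {}"
    then obtain e where e: "e \<in> A \<union> B" by auto
    then have "e \<in> E" "e \<notin> A \<or> e \<notin> B" using A by auto
    then show False using z[of e] e by (auto simp: signed_def)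
  qed
qed

text \<open>
  Three edge-disjoint paths between \<open>u\<close> and \<open>v\<close> leave a path with at most one terminal
  behind it, say at the node \<open>y\<close>; the two halves of that path at \<open>y\<close> can be traded.
\<close>

lemma no_theta:
  assumes T5: "card T \<le> 5" and uv: "u \<noteq> v"
    and P: "\<And>i. i \<in> {0, 1, 2 :: nat} \<Longrightarrow> P i \<noteq> [] \<and> hd (P i) = u \<and> last (P i) = v \<and> distinct (P i) \<and> set (wedges (P i)) \<subseteq> E"
    and disj: "\<And>i j. i \<in> {0, 1, 2} \<Longrightarrow> j \<in> {0, 1, 2} \<Longrightarrow> i \<noteq> j \<Longrightarrow> set (wedges (P i)) \<inter> set (wedges (P j)) = {}"
  shows False
proof -
  define W where "W i = set (wedges (P i))" for i
  \<comment> \<open>The nodes separated from \<open>u\<close> by deleting the edges of path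
    \<open>i\<close>. Its ends are not among them, as the other two paths remain; so these nodes are
    inner nodes of path \<open>i\<close> or hang off such nodes.\<close>
  define D where "D i = {x \<in> V. (u, x) \<notin> reach (E - W i)}" for i
  let ?F = "W 0 \<union> W 1 \<union> W 2" and ?N = "set (P 0) \<union> set (P 1) \<union> set (P 2)"
  have W: "W i \<subseteq> E" "i \<in> {0, 1, 2} \<Longrightarrow> j \<in> {0, 1, 2} \<Longrightarrow> i \<noteq> j \<Longrightarrow> W i \<inter> W j = {}" if "i \<in> {0, 1, 2}" for i j
    using P[OF that] disj[of i j] by (auto simp: W_def)
  have uN: "u \<in> set (P i)" "v \<in> set (P i)" if "i \<in> {0, 1, 2}" for i
    using P[OF that] hd_in_set[of "P i"] last_in_set[of "P i"] by auto
  have uV: "u \<in> V" "v \<in> V"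
  proof -
    have "\<Union>(W 0) = set (P 0)"
      unfolding W_def using P[of 0] uv by (intro Union_wedges) (cases "P 0" rule: wedges.cases; auto)
    then have "set (P 0) \<subseteq> V" using W(1)[of 0] sg by (auto simp: simple_graph_def)
    then show "u \<in> V" "v \<in> V" using uN[of 0] by auto
  qed
  have attach: "\<exists>y\<in>?N. (y, x) \<in> reach (E - ?F)" if "x \<in> V" for x
  proof (rule reach_attach)
    show "(u, x) \<in> reach E" using conn uV that by (auto simp: connected_graph_iff)
    show "u \<in> ?N" using uN[of 0] by auto
    show "\<Union>?F \<inter> \<Union>E \<subseteq> ?N" using wedges_subset by (fastforce simp: W_def)
  qed
  have along: "(u, y) \<in> reach (E - W i)" if "i \<in> {0, 1, 2}" "j \<in> {0, 1, 2}" "i \<noteq> j" "y \<in> set (P j)" for i j y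
  proof -
    have "set (wedges (P j)) \<subseteq> E - W i" using W(1)[of j] W(2)[of i j] that unfolding W_def by blast
    then show ?thesis using reach_wedges[of "P j" "E - W i" y] P[of j] that by auto
  qed
  have D_attach: "y \<in> set (P i)" if i: "i \<in> {0, 1, 2}" and xy: "x \<in> D i" "y \<in> ?N" "(y, x) \<in> reach (E - ?F)" for i x y
  proof (rule ccontr)
    assume "y \<notin> set (P i)"
    then obtain j where j: "j \<in> {0, 1, 2}" "j \<noteq> i" "y \<in> set (P j)" using xy(2) by auto
    have "(y, x) \<in> reach (E - W i)" by (rule reach_mono[OF _ xy(3)]) (use i in auto)
    with along[of i j y] j i have "(u, x) \<in> reach (E - W i)" by (blast intro: reach_trans)
    then show False using xy(1) by (simp add: D_def)
  qed
  have D_disj: "D i \<inter> D j = {}" if ij: "i \<in> {0, 1, 2}" "j \<in> {0, 1, 2}" "i \<noteq> j" for i j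
  proof (rule ccontr)
    assume "D i \<inter> D j \<noteq> {}"
    then obtain x where x: "x \<in> D i" "x \<in> D j" by auto
    then have "x \<in> V" by (simp add: D_def)
    then obtain y where y: "y \<in> ?N" "(y, x) \<in> reach (E - ?F)" using attach by blast
    have "y \<in> set (P i)" by (rule D_attach[OF ij(1) x(1) y])
    then have "(u, y) \<in> reach (E - W j)" using along[of j i y] ij by auto
    moreover have "(y, x) \<in> reach (E - W j)" by (rule reach_mono[OF _ y(2)]) (use ij in auto)
    ultimately have "(u, x) \<in> reach (E - W j)" by (rule reach_trans)
    then show False using x(2) by (simp add: D_def)
  qed
  \<comment> \<open>Three disjoint sets with two terminals each would need six terminals.\<close>
  have "\<exists>i\<in>{0, 1, 2}. card (D i \<inter> T) \<le> 1"
  proof (rule ccontr)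
    assume "\<not> ?thesis"
    then have ge: "card (D 0 \<inter> T) \<ge> 2" "card (D 1 \<inter> T) \<ge> 2" "card (D 2 \<inter> T) \<ge> 2" by force+
    have "card (D 0 \<inter> T \<union> D 1 \<inter> T \<union> D 2 \<inter> T) = card (D 0 \<inter> T) + card (D 1 \<inter> T) + card (D 2 \<inter> T)"
      using D_disj[of 0 1] D_disj[of 0 2] D_disj[of 1 2] by (subst card_Un_disjoint; auto)+
    moreover have "card (D 0 \<inter> T \<union> D 1 \<inter> T \<union> D 2 \<inter> T) \<le> card T" by (rule card_mono) auto
    ultimately show False using ge T5 by linarith
  qed
  then obtain i where i: "i \<in> {0, 1, 2}" "card (D i \<inter> T) \<le> 1" by blast
  \<comment> \<open>If \<open>D i\<close> has no terminal, any node of the path may serve as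
    \<open>y\<close>, even an end, in which case one of the two halves is empty.\<close>
  have "\<exists>y\<in>set (P i). \<forall>t\<in>D i \<inter> T. (y, t) \<in> reach (E - W i)"
  proof (cases "D i \<inter> T = {}")
    case True
    then show ?thesis using uN[OF i(1)] by auto
  next
    case False
    then have "card (D i \<inter> T) \<noteq> 0" by simp
    then have "card (D i \<inter> T) = 1" using i(2) by linarith
    then obtain t where t: "D i \<inter> T = {t}" by (auto simp: card_1_singleton_iff)
    then have tD: "t \<in> D i" by auto
    then obtain y where y: "y \<in> ?N" "(y, t) \<in> reach (E - ?F)" using attach[of t] by (auto simp: D_def)
    have "y \<in> set (P i)" by (rule D_attach[OF i(1) tD y])
    moreover have "(y, t) \<in> reach (E - W i)" by (rule reach_mono[OF _ y(2)]) (use i in auto)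
    ultimately show ?thesis using t by auto
  qed
  then obtain y where y: "y \<in> set (P i)" "\<And>t. t \<in> D i \<inter> T \<Longrightarrow> (y, t) \<in> reach (E - W i)" by blast
  obtain xs ys where xy: "P i = xs @ y # ys" using y(1) by (meson split_list)
  define A where "A = set (wedges (xs @ [y]))"
  define B where "B = set (wedges (y # ys))"
  have Pi: "hd (P i) = u" "last (P i) = v" "distinct (P i)" using P[OF i(1)] by auto
  have wed: "wedges (P i) = wedges (xs @ [y]) @ wedges (y # ys)" unfolding xy by (rule wedges_append_common)
  then have WAB: "W i = A \<union> B" by (simp add: W_def A_def B_def)
  have AB: "A \<inter> B = {}" using distinct_wedges[OF Pi(3)] unfolding wed A_def B_def by simp
  have parA: "odd (card (edge_cut A S)) \<longleftrightarrow> (u \<in> S) \<noteq> (y \<in> S)" for S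
    using odd_card_edge_cut_path[of "xs @ [y]" S] Pi unfolding A_def xy by (cases xs) auto
  have parB: "odd (card (edge_cut B S)) \<longleftrightarrow> (y \<in> S) \<noteq> (v \<in> S)" for S
    using odd_card_edge_cut_path[of "y # ys" S] Pi unfolding B_def xy by auto
  obtain j l where jl: "j \<in> {0, 1, 2}" "l \<in> {0, 1, 2}" "j \<noteq> i" "l \<noteq> i" "j \<noteq> l"
  proof -
    have "i = 0 \<or> i = 1 \<or> i = 2" using i(1) by auto
    then show ?thesis using that[of 1 2] that[of 0 2] that[of 0 1] by auto
  qed
  have uvr: "(u, v) \<in> reach (E - W i)" using along[of i j v] i jl uN[of j] by auto
  have attached: "(u, t) \<in> reach (E - W i) \<or> (y, t) \<in> reach (E - W i)" if "t \<in> T" for t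
    using y(2)[of t] that TV by (auto simp: D_def)
  \<comment> \<open>If \<open>S\<close> separates \<open>u\<close> and \<open>v\<close>, the other
    two paths each cross it. Otherwise \<open>A\<close> and \<open>B\<close> are crossed with equal
    parity. A cut inside one half leaves the other half uncrossed, so \<open>y\<close> is on the
    side of \<open>u\<close>; then so is every terminal, being linked to \<open>u\<close> or
    \<open>y\<close> outside path \<open>i\<close>.\<close>
  have main: "even (card (edge_cut A S) + card (edge_cut B S)) \<and> \<not> edge_cut E S \<subseteq> A \<and> \<not> edge_cut E S \<subseteq> B
      \<or> card (edge_cut (E - (A \<union> B)) S) \<ge> 2" if S: "steiner_set V T S" for S
  proof (cases "(u \<in> S) = (v \<in> S)")
    case False
    have odd: "odd (card (edge_cut (W n) S))" if "n \<in> {0, 1, 2}" for n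
      using odd_card_edge_cut_path[of "P n" S] P[OF that] False by (simp add: W_def)
    have "card (edge_cut (W j) S) \<ge> 1" "card (edge_cut (W l) S) \<ge> 1"
      using odd[OF jl(1)] odd[OF jl(2)] by (auto elim: oddE)
    then have "card (edge_cut (W j \<union> W l) S) \<ge> 2"
      using card_edge_cut_Un[OF W(2)[of j l]] jl by auto
    moreover have "W j \<union> W l \<subseteq> E - (A \<union> B)"
      using W(1)[of j] W(1)[of l] W(2)[of i j] W(2)[of i l] i jl unfolding WAB by blast
    then have "card (edge_cut (W j \<union> W l) S) \<le> card (edge_cut (E - (A \<union> B)) S)"
      by (intro card_mono edge_cut_mono) auto
    ultimately show ?thesis by linarith
  next
    case True
    have ev: "even (card (edge_cut A S) + card (edge_cut B S))" using parA[of S] parB[of S] True by auto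
    have "\<not> edge_cut E S \<subseteq> F" if F: "F = A \<or> F = B" for F
    proof
      assume sub: "edge_cut E S \<subseteq> F"
      have "edge_cut A S = {} \<or> edge_cut B S = {}"
        using sub AB F edge_cut_mono[of A E S] edge_cut_mono[of B E S] edge_cut_subset[of A S] edge_cut_subset[of B S] W(1)[OF i(1)] WAB
        by blast
      then have yS: "(y \<in> S) = (u \<in> S)" using parA[of S] parB[of S] True by auto
      obtain t where t: "t \<in> T" "(t \<in> S) \<noteq> (u \<in> S)" using S by (auto simp: steiner_set_def)
      then have "edge_cut (E - W i) S \<noteq> {}"
        using attached[OF t(1)] yS crossing_in_edge_cut[OF sg, of "E - W i"] by blast
      then show False using sub F WAB by (auto simp: edge_cut_def)
    qed
    then show ?thesis using ev by blast
  qed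
  have "A \<union> B = {}"
  proof (rule signed_perturbation_trivial[OF _ _ AB])
    show "A \<subseteq> E" "B \<subseteq> E" using W(1)[OF i(1)] WAB by auto
  qed (use main in blast)+
  then have "wedges (P i) = []" using WAB by (simp add: W_def)
  then show False using Pi uv P[OF i(1)] by (cases "P i" rule: wedges.cases) auto
qed

lemma ear_free: 
  assumes "card T \<le> 5"
  shows "ear_free E"
  unfolding ear_free_def
proof (intro allI impI, rule ccontr)
  fix C u v assume C: "is_cycle E C" "u \<in> \<Union>C" "v \<in> \<Union>C" "(u, v) \<in> reach (E - C)" "u \<noteq> v"
  obtain p q where pq: "distinct p" "hd p = u" "last p = v" "distinct q" "hd q = v" "last q = u"
    "p \<noteq> []" "q \<noteq> []" "C = set (wedges p) \<union> set (wedges q)" "set (wedges p) \<inter> set (wedges q) = {}"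
    using cycle_arcs[OF C(1-3,5)] .
  obtain r where r: "r \<noteq> []" "hd r = u" "last r = v" "distinct r" "set (wedges r) \<subseteq> E - C"
    using distinct_path_exists[OF C(4)] by blast
  define P where "P i = (if i = 0 then r else if i = 1 then p else rev q)" for i :: nat
  show False
  proof (rule no_theta[OF assms C(5), of P])
    fix i :: nat
    show "P i \<noteq> [] \<and> hd (P i) = u \<and> last (P i) = v \<and> distinct (P i) \<and> set (wedges (P i)) \<subseteq> E"
      using pq r cycle_subset[OF C(1)] by (auto simp: P_def hd_rev last_rev wedges_rev)
    fix j assume "i \<in> {0, 1, 2}" "j \<in> {0, 1, 2}" "i \<noteq> j"
    then show "set (wedges (P i)) \<inter> set (wedges (P j)) = {}"
      using pq(9,10) r(5) by (auto simp: P_def wedges_rev)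
  qed
qed

text \<open>Otherwise the weight of the only edge \<open>e\<close> at \<open>v\<close> could be
  changed by 1 in both directions: if \<open>e\<close> leaves a Steiner set, moving \<open>v\<close>
  to the other side gives a Steiner set whose cut is the old one without \<open>e\<close>. So the
  old value is at least \<open>2 + c e \<ge> 3\<close>.\<close>

lemma leaf_is_terminal:
  assumes v: "v \<in> V" "node_degree E v = 1"
  shows "v \<in> T"
proof (rule ccontr)
  assume vT: "v \<notin> T"
  obtain e where e: "{e \<in> E. v \<in> e} = {e}" using v(2) by (auto simp: node_degree_def card_1_singleton_iff)
  then have eE: "e \<in> E" "v \<in> e" by auto
  have sE: "signed {e} {} e = 0"
  proof (rule no_perturbation[of "signed {e} {}", OF _ _ eE(1)])
    fix S assume S: "steiner_set V T S"
    have none: "edge_cut {} S = {}" by (simp add: edge_cut_def)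
    show "2 \<le> cut_value E (\<lambda>f. c f + signed {e} {} f) S"
      using feas[OF S] eE by (subst cut_value_signed) (auto simp: none)
    have "2 \<le> cut_value E (\<lambda>f. c f + signed {} {e} f) S"
    proof (cases "e \<in> edge_cut E S")
      case False
      then have "edge_cut {e} S = {}" using eE by (auto simp: edge_cut_def)
      then show ?thesis using feas[OF S] eE none by (subst cut_value_signed) auto
    next
      case True
      define S' where "S' = (if v \<in> S then S - {v} else insert v S)"
      have "steiner_set V T S'" using S v(1) vT by (auto simp: S'_def steiner_set_def)
      then have "2 \<le> cut_value E c S'" by (rule feas)
      moreover have "edge_cut E S' = edge_cut E S - {e}"
      proof -
        have off: "f \<inter> S' = f \<inter> S" if "f \<in> E" "f \<noteq> e" for f
          using that e by (auto simp: S'_def)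
        obtain a b where ab: "e = {a, b}" "a \<noteq> b" using simple_graph_edgeE[OF sg eE(1)] by metis
        then have "card (e \<inter> S') \<noteq> 1"
          using True eE(2) card_edge_inter[OF ab(2), of S'] card_edge_inter[OF ab(2), of S]
          by (auto simp: S'_def edge_cut_def)
        then have "f \<in> edge_cut E S' \<longleftrightarrow> f \<in> edge_cut E S - {e}" for f
          using off[of f] by (cases "f = e") (simp_all add: edge_cut_def cong: conj_cong)
        then show ?thesis by blast
      qed
      moreover have "cut_value E c S = c e + sum c (edge_cut E S - {e})"
        unfolding cut_value_def using True by (simp add: sum.remove)
      ultimately have "cut_value E c S \<ge> 3" using c_ge_1[OF eE(1)] by (simp add: cut_value_def)
      moreover have "card (edge_cut {e} S) \<le> 1" using card_mono[of "{e}" "edge_cut {e} S"] edge_cut_subset[of "{e}" S] by simp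
      ultimately show ?thesis using eE by (subst cut_value_signed) (auto simp: none)
    qed
    then show "2 \<le> cut_value E (\<lambda>f. c f - signed {e} {} f) S" by (simp add: signed_def)
  qed
  then show False by (simp add: signed_def)
qed

lemma cycle_special_nodes:
  assumes "card T \<le> 5" and C: "is_cycle E C"
  shows "card {v \<in> \<Union>C. cut_node V E v \<or> v \<in> T} \<ge> 3"
proof (rule ccontr)
  let ?S = "{v \<in> \<Union>C. cut_node V E v \<or> v \<in> T}"
  assume "\<not> card ?S \<ge> 3"
  then have c2: "card ?S \<le> 2" by simp
  have CE: "C \<subseteq> E" by (rule cycle_subset[OF C])
  have CV: "\<Union>C \<subseteq> V" using CE sg by (auto simp: simple_graph_def)
  obtain f where f: "f \<in> C" using cycle_nonempty[OF C] by blast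
  then obtain a b where ab: "f = {a, b}" "a \<noteq> b" using simple_graph_edgeE[OF sg] CE by (metis subsetD)
  have abC: "a \<in> \<Union>C" "b \<in> \<Union>C" using f ab by auto
  \<comment> \<open>All special nodes are among \<open>u\<close> and \<open>v\<close>; if there are
    fewer than two, ends of an edge of \<open>C\<close> fill up.\<close>
  obtain u v where uv: "u \<in> \<Union>C" "v \<in> \<Union>C" "u \<noteq> v" "?S \<subseteq> {u, v}"
  proof -
    have "card ?S = 0 \<or> card ?S = 1 \<or> card ?S = 2" using c2 by linarith
    then consider "?S = {}" | s where "?S = {s}" | s t where "?S = {s, t}" "s \<noteq> t"
      by (auto simp: card_1_singleton_iff card_2_iff)
    then show ?thesis
    proof cases
      case 1
      then show ?thesis using that[of a b] abC ab(2) by blast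
    next
      case (2 s)
      then have "s \<in> \<Union>C" by blast
      then show ?thesis using that[of s a] that[of s b] 2 abC ab(2) by blast
    next
      case (3 s t)
      then have "s \<in> \<Union>C" "t \<in> \<Union>C" by blast+
      then show ?thesis using that[of s t] 3 by blast
    qed
  qed
  obtain p q where pq: "distinct p" "hd p = u" "last p = v" "distinct q" "hd q = v" "last q = u"
    "p \<noteq> []" "q \<noteq> []" "C = set (wedges p) \<union> set (wedges q)" "set (wedges p) \<inter> set (wedges q) = {}"
    using cycle_arcs[OF C uv(1-3)] .
  define A where "A = set (wedges p)"
  define B where "B = set (wedges q)"
  have AB: "A \<inter> B = {}" "C = A \<union> B" using pq by (auto simp: A_def B_def)
  have par: "odd (card (edge_cut A S)) \<longleftrightarrow> (u \<in> S) \<noteq> (v \<in> S)" "odd (card (edge_cut B S)) \<longleftrightarrow> (u \<in> S) \<noteq> (v \<in> S)" for S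
    using odd_card_edge_cut_path[of p S] odd_card_edge_cut_path[of q S] pq by (auto simp: A_def B_def)
  have main: "\<not> edge_cut E S \<subseteq> F" if S: "steiner_set V T S" and F: "F = A \<or> F = B" for S F
  proof
    assume sub: "edge_cut E S \<subseteq> F"
    show False
    proof (cases "(u \<in> S) = (v \<in> S)")
      case False
      then have "odd (card (edge_cut A S))" "odd (card (edge_cut B S))" using par[of S] by simp_all
      then have "edge_cut A S \<noteq> {}" "edge_cut B S \<noteq> {}" by (metis card.empty even_zero)+
      then show False
        using sub AB F edge_cut_mono[of A E S] edge_cut_mono[of B E S] edge_cut_subset[of A S] edge_cut_subset[of B S] CE
        by blast
    next
      case True
      \<comment> \<open>Now \<open>u\<close> and \<open>v\<close> are on one side and no edge
        outside \<open>C\<close> is cut. A terminal \<open>t\<close> on the other side hangs off a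
        node \<open>y\<close> of \<open>C\<close> that is not special. As \<open>y\<close> is no cut
        node, \<open>t\<close> is linked to \<open>u\<close> without \<open>y\<close> and hence
        hangs off a second node of \<open>C\<close>, against ear-freeness.\<close>
      obtain t where t: "t \<in> T" "(t \<in> S) \<noteq> (u \<in> S)" using S by (auto simp: steiner_set_def)
      have "u \<in> V" "t \<in> V" using uv(1) CV t TV by auto
      then have "(u, t) \<in> reach E" using conn by (auto simp: connected_graph_iff)
      then obtain y where y: "y \<in> \<Union>C" "(y, t) \<in> reach (E - C)"
        using reach_attach[of u t E "\<Union>C" C] uv(1) by auto
      have "edge_cut (E - C) S = {}" using sub F AB by (auto simp: edge_cut_def)
      then have "(y \<in> S) = (t \<in> S)"
        using crossing_in_edge_cut[OF sg _ y(2), of S] by blast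
      then have "y \<noteq> u" "y \<noteq> v" using t(2) True by auto
      then have "y \<notin> ?S" using uv(4) by blast
      then have "\<not> cut_node V E y" "y \<noteq> t" using y(1) t(1) by auto
      then have "(u, t) \<in> reach {e \<in> E. y \<notin> e}"
        using y(1) CV \<open>u \<in> V\<close> \<open>t \<in> V\<close> \<open>y \<noteq> u\<close> by (auto simp: cut_node_def connected_graph_iff)
      then obtain y' where y': "y' \<in> \<Union>C - {y}" "(y', t) \<in> reach ({e \<in> E. y \<notin> e} - C)"
        using reach_attach[of u t "{e \<in> E. y \<notin> e}" "\<Union>C - {y}" C] uv(1) \<open>y \<noteq> u\<close> by auto
      have "(y', t) \<in> reach (E - C)" by (rule reach_mono[OF _ y'(2)]) auto
      then have "(y', y) \<in> reach (E - C)" using y(2) by (rule reach_common_target)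
      then have "y' = y" using ear_free[OF assms(1)] C y(1) y'(1) unfolding ear_free_def by blast
      then show False using y'(1) by simp
    qed
  qed
  have "A \<union> B = {}"
  proof (rule signed_perturbation_trivial[OF _ _ AB(1)])
    show "A \<subseteq> E" "B \<subseteq> E" using CE AB by auto
    have ev: "even (card (edge_cut A S) + card (edge_cut B S))" for S using par[of S] by auto
    show "even (card (edge_cut A S) + card (edge_cut B S)) \<and> \<not> edge_cut E S \<subseteq> B \<or> card (edge_cut (E - (A \<union> B)) S) \<ge> 2"
      "even (card (edge_cut A S) + card (edge_cut B S)) \<and> \<not> edge_cut E S \<subseteq> A \<or> card (edge_cut (E - (A \<union> B)) S) \<ge> 2"
      if "steiner_set V T S" for S using main[OF that] ev by auto
  qed
  then show False using f AB by auto
qed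

end

section \<open>From facet weights to trees and cacti, and the equivalence\<close>

lemma facet_weights_extremal:
  assumes G: "steiner_graph V E T" and fw: "facet_weights V E T c"
  shows "extremal_weights V E T (\<lambda>e. 2 / min_steiner_cut V E T c * c $ e)"
proof
  define \<gamma> where "\<gamma> = min_steiner_cut V E T c"
  have \<gamma>: "\<gamma> > 0" and pos: "\<forall>e\<in>E. c $ e > 0" using fw by (auto simp: facet_weights_def \<gamma>_def)
  have cv: "cut_value E (\<lambda>e. a * x e) S = a * cut_value E x S" for a x S
    by (simp add: cut_value_def sum_distrib_left)
  show "steiner_graph V E T" by (rule G)
  show "0 < 2 / min_steiner_cut V E T c * c $ e" if "e \<in> E" for e
    using that pos \<gamma> by (simp add: \<gamma>_def)
  show "2 \<le> cut_value E (\<lambda>e. 2 / min_steiner_cut V E T c * c $ e) S" if "steiner_set V T S" for S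
    using min_steiner_cut_le[OF that, of E c] \<gamma> unfolding cv by (simp add: \<gamma>_def field_simps)
  fix x e
  assume x: "\<And>S. steiner_set V T S \<Longrightarrow> cut_value E (\<lambda>e. 2 / min_steiner_cut V E T c * c $ e) S = 2 \<Longrightarrow> cut_value E x S = 2"
    and e: "e \<in> E"
  \<comment> \<open>Scaling \<open>x\<close> back by \<open>\<gamma> / 2\<close> turns the equations
    with right-hand side 2 into those of the facet.\<close>
  have "\<gamma> / 2 * x e = c $ e"
  proof (rule facet_weights_unique[OF G fw _ e])
    fix S assume S: "steiner_set V T S" "cut_value E (\<lambda>e. c $ e) S = min_steiner_cut V E T c"
    then have "cut_value E x S = 2" using x[OF S(1)] \<gamma> unfolding cv by (simp add: \<gamma>_def)
    then show "cut_value E (\<lambda>e. \<gamma> / 2 * x e) S = min_steiner_cut V E T c" unfolding cv by (simp add: \<gamma>_def)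
  qed
  then show "x e = 2 / min_steiner_cut V E T c * c $ e" using \<gamma> by (simp add: \<gamma>_def field_simps)
qed

lemma facet_inducing_imp:
  assumes fi: "facet_inducing V E T" and T5: "card T \<le> 5"
  shows "steiner_tree V E T \<or> steiner_cactus V E T"
proof -
  obtain c where G: "steiner_graph V E T" and fw: "facet_weights V E T c" using fi by (auto simp: facet_inducing_def)
  interpret extremal_weights V E T "\<lambda>e. 2 / min_steiner_cut V E T c * c $ e"
    by (rule facet_weights_extremal[OF G fw])
  obtain k where k: "\<And>e. e \<in> E \<Longrightarrow> 2 / min_steiner_cut V E T c * c $ e = real (k e)"
    "\<And>S. even (\<Sum>e\<in>edge_cut E S. k e)" using even_integral_weights[OF T5] by blast
  interpret even_extremal_weights V E T "\<lambda>e. 2 / min_steiner_cut V E T c * c $ e" k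
    by unfold_locales (use k in auto)
  have deg: "\<forall>v\<in>V. node_degree E v = 1 \<longrightarrow> v \<in> T" using leaf_is_terminal by blast
  show ?thesis
  proof (cases "\<exists>C. is_cycle E C")
    case False
    then show ?thesis using G deg sg conn by (auto simp: steiner_tree_def tree_def)
  next
    case True
    have "C = C'" if "is_cycle E C" "e \<in> C" "is_cycle E C'" "e \<in> C'" for e C C'
      using unique_cyclesI_ear_free[OF ear_free[OF T5] that(1,3,2,4)]
        unique_cyclesI_ear_free[OF ear_free[OF T5] that(3,1,4,2)] by blast
    then have "cactus V E" using True sg conn unfolding cactus_def by blast
    then show ?thesis using G deg cycle_special_nodes[OF T5] by (auto simp: steiner_cactus_def)
  qed
qed

theorem theorem6:
  fixes V :: "('a::finite) set" and E :: "'a set set" and T :: "'a set"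
  assumes "steiner_graph V E T" and "card T \<le> 5"
  shows "facet_inducing V E T \<longleftrightarrow> steiner_tree V E T \<or> steiner_cactus V E T"
  using facet_inducing_imp[OF _ assms(2)] steiner_tree_facet_inducing steiner_cactus_facet_inducing by blast

end
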